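(* Let $\nu\in\mathbb{R}$, $N\ge1$ an integer and $\beta>0$. If $\beta<\frac1N$, then $Z_\beta=i\beta\mathbb{Z}$ is a sampling sequence for $\mathbf{F}_\nu^{(N)}(\mathbb{C}/\mathbb{Z})$.
   Context: $\mathbf{F}_\nu^{(N)}(\mathbb{C}/\mathbb{Z})$ is the Hilbert space of functions $F:\mathbb{C}\to\mathbb{C}$ with $\partial_{\overline z}^NF=0$, $F(z+k)=e^{2\pi ik\nu}e^{\pi kz+\frac{\pi}{2}k^2}F(z)$ for all $z\in\mathbb{C}$, $k\in\mathbb{Z}$, and $\|F\|^2=\int_{[0,1)\times\mathbb{R}}|F(z)|^2e^{-\pi|z|^2}dz<\infty$ (with $z=x+i\xi\equiv(x,\xi)$ and $dz$ Lebesgue measure). A set $Z\subset[0,1)\times\mathbb{R}$ is sampling for this space if there are $A,B>0$ such that $A\|F\|^2\le\sum_{z\in Z}|F(z)|^2e^{-\pi|z|^2}\le B\|F\|^2$ for all $F\in\mathbf{F}_\nu^{(N)}(\mathbb{C}/\mathbb{Z})$. *)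

theory Defs
  imports "HOL-Complex_Analysis.Complex_Analysis"
begin

text \<open>The Wirtinger operator \<open>(\<partial>\<^sub>x + i \<partial>\<^sub>\<xi>) / 2\<close> in the coordinates \<open>z = x + i \<xi>\<close>; the Frechet
  derivative is the real one, so it can be evaluated in the directions \<open>1\<close> and \<open>i\<close>.\<close>

definition dbar :: "(complex \<Rightarrow> complex) \<Rightarrow> complex \<Rightarrow> complex" where
  "dbar F z = (frechet_derivative F (at z) 1 + \<i> * frechet_derivative F (at z) \<i>) / 2"

text \<open>Since \<^const>\<open>frechet_derivative\<close> is unspecified at points of non-differentiability, real
  differentiability of the successive iterates is demanded explicitly. Nothing more is needed:
  real differentiability together with a vanishing Wirtinger derivative already means
  holomorphic, and inductively these functions are exactly the smooth solutions of
  \<open>dbar\<^sup>N F = 0\<close>.\<close>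

definition polyanalytic :: "nat \<Rightarrow> (complex \<Rightarrow> complex) \<Rightarrow> bool" where
  "polyanalytic N F \<longleftrightarrow>
     (\<forall>j<N. (dbar ^^ j) F differentiable_on UNIV) \<and> (\<forall>z. (dbar ^^ N) F z = 0)"

lemma polyanalytic_1_iff_entire: "polyanalytic 1 F \<longleftrightarrow> F holomorphic_on UNIV"
proof
  assume P: "polyanalytic 1 F"
  have "F field_differentiable (at z)" for z
  proof -
    define D where "D = frechet_derivative F (at z)"
    have "F differentiable (at z)"
      using P by (simp add: polyanalytic_def differentiable_on_def)
    then have d: "(F has_derivative D) (at z)"
      unfolding D_def by (simp add: frechet_derivative_works)
    have "dbar F z = 0"
      using P by (simp add: polyanalytic_def)
    then have "D 1 + \<i> * D \<i> = 0"
      by (simp add: dbar_def D_def)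
    then have "\<i> * (D 1 + \<i> * D \<i>) = 0"
      by (simp only: mult_zero_right)
    then have i: "D \<i> = \<i> * D 1"
      by (simp add: distrib_left flip: mult.assoc)
    have lin: "linear D"
      using d has_derivative_linear by blast
    have "D w = D 1 * w" for w
    proof -
      have w: "w = Re w *\<^sub>R 1 + Im w *\<^sub>R \<i>"
        by (simp add: complex_eq_iff)
      have "D w = D (Re w *\<^sub>R 1 + Im w *\<^sub>R \<i>)"
        by (rule arg_cong[OF w])
      also have "\<dots> = Re w *\<^sub>R D 1 + Im w *\<^sub>R D \<i>"
        by (simp only: linear_add[OF lin] linear_scale[OF lin])
      also have "\<dots> = D 1 * (Re w *\<^sub>R 1 + Im w *\<^sub>R \<i>)"
        unfolding i by (simp only: distrib_left mult_scaleR_right mult_1_right mult_1_left mult.commute)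
      also have "\<dots> = D 1 * w"
        by (rule arg_cong[OF w[symmetric]])
      finally show ?thesis .
    qed
    then have "D = (*) (D 1)"
      by (rule ext)
    then have "(F has_field_derivative D 1) (at z)"
      unfolding has_field_derivative_def using d
      by (rule subst[where P = "\<lambda>T. (F has_derivative T) (at z)"])
    then show ?thesis
      unfolding field_differentiable_def by blast
  qed
  then show "F holomorphic_on UNIV"
    by (simp add: holomorphic_on_def)
next
  assume H: "F holomorphic_on UNIV"
  have d: "(F has_derivative (*) (deriv F z)) (at z)" for z
    using holomorphic_derivI[OF H open_UNIV UNIV_I] has_field_derivative_imp_has_derivative
    by blast
  have "dbar F z = 0" for z
    unfolding dbar_def frechet_derivative_at[OF d, symmetric]
    by (simp add: mult.left_commute[of \<i>])
  moreover have "F differentiable_on UNIV"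
    using d unfolding differentiable_on_def differentiable_def by blast
  ultimately show "polyanalytic 1 F"
    by (simp add: polyanalytic_def)
qed

definition strip :: "complex set" where
  "strip = {z. 0 \<le> Re z \<and> Re z < 1}"

definition fock_weighted :: "(complex \<Rightarrow> complex) \<Rightarrow> complex \<Rightarrow> real" where
  "fock_weighted F z = (norm (F z))\<^sup>2 * exp (- pi * (norm z)\<^sup>2)"

definition fock_norm_sq :: "(complex \<Rightarrow> complex) \<Rightarrow> real" where
  "fock_norm_sq F = set_lebesgue_integral lborel strip (fock_weighted F)"

definition fock_space :: "real \<Rightarrow> nat \<Rightarrow> (complex \<Rightarrow> complex) set" where
  "fock_space \<nu> N =
     {F. polyanalytic N F \<and>
         (\<forall>z. \<forall>k::int. F (z + of_int k) =
            exp (2 * of_real pi * \<i> * of_int k * of_real \<nu>) *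
            exp (of_real pi * of_int k * z + of_real pi / 2 * (of_int k)\<^sup>2) * F z) \<and>
         set_integrable lborel strip (fock_weighted F)}"

text \<open>Summability is part of the upper bound: \<^const>\<open>infsum\<close> of a divergent family is \<open>0\<close>.\<close>

definition sampling :: "real \<Rightarrow> nat \<Rightarrow> complex set \<Rightarrow> bool" where
  "sampling \<nu> N Z \<longleftrightarrow> Z \<subseteq> strip \<and>
     (\<exists>A>0. \<exists>B>0. \<forall>F\<in>fock_space \<nu> N.
        fock_weighted F summable_on Z \<and>
        A * fock_norm_sq F \<le> infsum (fock_weighted F) Z \<and>
        infsum (fock_weighted F) Z \<le> B * fock_norm_sq F)"

end

theory Submission
  imports Defs
begin

text \<open>After multiplication by \<open>exp (- \<pi> z\<^sup>2 / 2 - 2 \<pi> \<i> \<nu> z)\<close> a function \<open>F\<close> of the space is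
  \<open>1\<close>-periodic and a polynomial of degree below \<open>N\<close> in \<open>Im z\<close> with periodic entire coefficients.
  Fourier expansion gives, for \<open>z = x + \<i> y\<close>, that \<open>\<bar>F z\<bar>\<^sup>2 exp (- \<pi> \<bar>z\<bar>\<^sup>2)\<close> is the squared modulus
  of \<open>\<Sum>\<^sub>k Q\<^sub>k(y + k + \<nu>) \<phi>(y + k + \<nu>) exp (2 \<pi> \<i> k x)\<close>, where \<open>\<phi> t = exp (- \<pi> t\<^sup>2)\<close> and the \<open>Q\<^sub>k\<close> are
  polynomials of degree below \<open>N\<close> (\<open>fock_space_coefficients\<close>). By Parseval the squared norm of \<open>F\<close>
  is the sum of the energies \<open>\<integral> \<bar>Q\<^sub>k\<bar>\<^sup>2 \<phi>\<^sup>2\<close> (\<open>fock_norm_sq_eq_sum_energy\<close>), and the weighted sample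
  at \<open>\<i> \<beta> n\<close> is \<open>\<bar>S\<^sub>n\<bar>\<^sup>2\<close> with \<open>S\<^sub>n = \<Sum>\<^sub>k (Q\<^sub>k \<phi>)(\<beta> n + k + \<nu>)\<close>. It remains to compare \<open>\<Sum> \<bar>S\<^sub>n\<bar>\<^sup>2\<close> with
  the sum of the energies.

  For the upper bound, \<open>Q\<^sub>k \<phi>\<close> decays exponentially with a constant controlled by the energy
  (\<open>gauss_poly_le_energy\<close>), and the Schur test applies.

  For the lower bound the values of each \<open>Q\<^sub>k\<close> at \<open>N\<close> consecutive nodes near \<open>0\<close> are recovered
  linearly from the samples. With \<open>q = exp (-2 \<pi> \<beta>)\<close>, the product \<open>exp (\<pi> (\<beta> m + r)\<^sup>2) S\<^sub>n\<^sub>+\<^sub>m\<close>, where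
  \<open>r = \<beta> n + k + \<nu>\<close>, is a sum over \<open>l\<close> of polynomials in \<open>m\<close> of degree below \<open>N\<close> times \<open>q\<close> to the
  power \<open>l m\<close>, and the term \<open>l = 0\<close> is \<open>Q\<^sub>k (\<beta> m + r)\<close>. A sequence \<open>\<kappa>\<close> isolates this term if its
  Laurent series has zeros of order \<open>N\<close> at all \<open>q\<^sup>l\<close> with \<open>l \<noteq> 0\<close> and agrees with \<open>1\<close> to order \<open>N\<close>
  at \<open>1\<close>. Such a series is obtained from the \<open>N\<close>-th power of a Jacobi theta function from which
  the zero at \<open>1\<close> has been divided out (\<open>ex_prescribed_moments_kernel\<close>). Its coefficients decay
  like \<open>exp (- \<pi> \<beta> m\<^sup>2 / N)\<close>, which beats the factor \<open>exp (\<pi> \<beta>\<^sup>2 m\<^sup>2)\<close> because \<open>\<beta> < 1 / N\<close>. The Schur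
  test bounds the recovered values in \<open>\<ell>\<^sup>2\<close> by the samples, and Lagrange interpolation bounds the
  energies by these values (\<open>gauss_energy_le_nodes\<close>).\<close>

section \<open>Sums over the integers\<close>

lemma summable_on_int_if_nat_halves:
  fixes f :: "int \<Rightarrow> real"
  assumes "(\<lambda>n::nat. f (int n)) summable_on UNIV" "(\<lambda>n::nat. f (- int n)) summable_on UNIV"
  shows "f summable_on UNIV"
proof -
  have 1: "f summable_on (range int)"
    using assms(1) by (subst summable_on_reindex) (auto simp: o_def)
  have 2: "f summable_on (range (\<lambda>n. - int n))"
    using assms(2) by (subst summable_on_reindex) (auto simp: o_def inj_on_def)
  have "x \<in> range int \<union> range (\<lambda>n. - int n)" for x :: int
    by (cases x rule: int_cases2) auto
  then have "range int \<union> range (\<lambda>n. - int n) = UNIV" by blast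
  then show ?thesis using summable_on_union[OF 1 2] by simp
qed

lemma exp_neg_abs_int_summable:
  assumes "c > 0" shows "(\<lambda>n::int. exp (- c * \<bar>of_int n\<bar>) :: real) summable_on UNIV"
proof -
  have "(\<lambda>n::nat. exp (- c * real n)) summable_on UNIV"
  proof -
    have "summable (\<lambda>n::nat. exp (-c) ^ n)" using assms by (intro summable_geometric) auto
    then show ?thesis
      by (subst summable_on_UNIV_nonneg_real_iff) (auto simp: exp_of_nat_mult[symmetric] mult.commute)
  qed
  then show ?thesis by (intro summable_on_int_if_nat_halves) auto
qed

lemma has_sum_finite_sum:
  fixes f :: "'i \<Rightarrow> 'a \<Rightarrow> 'b :: topological_comm_monoid_add"
  assumes "\<And>i. i \<in> I \<Longrightarrow> (f i has_sum S i) A"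
  shows "((\<lambda>x. \<Sum>i\<in>I. f i x) has_sum (\<Sum>i\<in>I. S i)) A"
  using assms by (induction I rule: infinite_finite_induct) (auto intro!: has_sum_add)

lemma has_sum_product:
  fixes f :: "'a \<Rightarrow> real" and g :: "'b \<Rightarrow> real"
  assumes f: "(f has_sum S) A" and g: "(g has_sum T) B"
  shows "((\<lambda>x. f (fst x) * g (snd x)) has_sum S * T) (A \<times> B)"
proof (rule has_sum_SigmaI)
  have fs: "(\<lambda>x. norm (f x)) summable_on A" and gs: "(\<lambda>x. norm (g x)) summable_on B"
    using f g has_sum_imp_summable summable_on_iff_abs_summable_on_real by blast+
  have "(\<lambda>x. norm (f (fst x)) * norm (g (snd x))) summable_on (A \<times> B)"
  proof (rule summable_on_SigmaI)
    show "((\<lambda>y. norm (f (fst (x, y))) * norm (g (snd (x, y)))) has_sum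
        norm (f x) * (\<Sum>\<^sub>\<infinity>y\<in>B. norm (g y))) B" for x
      using has_sum_cmult_right[OF has_sum_infsum[OF gs], of "norm (f x)"] by simp
    show "(\<lambda>x. norm (f x) * (\<Sum>\<^sub>\<infinity>y\<in>B. norm (g y))) summable_on A"
      by (intro summable_on_cmult_left fs)
  qed auto
  then have "(\<lambda>x. norm (f (fst x) * g (snd x))) summable_on (A \<times> B)"
    by (simp add: abs_mult)
  then show "(\<lambda>x. f (fst x) * g (snd x)) summable_on (A \<times> B)"
    by (rule abs_summable_summable)
  show "((\<lambda>y. f (fst (x, y)) * g (snd (x, y))) has_sum f x * T) B" for x
    by (simp add: has_sum_cmult_right g)
  show "((\<lambda>x. f x * T) has_sum S * T) A"
    by (simp add: has_sum_cmult_left f)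
qed

section \<open>Sequences of Gaussian decay and their moments\<close>

text \<open>The linear term \<open>D * \<bar>n\<bar>\<close> in the exponent absorbs the errors made by shifts, partial sums
  and convolutions, so that \<open>\<alpha>\<close> is tracked without loss; it is the constant that has to be
  compared with \<open>\<pi> \<beta>\<^sup>2\<close> at the end.\<close>

definition gauss_decay :: "real \<Rightarrow> (int \<Rightarrow> real) \<Rightarrow> bool" where
  "gauss_decay \<alpha> a \<longleftrightarrow>
     (\<exists>C D. \<forall>n. \<bar>a n\<bar> \<le> C * exp (D * \<bar>of_int n\<bar> - \<alpha> * (of_int n)\<^sup>2))"

lemma gauss_decayD:
  assumes "gauss_decay \<alpha> a"
  shows "\<exists>C\<ge>0. \<exists>D\<ge>0. \<forall>n. \<bar>a n\<bar> \<le> C * exp (D * \<bar>of_int n\<bar> - \<alpha> * (of_int n)\<^sup>2)"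
proof -
  from assms obtain C D where CD: "\<And>n. \<bar>a n\<bar> \<le> C * exp (D * \<bar>of_int n\<bar> - \<alpha> * (of_int n)\<^sup>2)"
    unfolding gauss_decay_def by blast
  have C: "C \<ge> 0" using CD[of 0] by simp
  have "\<bar>a n\<bar> \<le> C * exp (\<bar>D\<bar> * \<bar>of_int n\<bar> - \<alpha> * (of_int n)\<^sup>2)" for n
    by (rule order_trans[OF CD]) (use C in \<open>auto intro!: mult_left_mono mult_right_mono\<close>)
  with C abs_ge_zero[of D] show ?thesis by blast
qed

text \<open>Completing the square bounds the terms by a multiple of \<open>exp (-\<bar>n\<bar>)\<close>.\<close>

lemma gauss_summable:
  fixes \<alpha> d :: real
  assumes "\<alpha> > 0"
  shows "(\<lambda>n::int. exp (d * \<bar>of_int n\<bar> - \<alpha> * (of_int n)\<^sup>2)) summable_on UNIV"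
proof (rule summable_on_comparison_test)
  show "(\<lambda>n::int. exp ((d+1)\<^sup>2 / (4*\<alpha>)) * exp (- 1 * \<bar>of_int n\<bar>)) summable_on UNIV"
    by (intro summable_on_cmult_right exp_neg_abs_int_summable) simp
  fix n :: int
  have "0 \<le> \<alpha> * (\<bar>of_int n\<bar> - (d+1)/(2*\<alpha>))\<^sup>2" using assms by simp
  also have "\<dots> = \<alpha> * (of_int n)\<^sup>2 - (d+1) * \<bar>of_int n\<bar> + (d+1)\<^sup>2 / (4*\<alpha>)"
    using assms by (simp add: power2_eq_square field_simps flip: abs_mult)
  finally have "d * \<bar>of_int n\<bar> - \<alpha> * (of_int n)\<^sup>2 \<le> (d+1)\<^sup>2 / (4*\<alpha>) + - 1 * \<bar>of_int n\<bar>"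
    by (simp add: algebra_simps)
  then show "exp (d * \<bar>of_int n\<bar> - \<alpha> * (of_int n)\<^sup>2) \<le>
      exp ((d+1)\<^sup>2 / (4*\<alpha>)) * exp (- 1 * \<bar>of_int n\<bar> :: real)"
    by (simp flip: exp_add)
qed auto

lemma gauss_decay_exp_summable:
  assumes "\<alpha> > 0" "gauss_decay \<alpha> a"
  shows "(\<lambda>n. \<bar>a n\<bar> * exp (d * \<bar>of_int n\<bar>)) summable_on UNIV"
proof -
  obtain C D where CD: "C \<ge> 0" "D \<ge> 0"
    "\<And>n. \<bar>a n\<bar> \<le> C * exp (D * \<bar>of_int n\<bar> - \<alpha> * (of_int n)\<^sup>2)"
    using gauss_decayD[OF assms(2)] by blast
  show ?thesis
  proof (rule summable_on_comparison_test)
    show "(\<lambda>n. C * exp ((D + d) * \<bar>of_int n\<bar> - \<alpha> * (of_int n)\<^sup>2)) summable_on (UNIV::int set)"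
      by (intro summable_on_cmult_right gauss_summable assms)
    fix n :: int
    have "\<bar>a n\<bar> * exp (d * \<bar>of_int n\<bar>) \<le>
        (C * exp (D * \<bar>of_int n\<bar> - \<alpha> * (of_int n)\<^sup>2)) * exp (d * \<bar>of_int n\<bar>)"
      by (intro mult_right_mono CD) auto
    also have "\<dots> = C * exp ((D + d) * \<bar>of_int n\<bar> - \<alpha> * (of_int n)\<^sup>2)"
      by (simp add: algebra_simps flip: exp_add)
    finally show "\<bar>a n\<bar> * exp (d * \<bar>of_int n\<bar>) \<le> C * exp ((D + d) * \<bar>of_int n\<bar> - \<alpha> * (of_int n)\<^sup>2)" .
  qed auto
qed

lemma power_le_fact_exp: "x \<ge> 0 \<Longrightarrow> x ^ i \<le> fact i * exp (x::real)"
proof -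
  assume x: "x \<ge> 0"
  have "x ^ i /\<^sub>R fact i \<le> (\<Sum>n. x ^ n /\<^sub>R fact n)"
    using sum_le_suminf[OF summable_exp_generic[of x], of "{i}"] x by simp
  then show ?thesis by (simp add: exp_def field_simps)
qed

text \<open>For the Laurent series \<open>V(\<zeta>) = \<Sum> a\<^sub>n \<zeta>\<^sup>n\<close> this is \<open>(\<zeta> d/d\<zeta>)\<^sup>i V\<close> at \<open>\<zeta> = e\<^sup>s\<close>, so the vanishing
  of the moments of order below \<open>N\<close> is a zero of order \<open>N\<close> there.\<close>

definition moment :: "(int \<Rightarrow> real) \<Rightarrow> real \<Rightarrow> nat \<Rightarrow> real" where
  "moment a s i = (\<Sum>\<^sub>\<infinity>n. a n * of_int n ^ i * exp (s * of_int n))"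

lemma moment_abs_summable:
  assumes "\<alpha> > 0" "gauss_decay \<alpha> a"
  shows "(\<lambda>n. \<bar>a n * of_int n ^ i * exp (s * of_int n)\<bar>) summable_on UNIV"
proof (rule summable_on_comparison_test)
  show "(\<lambda>n. fact i * (\<bar>a n\<bar> * exp ((1 + \<bar>s\<bar>) * \<bar>of_int n\<bar>))) summable_on UNIV"
    by (intro summable_on_cmult_right gauss_decay_exp_summable[OF assms])
  fix n :: int
  have "s * of_int n \<le> \<bar>s\<bar> * \<bar>of_int n\<bar>" by (metis abs_ge_self abs_mult)
  then have "\<bar>of_int n\<bar> ^ i * exp (s * of_int n) \<le> (fact i * exp \<bar>of_int n\<bar>) * exp (\<bar>s\<bar> * \<bar>of_int n\<bar>)"
    by (intro mult_mono power_le_fact_exp) auto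
  also have "\<dots> = fact i * exp ((1 + \<bar>s\<bar>) * \<bar>of_int n\<bar>)"
    by (simp add: algebra_simps flip: exp_add)
  finally have "\<bar>a n\<bar> * (\<bar>of_int n\<bar> ^ i * exp (s * of_int n)) \<le>
     \<bar>a n\<bar> * (fact i * exp ((1 + \<bar>s\<bar>) * \<bar>of_int n\<bar>))"
    by (rule mult_left_mono) simp
  then show "\<bar>a n * of_int n ^ i * exp (s * of_int n)\<bar> \<le> fact i * (\<bar>a n\<bar> * exp ((1 + \<bar>s\<bar>) * \<bar>of_int n\<bar>))"
    by (simp only: abs_mult power_abs abs_exp_cancel mult_ac)
qed auto

lemma moment_has_sum:
  assumes "\<alpha> > 0" "gauss_decay \<alpha> a"
  shows "((\<lambda>n. a n * of_int n ^ i * exp (s * of_int n)) has_sum moment a s i) UNIV"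
proof -
  have "(\<lambda>n. norm (a n * of_int n ^ i * exp (s * of_int n))) summable_on UNIV"
    unfolding real_norm_def by (rule moment_abs_summable[OF assms])
  then show ?thesis
    unfolding moment_def by (rule has_sum_infsum[OF abs_summable_summable])
qed

lemma gauss_decay_cmult:
  assumes "gauss_decay \<alpha> a"
  shows "gauss_decay \<alpha> (\<lambda>n. c * a n)"
proof -
  obtain C D where CD: "\<And>n. \<bar>a n\<bar> \<le> C * exp (D * \<bar>of_int n\<bar> - \<alpha> * (of_int n)\<^sup>2)"
    using gauss_decayD[OF assms] by blast
  have "\<bar>c * a n\<bar> \<le> (\<bar>c\<bar> * C) * exp (D * \<bar>of_int n\<bar> - \<alpha> * (of_int n)\<^sup>2)" for n
    using mult_left_mono[OF CD[of n], of "\<bar>c\<bar>"] by (simp only: abs_mult mult.assoc abs_ge_zero)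
  then show ?thesis unfolding gauss_decay_def by blast
qed

lemma gauss_decay_add:
  assumes "gauss_decay \<alpha> a" "gauss_decay \<alpha> b"
  shows "gauss_decay \<alpha> (\<lambda>n. a n + b n)"
proof -
  obtain C D where CD: "C \<ge> 0" "D \<ge> 0"
    "\<And>n. \<bar>a n\<bar> \<le> C * exp (D * \<bar>of_int n\<bar> - \<alpha> * (of_int n)\<^sup>2)"
    using gauss_decayD[OF assms(1)] by blast
  obtain C' D' where CD': "C' \<ge> 0" "D' \<ge> 0"
    "\<And>n. \<bar>b n\<bar> \<le> C' * exp (D' * \<bar>of_int n\<bar> - \<alpha> * (of_int n)\<^sup>2)"
    using gauss_decayD[OF assms(2)] by blast
  have "\<bar>a n + b n\<bar> \<le> (C + C') * exp ((D + D') * \<bar>of_int n\<bar> - \<alpha> * (of_int n)\<^sup>2)" for n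
  proof -
    have "\<bar>a n\<bar> \<le> C * exp ((D + D') * \<bar>of_int n\<bar> - \<alpha> * (of_int n)\<^sup>2)"
      by (rule order_trans[OF CD(3)]) (use CD CD' in \<open>auto intro!: mult_left_mono mult_right_mono\<close>)
    moreover have "\<bar>b n\<bar> \<le> C' * exp ((D + D') * \<bar>of_int n\<bar> - \<alpha> * (of_int n)\<^sup>2)"
      by (rule order_trans[OF CD'(3)]) (use CD CD' in \<open>auto intro!: mult_left_mono mult_right_mono\<close>)
    ultimately show ?thesis unfolding distrib_right[of C C'] by linarith
  qed
  then show ?thesis unfolding gauss_decay_def by blast
qed

lemma gauss_decay_shift:
  assumes "gauss_decay \<alpha> a" "\<alpha> > 0"
  shows "gauss_decay \<alpha> (\<lambda>n. a (n - 1))"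
proof -
  obtain C D where CD: "C \<ge> 0" "D \<ge> 0"
    "\<And>n. \<bar>a n\<bar> \<le> C * exp (D * \<bar>of_int n\<bar> - \<alpha> * (of_int n)\<^sup>2)"
    using gauss_decayD[OF assms(1)] by blast
  have "\<bar>a (n - 1)\<bar> \<le> (C * exp D) * exp ((D + 2*\<alpha>) * \<bar>of_int n\<bar> - \<alpha> * (of_int n)\<^sup>2)" for n
  proof -
    have "D * \<bar>of_int (n-1)\<bar> \<le> D * (\<bar>of_int n\<bar> + 1)"
      by (rule mult_left_mono) (use CD in auto)
    moreover have "\<alpha> * (2 * of_int n) \<le> \<alpha> * (2 * \<bar>of_int n\<bar> + 1)"
      by (rule mult_left_mono) (use assms in auto)
    ultimately have "D * \<bar>of_int (n-1)\<bar> - \<alpha> * (of_int (n-1))\<^sup>2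
        \<le> D + ((D + 2*\<alpha>) * \<bar>of_int n\<bar> - \<alpha> * (of_int n)\<^sup>2)"
      by (simp add: power2_eq_square algebra_simps)
    then have "exp (D * \<bar>of_int (n-1)\<bar> - \<alpha> * (of_int (n-1))\<^sup>2)
        \<le> exp D * exp ((D + 2*\<alpha>) * \<bar>of_int n\<bar> - \<alpha> * (of_int n)\<^sup>2)"
      by (simp flip: exp_add)
    from mult_left_mono[OF this CD(1)] show ?thesis
      using CD(3)[of "n-1"] by (simp add: mult.assoc)
  qed
  then show ?thesis unfolding gauss_decay_def by blast
qed

text \<open>On Laurent series this is multiplication by \<open>\<zeta> - 1\<close>.\<close>

definition shift_diff :: "(int \<Rightarrow> real) \<Rightarrow> int \<Rightarrow> real" where
  "shift_diff a n = a (n - 1) - a n"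

lemma gauss_decay_shift_diff:
  assumes "gauss_decay \<alpha> a" "\<alpha> > 0"
  shows "gauss_decay \<alpha> (shift_diff a)"
proof -
  have "gauss_decay \<alpha> (\<lambda>n. a (n-1) + (-1) * a n)"
    by (intro gauss_decay_add gauss_decay_shift gauss_decay_cmult assms)
  then show ?thesis by (simp add: shift_diff_def[abs_def])
qed

lemma moment_add:
  assumes "gauss_decay \<alpha> a" "gauss_decay \<alpha> b" "\<alpha> > 0"
  shows "moment (\<lambda>n. a n + c * b n) s i = moment a s i + c * moment b s i"
proof -
  have "((\<lambda>n. a n * of_int n ^ i * exp (s * of_int n) + c * (b n * of_int n ^ i * exp (s * of_int n)))
      has_sum moment a s i + c * moment b s i) UNIV"
    by (intro has_sum_add has_sum_cmult_right moment_has_sum[OF assms(3)] assms)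
  then show ?thesis unfolding moment_def
    by (intro infsumI) (simp add: algebra_simps)
qed

text \<open>Expand \<open>(n + 1)\<^sup>i\<close> after shifting the summation index. At \<open>s = 0\<close> the top term cancels, so
  the difference lowers the order of the moments by one.\<close>

lemma moment_shift_diff:
  assumes "gauss_decay \<alpha> a" "\<alpha> > 0"
  shows "moment (shift_diff a) s i = exp s * (\<Sum>j\<le>i. real (i choose j) * moment a s j) - moment a s i"
proof -
  have 1: "((\<lambda>n. (\<Sum>j\<le>i. real (i choose j) * (a n * of_int n ^ j * exp (s * of_int n)))) has_sum
      (\<Sum>j\<le>i. real (i choose j) * moment a s j)) UNIV"
    by (intro has_sum_finite_sum has_sum_cmult_right moment_has_sum[OF assms(2,1)])
  have 2: "(\<Sum>j\<le>i. real (i choose j) * (a n * of_int n ^ j * exp (s * of_int n))) =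
      a n * of_int (n+1) ^ i * exp (s * of_int n)" for n
    by (simp add: binomial_ring sum_distrib_left sum_distrib_right mult_ac)
  have 3: "((\<lambda>n. exp s * (a n * of_int (n+1) ^ i * exp (s * of_int n))) has_sum
      exp s * (\<Sum>j\<le>i. real (i choose j) * moment a s j)) UNIV"
    using 1 unfolding 2 by (rule has_sum_cmult_right)
  have "((\<lambda>n. exp s * (a (n-1) * of_int (n-1+1) ^ i * exp (s * of_int (n-1)))) has_sum
      exp s * (\<Sum>j\<le>i. real (i choose j) * moment a s j)) UNIV"
    by (subst has_sum_reindex_bij_witness[where i="\<lambda>n. n+1" and j="\<lambda>n. n-1" and T=UNIV and
          h="(\<lambda>n. exp s * (a n * of_int (n+1) ^ i * exp (s * of_int n)))"]) (use 3 in auto)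
  moreover have "exp s * (a (n-1) * of_int (n-1+1) ^ i * exp (s * of_int (n-1))) =
      a (n-1) * of_int n ^ i * exp (s * of_int n)" for n
    by (simp add: algebra_simps exp_diff)
  ultimately have 4: "((\<lambda>n. a (n-1) * of_int n ^ i * exp (s * of_int n)) has_sum
      exp s * (\<Sum>j\<le>i. real (i choose j) * moment a s j)) UNIV" by (simp only:)
  have "((\<lambda>n. a (n-1) * of_int n ^ i * exp (s * of_int n) + (-1) * (a n * of_int n ^ i * exp (s * of_int n))) has_sum
      exp s * (\<Sum>j\<le>i. real (i choose j) * moment a s j) + (-1) * moment a s i) UNIV"
    by (intro has_sum_add has_sum_cmult_right 4 moment_has_sum[OF assms(2,1)])
  then show ?thesis unfolding moment_def[of "shift_diff a"] 
    by (intro infsumI) (simp add: shift_diff_def algebra_simps)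
qed

definition conv :: "(int \<Rightarrow> real) \<Rightarrow> (int \<Rightarrow> real) \<Rightarrow> int \<Rightarrow> real" where
  "conv a b n = (\<Sum>\<^sub>\<infinity>m. a m * b (n - m))"

text \<open>The Leibniz rule for the product of two Laurent series.\<close>

lemma moment_conv:
  assumes a: "gauss_decay \<alpha> a" "\<alpha> > 0" and b: "gauss_decay \<gamma> b" "\<gamma> > 0"
  shows "moment (conv a b) s i = (\<Sum>j\<le>i. real (i choose j) * moment a s j * moment b s (i - j))"
proof -
  define A where "A j n = a n * of_int n ^ j * exp (s * of_int n)" for j n
  define B where "B j n = b n * of_int n ^ j * exp (s * of_int n)" for j n
  have A: "(A j has_sum moment a s j) UNIV" "(\<lambda>n. norm (A j n)) summable_on UNIV" for j
    unfolding A_def using moment_has_sum[OF a(2,1)] moment_abs_summable[OF a(2,1)] by auto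
  have B: "(B j has_sum moment b s j) UNIV" "(\<lambda>n. norm (B j n)) summable_on UNIV" for j
    unfolding B_def using moment_has_sum[OF b(2,1)] moment_abs_summable[OF b(2,1)] by auto
  define f where "f = (\<lambda>(m,k). a m * b k * of_int (m + k) ^ i * exp (s * of_int (m + k)))"
  have f_eq: "f x = (\<Sum>j\<le>i. real (i choose j) * (A j (fst x) * B (i-j) (snd x)))" for x
    by (cases x) (simp add: f_def A_def B_def binomial_ring sum_distrib_left sum_distrib_right 
        distrib_left exp_add mult_ac)
  have AB: "((\<lambda>x. A j (fst x) * B j' (snd x)) has_sum moment a s j * moment b s j') (UNIV \<times> UNIV)" for j j'
    by (rule has_sum_product[OF A(1) B(1)])
  have f: "(f has_sum (\<Sum>j\<le>i. real (i choose j) * (moment a s j * moment b s (i - j)))) (UNIV \<times> UNIV)"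
    unfolding f_eq by (intro has_sum_finite_sum has_sum_cmult_right AB)
  have f': "((\<lambda>(n,m). f (m, n - m)) has_sum 
      (\<Sum>j\<le>i. real (i choose j) * (moment a s j * moment b s (i - j)))) (UNIV \<times> UNIV)"
    by (subst has_sum_reindex_bij_witness[where i="\<lambda>(m,k). (m+k,m)" and j="\<lambda>(n,m). (m,n-m)" and 
          T="UNIV \<times> UNIV" and h=f]) (use f in auto)
  have "((\<lambda>n. conv a b n * of_int n ^ i * exp (s * of_int n)) has_sum 
      (\<Sum>j\<le>i. real (i choose j) * (moment a s j * moment b s (i - j)))) UNIV"
  proof -
    have "((\<lambda>n. \<Sum>\<^sub>\<infinity>m. f (m, n - m)) has_sum 
       (\<Sum>j\<le>i. real (i choose j) * (moment a s j * moment b s (i - j)))) UNIV"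
      using infsum_Sigma'_banach[of "\<lambda>n m. f (m, n - m)" UNIV "\<lambda>_. UNIV"] f'
        summable_on_Sigma_banach[of "\<lambda>n m. f (m, n - m)" UNIV "\<lambda>_. UNIV"]
      by (simp add: has_sum_iff)
    also have "(\<lambda>n. \<Sum>\<^sub>\<infinity>m. f (m, n - m)) = (\<lambda>n. conv a b n * of_int n ^ i * exp (s * of_int n))"
      by (simp add: f_def conv_def infsum_cmult_left' fun_eq_iff)
    finally show ?thesis .
  qed
  then show ?thesis unfolding moment_def[of "conv a b"]
    by (intro infsumI) (simp add: algebra_simps)
qed

text \<open>With \<open>\<delta> = \<gamma> / (\<alpha> + \<gamma>)\<close>, completing the square gives
  \<open>\<alpha> m\<^sup>2 + \<gamma> (n - m)\<^sup>2 = \<alpha> \<gamma> / (\<alpha> + \<gamma>) n\<^sup>2 + (\<alpha> + \<gamma>) (m - \<delta> n)\<^sup>2\<close>; the second summand makes the sum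
  over \<open>m\<close> converge, uniformly in \<open>n\<close> once \<open>m\<close> is counted from the integer part of \<open>\<delta> n\<close>. The
  reciprocals of the constants add up, so an \<open>N\<close>-fold convolution divides the constant by \<open>N\<close>.\<close>

lemma gauss_decay_conv:
  assumes a: "gauss_decay \<alpha> a" "\<alpha> > 0" and b: "gauss_decay \<gamma> b" "\<gamma> > 0"
  shows "gauss_decay (\<alpha> * \<gamma> / (\<alpha> + \<gamma>)) (conv a b)"
proof -
  obtain C D where CD: "C \<ge> 0" "D \<ge> 0"
    "\<And>n. \<bar>a n\<bar> \<le> C * exp (D * \<bar>of_int n\<bar> - \<alpha> * (of_int n)\<^sup>2)"
    using gauss_decayD[OF a(1)] by blast
  obtain C' D' where CD': "C' \<ge> 0" "D' \<ge> 0"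
    "\<And>n. \<bar>b n\<bar> \<le> C' * exp (D' * \<bar>of_int n\<bar> - \<gamma> * (of_int n)\<^sup>2)"
    using gauss_decayD[OF b(1)] by blast
  define \<sigma> where "\<sigma> = \<alpha> + \<gamma>"
  define E where "E = D + D'"
  have pos: "\<sigma> > 0" "E \<ge> 0" using a b CD CD' by (auto simp: \<sigma>_def E_def)
  define J where "J = (\<Sum>\<^sub>\<infinity>j::int. exp ((E + 2*\<sigma>) * \<bar>of_int j\<bar> - \<sigma> * (of_int j)\<^sup>2))"
  have J: "(\<lambda>j::int. exp ((E + 2*\<sigma>) * \<bar>of_int j\<bar> - \<sigma> * (of_int j)\<^sup>2)) summable_on UNIV"
    by (rule gauss_summable[OF pos(1)])
  have "\<bar>conv a b n\<bar> \<le> (C * C' * exp E * J) * exp ((2*E) * \<bar>of_int n\<bar> - \<alpha> * \<gamma> / (\<alpha> + \<gamma>) * (of_int n)\<^sup>2)" for n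
  proof -
    define \<delta> where "\<delta> = \<gamma> / \<sigma>"
    define k where "k = \<lfloor>\<delta> * of_int n\<rfloor>"
    define f where "f = \<delta> * of_int n - of_int k"
    define K where "K = (C * C' * exp E) * exp ((2*E) * \<bar>of_int n\<bar> - \<alpha> * \<gamma> / (\<alpha> + \<gamma>) * (of_int n)\<^sup>2)"
    have f: "0 \<le> f" "f < 1" unfolding f_def k_def by linarith+
    have \<delta>: "0 \<le> \<delta>" "\<delta> \<le> 1" using a b by (auto simp: \<delta>_def \<sigma>_def)
    have "\<bar>\<delta> * of_int n\<bar> \<le> \<bar>of_int n\<bar>"
      using mult_right_mono[OF \<delta>(2), of "\<bar>of_int n\<bar>"] \<delta>(1) by (simp add: abs_mult)
    then have k: "\<bar>of_int k\<bar> \<le> \<bar>of_int n\<bar> + (1::real)"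
      using f unfolding f_def by linarith
    have key: "\<bar>a (k + j) * b (n - (k + j))\<bar> \<le> K * exp ((E + 2*\<sigma>) * \<bar>of_int j\<bar> - \<sigma> * (of_int j)\<^sup>2)" for j
    proof -
      define m where "m = k + j"
      have m: "\<bar>of_int m\<bar> \<le> \<bar>of_int n\<bar> + 1 + (\<bar>of_int j\<bar>::real)" 
        using k unfolding m_def by simp
      have nm: "\<bar>of_int (n - m)\<bar> \<le> 2 * \<bar>of_int n\<bar> + 1 + (\<bar>of_int j\<bar>::real)" 
        using m by simp
      have e1: "D * \<bar>of_int m\<bar> \<le> D * (2 * \<bar>of_int n\<bar> + 1 + \<bar>of_int j\<bar>)"
        using m CD(2) by (intro mult_left_mono) auto
      have e2: "D' * \<bar>of_int (n - m)\<bar> \<le> D' * (2 * \<bar>of_int n\<bar> + 1 + \<bar>of_int j\<bar>)"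
        by (rule mult_left_mono[OF nm CD'(2)])
      have fj: "of_int j * f \<le> \<bar>of_int j\<bar>"
        using f mult_left_mono[of f 1 "\<bar>of_int j\<bar>"] abs_ge_self[of "of_int j * f"] by (simp add: abs_mult)
      have "(of_int j - f)\<^sup>2 \<ge> (of_int j)\<^sup>2 - 2 * \<bar>of_int j\<bar>"
        using fj zero_le_power2[of f] by (simp only: power2_diff)
      then have e3: "\<sigma> * (of_int m - \<delta> * of_int n)\<^sup>2 \<ge> \<sigma> * ((of_int j)\<^sup>2 - 2 * \<bar>of_int j\<bar>)"
        using pos by (intro mult_left_mono) (auto simp: m_def f_def algebra_simps)
      have e4: "\<alpha> * (of_int m)\<^sup>2 + \<gamma> * (of_int (n - m))\<^sup>2 =
          \<alpha> * \<gamma> / (\<alpha> + \<gamma>) * (of_int n)\<^sup>2 + \<sigma> * (of_int m - \<delta> * of_int n)\<^sup>2"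
      proof -
        have "\<sigma> * \<delta> = \<gamma>" using pos by (simp add: \<delta>_def)
        moreover have "\<alpha> * \<gamma> / (\<alpha> + \<gamma>) = \<gamma> - \<gamma> * \<delta>"
          using pos by (simp add: \<delta>_def \<sigma>_def field_simps)
        ultimately have 1: "\<alpha> * \<gamma> / (\<alpha> + \<gamma>) = \<gamma> - \<sigma> * \<delta> * \<delta>" by simp
        have "\<alpha> * \<gamma> / (\<alpha> + \<gamma>) * (of_int n)\<^sup>2 + \<sigma> * (of_int m - \<delta> * of_int n)\<^sup>2
           = (\<gamma> - \<sigma> * \<delta> * \<delta>) * (of_int n)\<^sup>2 + \<sigma> * (of_int m)\<^sup>2 - 2 * (\<sigma> * \<delta>) * of_int m * of_int n + \<sigma> * \<delta> * \<delta> * (of_int n)\<^sup>2"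
          unfolding 1 by (simp add: power2_eq_square algebra_simps)
        also have "\<dots> = \<gamma> * (of_int n)\<^sup>2 + \<sigma> * (of_int m)\<^sup>2 - 2 * \<gamma> * of_int m * of_int n"
          unfolding \<open>\<sigma> * \<delta> = \<gamma>\<close> by (simp add: algebra_simps)
        finally show ?thesis by (simp add: \<sigma>_def power2_eq_square algebra_simps)
      qed
      have "\<bar>a m * b (n - m)\<bar> \<le> (C * exp (D * \<bar>of_int m\<bar> - \<alpha> * (of_int m)\<^sup>2)) *
          (C' * exp (D' * \<bar>of_int (n-m)\<bar> - \<gamma> * (of_int (n-m))\<^sup>2))"
        unfolding abs_mult by (intro mult_mono CD CD') (use CD in auto)
      also have "\<dots> = C * C' * exp (D * \<bar>of_int m\<bar> - \<alpha> * (of_int m)\<^sup>2 + (D' * \<bar>of_int (n-m)\<bar> - \<gamma> * (of_int (n-m))\<^sup>2))"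
        by (simp add: exp_add)
      also have "\<dots> \<le> C * C' * exp (E + ((2*E) * \<bar>of_int n\<bar> - \<alpha> * \<gamma> / (\<alpha> + \<gamma>) * (of_int n)\<^sup>2) + 
          ((E + 2*\<sigma>) * \<bar>of_int j\<bar> - \<sigma> * (of_int j)\<^sup>2))"
        using e1 e2 e3 e4 CD(1) CD'(1) unfolding E_def
        by (intro mult_left_mono) (auto simp: algebra_simps)
      also have "\<dots> = K * exp ((E + 2*\<sigma>) * \<bar>of_int j\<bar> - \<sigma> * (of_int j)\<^sup>2)"
        by (simp add: K_def exp_add)
      finally show ?thesis by (simp add: m_def)
    qed
    have s1: "(\<lambda>j. \<bar>a (k + j) * b (n - (k + j))\<bar>) summable_on UNIV"
      by (rule summable_on_comparison_test[OF summable_on_cmult_right[OF J, of K]]) (use key in auto)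
    have re: "conv a b n = (\<Sum>\<^sub>\<infinity>j. a (k + j) * b (n - (k + j)))"
      unfolding conv_def
      by (rule infsum_reindex_bij_witness[where j="\<lambda>m. m - k" and i="\<lambda>j. k + j"]) auto
    have "\<bar>conv a b n\<bar> \<le> (\<Sum>\<^sub>\<infinity>j. \<bar>a (k + j) * b (n - (k + j))\<bar>)"
      unfolding re using norm_infsum_bound[of "\<lambda>j. a (k + j) * b (n - (k + j))" UNIV] s1 by simp
    also have "\<dots> \<le> (\<Sum>\<^sub>\<infinity>j. K * exp ((E + 2*\<sigma>) * \<bar>of_int j\<bar> - \<sigma> * (of_int j)\<^sup>2))"
      by (intro infsum_mono s1 summable_on_cmult_right J key)
    also have "\<dots> = K * J" by (simp add: J_def infsum_cmult_right')
    finally show ?thesis by (simp add: K_def mult_ac)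
  qed
  then show ?thesis unfolding gauss_decay_def by blast
qed

section \<open>A kernel annihilating all translates but one\<close>

text \<open>On \<open>T\<close> the index \<open>m\<close> lies beyond \<open>n\<close> on the same side of \<open>0\<close>, whence \<open>m\<^sup>2 \<ge> n\<^sup>2 + (m - n)\<^sup>2\<close>.\<close>

lemma gauss_tail_bound:
  fixes a :: "int \<Rightarrow> real" and C D \<alpha> :: real
  assumes a: "\<And>n. \<bar>a n\<bar> \<le> C * exp (D * \<bar>of_int n\<bar> - \<alpha> * (of_int n)\<^sup>2)" "C \<ge> 0" "D \<ge> 0" "\<alpha> > 0"
    and T: "\<And>m. m \<in> T \<Longrightarrow> 0 \<le> n * (m - n)"
  shows "\<bar>infsum a T\<bar> \<le> C * (\<Sum>\<^sub>\<infinity>j::int. exp (D * \<bar>of_int j\<bar> - \<alpha> * (of_int j)\<^sup>2))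
           * exp (D * \<bar>of_int n\<bar> - \<alpha> * (of_int n)\<^sup>2)"
proof -
  define e where "e j = exp (D * \<bar>of_int j\<bar> - \<alpha> * (of_int j)\<^sup>2)" for j :: int
  have e: "e summable_on UNIV" unfolding e_def by (rule gauss_summable[OF a(4)])
  have ae: "\<bar>a n\<bar> \<le> C * e n" for n unfolding e_def by (rule a)
  have le: "\<bar>a m\<bar> \<le> C * e n * e (m - n)" if "m \<in> T" for m
  proof -
    define j where "j = m - n"
    have nj: "0 \<le> real_of_int n * of_int j"
      using T[OF that] by (simp only: j_def of_int_0_le_iff flip: of_int_mult)
    have "(of_int m)\<^sup>2 = (of_int n)\<^sup>2 + (of_int j)\<^sup>2 + 2 * (real_of_int n * of_int j)"
      by (simp add: j_def power2_eq_square algebra_simps)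
    with nj have "\<alpha> * (of_int m)\<^sup>2 \<ge> \<alpha> * ((of_int n)\<^sup>2 + (of_int j)\<^sup>2)"
      using a(4) by (intro mult_left_mono) auto
    moreover have "D * \<bar>of_int m\<bar> \<le> D * (\<bar>of_int n\<bar> + \<bar>of_int j\<bar>)"
      using a(3) by (intro mult_left_mono) (auto simp: j_def)
    ultimately have "e m \<le> e n * e j"
      unfolding e_def by (simp add: algebra_simps flip: exp_add)
    then show ?thesis
      using ae[of m] mult_left_mono[OF _ a(2), of "e m" "e n * e j"] unfolding j_def by linarith
  qed
  have e': "(\<lambda>m. e (m - n)) summable_on UNIV"
    using e by (subst summable_on_reindex_bij_witness[where i="\<lambda>j. j + n" and j="\<lambda>m. m - n" and T=UNIV and h=e]) auto
  have s: "(\<lambda>m. \<bar>a m\<bar>) summable_on T"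
    by (rule summable_on_comparison_test[OF summable_on_cmult_right[of _ _ "C * e n"] _]) 
       (use le e' summable_on_subset_banach[OF e', of T] in auto)
  have "\<bar>infsum a T\<bar> \<le> (\<Sum>\<^sub>\<infinity>m\<in>T. \<bar>a m\<bar>)"
    using norm_infsum_bound[of a T] s by simp
  also have "\<dots> \<le> (\<Sum>\<^sub>\<infinity>m. C * e n * e (m - n))"
    by (intro infsum_mono_neutral s summable_on_cmult_right e') (use le a(2) in \<open>auto simp: e_def\<close>)
  also have "\<dots> = C * e n * (\<Sum>\<^sub>\<infinity>m. e (m - n))"
    by (simp add: infsum_cmult_right')
  also have "(\<Sum>\<^sub>\<infinity>m. e (m - n)) = infsum e UNIV"
    by (rule infsum_reindex_bij_witness[where i="\<lambda>j. j + n" and j="\<lambda>m. m - n"]) auto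
  finally show ?thesis by (simp add: e_def[abs_def] mult_ac)
qed

lemma gauss_decay_imp_summable: 
  assumes "gauss_decay \<alpha> a" "\<alpha> > 0" shows "a summable_on UNIV"
  using moment_has_sum[OF assms(2,1), of 0 0] by (auto dest: has_sum_imp_summable)

text \<open>Division of a Laurent series with a zero at \<open>1\<close> by \<open>\<zeta> - 1\<close>: the quotient has the negative
  partial sums as coefficients. Because the total sum vanishes, a partial sum is also minus the
  complementary tail, and one of the two is a tail away from \<open>0\<close>, hence small.\<close>

lemma gauss_decay_antidiff:
  assumes a: "gauss_decay \<alpha> a" "\<alpha> > 0" and z: "moment a 0 0 = 0"
  obtains b where "gauss_decay \<alpha> b" "a = shift_diff b"
proof
  define b where "b n = - infsum a {..n}" for n
  have as: "a summable_on UNIV" by (rule gauss_decay_imp_summable[OF a])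
  have sub: "a summable_on T" for T by (rule summable_on_subset_banach[OF as]) simp
  have tot: "infsum a UNIV = 0" using z by (simp add: moment_def)
  obtain C D where CD: "C \<ge> 0" "D \<ge> 0"
    "\<And>n. \<bar>a n\<bar> \<le> C * exp (D * \<bar>of_int n\<bar> - \<alpha> * (of_int n)\<^sup>2)"
    using gauss_decayD[OF a(1)] by blast
  show "a = shift_diff b"
  proof
    fix n
    have "infsum a {..n} = infsum a ({..n-1} \<union> {n})"
      by (rule arg_cong[where f="infsum a"]) auto
    also have "\<dots> = infsum a {..n-1} + infsum a {n}"
      by (intro infsum_Un_disjoint sub) auto
    finally show "a n = shift_diff b n" by (simp add: shift_diff_def b_def)
  qed
  define J where "J = (\<Sum>\<^sub>\<infinity>j::int. exp (D * \<bar>of_int j\<bar> - \<alpha> * (of_int j)\<^sup>2))"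
  have "\<bar>b n\<bar> \<le> (C * J) * exp (D * \<bar>of_int n\<bar> - \<alpha> * (of_int n)\<^sup>2)" for n
  proof (cases "n \<ge> 0")
    case True
    have "infsum a UNIV = infsum a ({..n} \<union> {n<..})"
      by (rule arg_cong[where f="infsum a"]) auto
    also have "\<dots> = infsum a {..n} + infsum a {n<..}"
      by (intro infsum_Un_disjoint sub) auto
    finally have "b n = infsum a {n<..}" using tot by (simp add: b_def)
    then show ?thesis
      unfolding J_def using gauss_tail_bound[OF CD(3,1,2) a(2), of "{n<..}" n] True by simp
  next
    case False
    then show ?thesis unfolding b_def J_def abs_minus_cancel
      by (intro gauss_tail_bound[OF CD(3,1,2) a(2)]) (auto simp: mult_nonpos_nonpos)
  qed
  then show "gauss_decay \<alpha> b" unfolding gauss_decay_def by blast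
qed

text \<open>A Laurent series with a zero of infinite order at \<open>1\<close> vanishes; evaluating it at \<open>-1\<close> is all
  that is needed. Expanding the cosine into its power series and exchanging the sums expresses the
  value by the moments.\<close>

lemma moments_zero_imp_alternating_sum_zero:
  assumes a: "gauss_decay \<alpha> a" "\<alpha> > 0" and z: "\<And>i. moment a 0 i = 0"
  shows "((\<lambda>n. a n * cos (pi * of_int n)) has_sum 0) UNIV"
proof -
  define c where "c k x = cos_coeff k * x ^ k" for k and x :: real
  have cs: "((\<lambda>k. c k x) has_sum cos x) UNIV" for x
  proof (rule norm_summable_imp_has_sum)
    show "(\<lambda>k. c k x) sums cos x" unfolding c_def using cos_converges[of x] by simp
    show "summable (\<lambda>k. norm (c k x))" unfolding c_def using summable_norm_cos[of x] by simp
  qed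
  have ce: "((\<lambda>k. \<bar>x\<bar> ^ k /\<^sub>R fact k) has_sum exp \<bar>x\<bar>) UNIV" for x :: real
    by (rule norm_summable_imp_has_sum) (use exp_converges[of "\<bar>x\<bar>"] summable_exp_generic[of "\<bar>x\<bar>"] in \<open>auto simp: abs_mult power_abs\<close>)
  have cle: "\<bar>c k x\<bar> \<le> \<bar>x\<bar> ^ k /\<^sub>R fact k" for k x
    by (auto simp: c_def cos_coeff_def abs_mult power_abs field_simps)
  define f where "f n k = a n * c k (pi * of_int n)" for n k
  have "(\<lambda>x. norm (case x of (n,k) \<Rightarrow> f n k)) summable_on (UNIV \<times> UNIV)"
  proof (rule summable_on_comparison_test)
    show "(\<lambda>(n,k). \<bar>a n\<bar> * (\<bar>pi * of_int n\<bar> ^ k /\<^sub>R fact k)) summable_on (UNIV \<times> UNIV)"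
    proof (rule summable_on_SigmaI)
      show "((\<lambda>k. case (n, k) of (n, k) \<Rightarrow> \<bar>a n\<bar> * (\<bar>pi * of_int n\<bar> ^ k /\<^sub>R fact k)) has_sum
          \<bar>a n\<bar> * exp \<bar>pi * of_int n\<bar>) UNIV" for n
        unfolding prod.case by (intro has_sum_cmult_right ce)
      show "(\<lambda>n. \<bar>a n\<bar> * exp \<bar>pi * of_int n\<bar>) summable_on UNIV"
        using gauss_decay_exp_summable[OF a(2,1), of pi] by (simp add: abs_mult)
    qed auto
    show "norm (case x of (n,k) \<Rightarrow> f n k) \<le> (case x of (n,k) \<Rightarrow> \<bar>a n\<bar> * (\<bar>pi * of_int n\<bar> ^ k /\<^sub>R fact k))" for x
    proof (cases x)
      case (Pair n k)
      show ?thesis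
        unfolding Pair prod.case f_def real_norm_def abs_mult[of "a n"]
        by (intro mult_left_mono cle abs_ge_zero)
    qed
  qed auto
  then have fs: "(\<lambda>(n,k). f n k) summable_on (UNIV \<times> UNIV)"
    by (rule abs_summable_summable)
  have 1: "(\<Sum>\<^sub>\<infinity>k. f n k) = a n * cos (pi * of_int n)" for n
    unfolding f_def using cs[of "pi * of_int n"] by (simp add: infsum_cmult_right' has_sum_iff)
  have 2: "(\<Sum>\<^sub>\<infinity>n. f n k) = 0" for k
  proof -
    have "f n k = (cos_coeff k * pi ^ k) * (a n * of_int n ^ k * exp (0 * of_int n))" for n
      by (simp add: f_def c_def power_mult_distrib)
    then show ?thesis using z[of k] by (simp only: infsum_cmult_right' moment_def[symmetric])
  qed
  have "(\<lambda>n. \<Sum>\<^sub>\<infinity>k. f n k) summable_on UNIV"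
    using summable_on_Sigma_banach[OF fs] .
  moreover have "(\<Sum>\<^sub>\<infinity>n. \<Sum>\<^sub>\<infinity>k. f n k) = 0"
    using infsum_swap_banach[OF fs] by (simp add: 2)
  ultimately show ?thesis by (simp add: 1 has_sum_iff)
qed

text \<open>The coefficients of the Jacobi theta function with nome parameter \<open>q = exp (-2 \<pi> \<beta>)\<close>, whose
  zeros are the powers of \<open>q\<close>; the cosine is the sign \<open>(-1)\<^sup>n\<close>.\<close>

definition theta_seq :: "real \<Rightarrow> int \<Rightarrow> real" where
  "theta_seq \<beta> n = cos (pi * of_int n) * exp (- pi * \<beta> * (of_int n * (of_int n - 1)))"

lemma cos_pi_of_int_squared: "cos (pi * of_int n) * cos (pi * of_int n) = 1"
  using sin_cos_squared_add3[of "pi * of_int n"] sin_times_pi_eq_0[of "real_of_int n"] 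
  by (simp add: mult.commute)

lemma gauss_decay_theta_seq: "\<beta> > 0 \<Longrightarrow> gauss_decay (pi * \<beta>) (theta_seq \<beta>)"
proof -
  assume b: "\<beta> > 0"
  have "\<bar>theta_seq \<beta> n\<bar> \<le> 1 * exp (pi * \<beta> * \<bar>of_int n\<bar> - pi * \<beta> * (of_int n)\<^sup>2)" for n
  proof -
    have "pi * \<beta> * of_int n \<le> pi * \<beta> * \<bar>of_int n\<bar>"
      using b by (intro mult_left_mono) auto
    then have "- pi * \<beta> * (of_int n * (of_int n - 1)) \<le> pi * \<beta> * \<bar>of_int n\<bar> - pi * \<beta> * (of_int n)\<^sup>2"
      by (simp add: power2_eq_square algebra_simps)
    then have e: "exp (- pi * \<beta> * (of_int n * (of_int n - 1))) \<le> exp (pi * \<beta> * \<bar>of_int n\<bar> - pi * \<beta> * (of_int n)\<^sup>2)"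
      by simp
    show ?thesis unfolding theta_seq_def abs_mult
      by (rule mult_mono) (use e abs_cos_le_one[of "pi * of_int n"] in auto)
  qed
  then show ?thesis unfolding gauss_decay_def by blast
qed

text \<open>The reflection \<open>n \<mapsto> 1 - 2 l - n\<close> preserves the exponent \<open>n (n - 1) + 2 l n\<close> and changes the
  parity.\<close>

lemma theta_seq_moment_zero: "moment (theta_seq \<beta>) (- 2 * pi * \<beta> * of_int l) 0 = 0"
proof -
  define f where "f n = theta_seq \<beta> n * exp (- 2 * pi * \<beta> * of_int l * of_int n)" for n :: int
  have "infsum f UNIV = infsum (\<lambda>n. - f n) UNIV"
  proof (rule infsum_reindex_bij_witness[where i="\<lambda>n. 1 - 2 * l - n" and j="\<lambda>n. 1 - 2 * l - n"])
    fix n :: int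
    have "cos (pi * of_int (1 - 2 * l - n)) = cos (- (pi * of_int n) + pi + of_int (-l) * (2 * pi))"
      by (rule arg_cong[where f=cos]) (simp add: algebra_simps)
    also have "\<dots> = cos (- (pi * of_int n) + pi)"
      using cos.plus_of_int[of "- (pi * of_int n) + pi" "-l"] by (simp only: of_real_eq_id id_apply)
    also have "\<dots> = - cos (pi * of_int n)" by (simp add: cos_add)
    finally have c: "cos (pi * of_int (1 - 2 * l - n)) = - cos (pi * of_int n)" .
    have e: "- pi * \<beta> * (of_int (1 - 2 * l - n) * (of_int (1 - 2 * l - n) - 1)) + - 2 * pi * \<beta> * of_int l * of_int (1 - 2 * l - n)
       = - pi * \<beta> * (of_int n * (of_int n - 1)) + - 2 * pi * \<beta> * of_int l * of_int n"
      by (simp add: algebra_simps)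
    show "- f (1 - 2 * l - n) = f n"
      unfolding f_def theta_seq_def c using arg_cong[OF e, of exp] by (simp only: exp_add minus_mult_left mult.assoc minus_minus)
  qed auto
  then have "infsum f UNIV = 0" by (simp add: infsum_uminus)
  then show ?thesis by (simp add: moment_def f_def[abs_def])
qed

text \<open>Divide the theta function by \<open>\<zeta> - 1\<close> until it no longer vanishes at \<open>1\<close>; its other zeros at
  the powers of \<open>q\<close> remain. The process stops, for otherwise all moments of the theta coefficients
  would vanish and with them their alternating sum, whose terms are positive.\<close>

lemma ex_base_kernel:
  assumes b: "\<beta> > 0"
  obtains \<tau> where "gauss_decay (pi * \<beta>) \<tau>" "\<And>l. l \<noteq> 0 \<Longrightarrow> moment \<tau> (- 2 * pi * \<beta> * of_int l) 0 = 0"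
    "moment \<tau> 0 0 = 1"
proof -
  define P where "P a \<longleftrightarrow> gauss_decay (pi * \<beta>) a \<and> (\<forall>l::int. l \<noteq> 0 \<longrightarrow> moment a (- 2 * pi * \<beta> * of_int l) 0 = 0)" for a
  have pb: "pi * \<beta> > 0" using b by simp
  have "\<exists>a. P a \<and> moment a 0 0 \<noteq> 0"
  proof (rule ccontr)
    assume "\<not> ?thesis"
    then have all0: "moment a 0 0 = 0" if "P a" for a using that by blast
    have "P a \<Longrightarrow> moment a 0 i = 0" for a i
    proof (induction i arbitrary: a rule: less_induct)
      case (less i a)
      from less.prems have ga: "gauss_decay (pi * \<beta>) a" by (simp add: P_def)
      obtain c where c: "gauss_decay (pi * \<beta>) c" "a = shift_diff c"
        using gauss_decay_antidiff[OF ga pb all0[OF less.prems]] by blast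
      have "P c" unfolding P_def
      proof (intro conjI allI impI c(1))
        fix l :: int assume l: "l \<noteq> 0"
        define s where "s = - 2 * pi * \<beta> * of_int l"
        have "moment a s 0 = 0" using less.prems l by (simp add: P_def s_def)
        then have "(exp s - 1) * moment c s 0 = 0"
          using moment_shift_diff[OF c(1) pb, of s 0] by (simp add: c(2) algebra_simps)
        moreover have "s \<noteq> 0" using l b by (simp add: s_def)
        ultimately show "moment c (- 2 * pi * \<beta> * of_int l) 0 = 0" by (simp add: s_def)
      qed
      then have "moment c 0 j = 0" if "j < i" for j using less.IH that by blast
      moreover have "moment a 0 i = (\<Sum>j\<le>i. real (i choose j) * moment c 0 j) - moment c 0 i"
        using moment_shift_diff[OF c(1) pb, of 0 i] by (simp add: c(2))
      moreover have "{..i} = insert i {..<i}" by auto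
      ultimately show ?case by simp
    qed
    moreover have "P (theta_seq \<beta>)"
      using gauss_decay_theta_seq[OF b] theta_seq_moment_zero by (simp add: P_def)
    ultimately have hs: "((\<lambda>n. theta_seq \<beta> n * cos (pi * of_int n)) has_sum 0) UNIV"
      using moments_zero_imp_alternating_sum_zero[OF gauss_decay_theta_seq[OF b] pb] by blast
    have pos: "theta_seq \<beta> n * cos (pi * of_int n) = exp (- pi * \<beta> * (of_int n * (of_int n - 1)))" for n
    proof -
      have "theta_seq \<beta> n * cos (pi * of_int n) =
          (cos (pi * of_int n) * cos (pi * of_int n)) * exp (- pi * \<beta> * (of_int n * (of_int n - 1)))"
        by (simp only: theta_seq_def mult_ac)
      then show ?thesis by (simp only: cos_pi_of_int_squared mult_1_left)
    qed
    have "theta_seq \<beta> 0 * cos (pi * of_int 0) = 0"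
      by (rule nonneg_has_sum_le_0D[OF hs]) (simp_all only: pos exp_ge_zero order_refl UNIV_I)
    then show False unfolding pos by simp
  qed
  then obtain a where a: "P a" "moment a 0 0 \<noteq> 0" by blast
  define \<tau> where "\<tau> n = (1 / moment a 0 0) * a n" for n
  have m: "moment \<tau> s i = (1 / moment a 0 0) * moment a s i" for s i
    unfolding moment_def \<tau>_def mult.assoc by (rule infsum_cmult_right')
  show ?thesis
  proof (rule that)
    show "gauss_decay (pi * \<beta>) \<tau>"
      unfolding \<tau>_def[abs_def] using a(1) by (intro gauss_decay_cmult) (simp add: P_def)
  qed (use a in \<open>auto simp: m P_def\<close>)
qed

text \<open>The \<open>N\<close>-th power of the Laurent series of the base kernel has zeros of order \<open>N\<close>.\<close>

lemma ex_power_kernel: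
  assumes b: "\<beta> > 0" and N: "N \<ge> 1"
  shows "\<exists>\<kappa>. gauss_decay (pi * \<beta> / real N) \<kappa> \<and>
     (\<forall>l i. l \<noteq> 0 \<longrightarrow> i < N \<longrightarrow> moment \<kappa> (- 2 * pi * \<beta> * of_int l) i = 0) \<and> moment \<kappa> 0 0 = 1"
  using N
proof (induction N rule: dec_induct)
  case base
  show ?case using ex_base_kernel[OF b] by (metis div_by_1 less_one of_nat_1)
next
  case (step N)
  obtain \<kappa> where \<kappa>: "gauss_decay (pi * \<beta> / real N) \<kappa>" "moment \<kappa> 0 0 = 1"
     "\<And>l i. l \<noteq> 0 \<Longrightarrow> i < N \<Longrightarrow> moment \<kappa> (- 2 * pi * \<beta> * of_int l) i = 0"
    using step.IH by blast
  obtain \<tau> where \<tau>: "gauss_decay (pi * \<beta>) \<tau>" "\<And>l. l \<noteq> 0 \<Longrightarrow> moment \<tau> (- 2 * pi * \<beta> * of_int l) 0 = 0"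
    "moment \<tau> 0 0 = 1"
    using ex_base_kernel[OF b] by blast
  have pos: "pi * \<beta> > 0" "pi * \<beta> / real N > 0" using b step by auto
  have eq: "pi * \<beta> / real N * (pi * \<beta>) / (pi * \<beta> / real N + pi * \<beta>) = pi * \<beta> / real (Suc N)"
  proof -
    have "pi * \<beta> / real N + pi * \<beta> = pi * \<beta> * real (Suc N) / real N"
      using step(1) by (simp add: field_simps)
    then show ?thesis using b step(1) by simp
  qed
  note mc = moment_conv[OF \<kappa>(1) pos(2) \<tau>(1) pos(1)]
  show ?case
  proof (intro exI[of _ "conv \<kappa> \<tau>"] conjI allI impI)
    show "gauss_decay (pi * \<beta> / real (Suc N)) (conv \<kappa> \<tau>)"
      using gauss_decay_conv[OF \<kappa>(1) pos(2) \<tau>(1) pos(1)] unfolding eq .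
    show "moment (conv \<kappa> \<tau>) 0 0 = 1" by (simp add: mc \<kappa> \<tau>)
    fix l :: int and i assume l: "l \<noteq> 0" and i: "i < Suc N"
    show "moment (conv \<kappa> \<tau>) (- 2 * pi * \<beta> * of_int l) i = 0"
      unfolding mc
    proof (rule sum.neutral, rule ballI)
      fix j assume "j \<in> {..i}"
      \<comment> \<open>In the Leibniz rule either the first factor is differentiated fewer than \<open>N\<close> times or the
        second one not at all.\<close>
      then consider "j < N" | "i - j = 0" using i by force
      then show "real (i choose j) * moment \<kappa> (- 2 * pi * \<beta> * of_int l) j * moment \<tau> (- 2 * pi * \<beta> * of_int l) (i - j) = 0"
        by cases (use \<kappa>(3)[OF l, of j] \<tau>(2)[OF l] in auto)
    qed
  qed
qed

text \<open>Multiplying the power kernel by \<open>(\<zeta> - 1)\<^sup>j\<close> and a constant gives kernels \<open>\<eta>\<^sub>j\<close> whose moments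
  at \<open>1\<close> vanish below order \<open>j\<close> and equal \<open>1\<close> at order \<open>j\<close>. This triangular system is solved for
  the moments of the point evaluation at \<open>0\<close>, so that summation against \<open>\<kappa>\<close> sends a polynomial of
  degree below \<open>N\<close> to its value at \<open>0\<close>.\<close>

lemma ex_prescribed_moments_kernel:
  assumes b: "\<beta> > 0" and N: "N \<ge> 1"
  obtains \<kappa> where "gauss_decay (pi * \<beta> / real N) \<kappa>"
     "\<And>l i. l \<noteq> 0 \<Longrightarrow> i < N \<Longrightarrow> moment \<kappa> (- 2 * pi * \<beta> * of_int l) i = 0" 
     "\<And>i. i < N \<Longrightarrow> moment \<kappa> 0 i = 0 ^ i"
proof -
  define \<alpha> where "\<alpha> = pi * \<beta> / real N"
  have \<alpha>: "\<alpha> > 0" using b N by (simp add: \<alpha>_def)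
  define P where "P a \<longleftrightarrow> gauss_decay \<alpha> a \<and> (\<forall>l i. l \<noteq> 0 \<longrightarrow> i < N \<longrightarrow> moment a (- 2 * pi * \<beta> * of_int l) i = 0)" for a
  have madd: "moment (\<lambda>n. x n + c * y n) s i = moment x s i + c * moment y s i" if "P x" "P y" for x y c s i
    using that moment_add[OF _ _ \<alpha>] by (simp add: P_def)
  have Padd: "P (\<lambda>n. x n + c * y n)" if "P x" "P y" for x y c
    using that madd[OF that] by (auto simp: P_def intro!: gauss_decay_add gauss_decay_cmult)
  have mmul: "moment (\<lambda>n. c * y n) s i = c * moment y s i" for y c s i
    unfolding moment_def mult.assoc by (rule infsum_cmult_right')
  have Pbd: "P (shift_diff x)" if "P x" for x
    using that by (auto simp: P_def moment_shift_diff[OF _ \<alpha>] intro!: gauss_decay_shift_diff \<alpha>)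
  have Pmul: "P (\<lambda>n. c * y n)" if "P y" for y c
    using that by (auto simp: P_def mmul intro!: gauss_decay_cmult)
  have basis: "\<exists>\<eta>. P \<eta> \<and> (\<forall>i\<le>j. moment \<eta> 0 i = (if i = j then 1 else 0))" for j
  proof (induction j)
    case 0
    show ?case using ex_power_kernel[OF b N] by (auto simp: P_def \<alpha>_def)
  next
    case (Suc j)
    then obtain \<eta> where \<eta>: "P \<eta>" "\<And>i. i \<le> j \<Longrightarrow> moment \<eta> 0 i = (if i = j then 1 else 0)" by blast
    have g: "gauss_decay \<alpha> \<eta>" using \<eta>(1) by (simp add: P_def)
    have m: "moment (shift_diff \<eta>) 0 i = (\<Sum>k<i. real (i choose k) * moment \<eta> 0 k)" for i
    proof -
      have "{..i} = insert i {..<i}" by auto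
      then show ?thesis unfolding moment_shift_diff[OF g \<alpha>] by simp
    qed
    have m1: "moment (shift_diff \<eta>) 0 i = (if i = Suc j then real (Suc j) else 0)" if "i \<le> Suc j" for i
    proof -
      have "moment (shift_diff \<eta>) 0 i = (\<Sum>k<i. if k = j then real (i choose j) else 0)"
        unfolding m by (rule sum.cong) (use that \<eta>(2) in auto)
      also have "\<dots> = (if i = Suc j then real (Suc j) else 0)"
        using that by (auto simp: binomial_Suc_n)
      finally show ?thesis .
    qed
    show ?case
    \<comment> \<open>The moment of order \<open>j + 1\<close> of the difference is \<open>j + 1\<close> times the one of order \<open>j\<close>.\<close>
    proof (rule exI[of _ "\<lambda>n. (1 / real (Suc j)) * shift_diff \<eta> n"], intro conjI allI impI)
      show "P (\<lambda>n. (1 / real (Suc j)) * shift_diff \<eta> n)" by (intro Pmul Pbd \<eta>(1))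
      show "moment (\<lambda>n. (1 / real (Suc j)) * shift_diff \<eta> n) 0 i = (if i = Suc j then 1 else 0)" if "i \<le> Suc j" for i
        unfolding mmul m1[OF that] by simp
    qed
  qed
  have "\<exists>\<kappa>. P \<kappa> \<and> (\<forall>i<M. moment \<kappa> 0 i = 0 ^ i)" for M
  proof (induction M)
    case 0
    show ?case using basis[of 0] by auto
  next
    case (Suc M)
    obtain \<kappa> where \<kappa>: "P \<kappa>" "\<And>i. i < M \<Longrightarrow> moment \<kappa> 0 i = 0 ^ i" using Suc by blast
    obtain \<eta> where \<eta>: "P \<eta>" "\<And>i. i \<le> M \<Longrightarrow> moment \<eta> 0 i = (if i = M then 1 else 0)" using basis[of M] by blast
    show ?case
      by (rule exI[of _ "\<lambda>n. \<kappa> n + (0 ^ M - moment \<kappa> 0 M) * \<eta> n"])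
         (use \<kappa> \<eta> in \<open>auto simp: madd less_Suc_eq intro!: Padd\<close>)
  qed
  then show ?thesis using that unfolding P_def \<alpha>_def by blast
qed

section \<open>Fourier series of periodic entire functions\<close>

text \<open>As a function of \<open>z\<close>, the integral has derivative \<open>h (1 + z) - h z = 0\<close>.\<close>

lemma integral_period_translate:
  fixes h :: "complex \<Rightarrow> complex"
  assumes h: "h holomorphic_on UNIV" and per: "\<And>z. h (z + 1) = h z"
  shows "integral {0..1} (\<lambda>x. h (of_real x + z)) = integral {0..1} (\<lambda>x. h (of_real x))"
proof -
  have hd: "(h has_field_derivative deriv h z) (at z)" for z
    by (rule holomorphic_derivI[OF h open_UNIV UNIV_I])
  have cd: "continuous_on UNIV (deriv h)"
    by (intro holomorphic_on_imp_continuous_on holomorphic_deriv h open_UNIV)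
  have ch: "continuous_on UNIV h" by (rule holomorphic_on_imp_continuous_on[OF h])
  have z0: "integral {0..1} (\<lambda>x. deriv h (of_real x + z)) = 0" for z
  proof -
    have "((\<lambda>x. deriv h (of_real x + z)) has_integral h (of_real 1 + z) - h (of_real 0 + z)) {0..1}"
    proof (rule fundamental_theorem_of_calculus)
      fix x :: real
      have "((\<lambda>w. h (w + z)) has_field_derivative deriv h (of_real x + z)) (at (of_real x))"
        by (intro DERIV_shift[THEN iffD1] hd)
      then show "((\<lambda>x. h (of_real x + z)) has_vector_derivative deriv h (of_real x + z)) (at x within {0..1})"
        by (rule has_vector_derivative_real_field[THEN has_vector_derivative_at_within])
    qed simp
    then show ?thesis using per[of z] by (simp add: add.commute integral_unique)
  qed
  have "((\<lambda>z. integral (cbox 0 1) (\<lambda>x. h (of_real x + z))) has_field_derivative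
      integral (cbox 0 1) (\<lambda>x. deriv h (of_real x + z))) (at z within UNIV)" for z
  proof (rule leibniz_rule_field_derivative)
    fix w and t :: real
    show "((\<lambda>z. h (of_real t + z)) has_field_derivative deriv h (of_real t + w)) (at w within UNIV)"
      using DERIV_shift[THEN iffD1, OF hd[of "w + of_real t"]] by (simp add: add.commute)
  next
    fix w 
    show "(\<lambda>x. h (of_real x + w)) integrable_on cbox 0 1"
      by (intro integrable_continuous continuous_intros continuous_on_compose2[OF ch]) auto
  next
    show "continuous_on (UNIV \<times> cbox 0 1) (\<lambda>(z, t). deriv h (of_real t + z))"
      unfolding case_prod_unfold
      by (intro continuous_intros continuous_on_compose2[OF cd]) auto
  qed auto
  then have "((\<lambda>z. integral {0..1} (\<lambda>x. h (of_real x + z))) has_field_derivative 0) (at z within UNIV)" for z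
    by (simp add: z0)
  then obtain c where "integral {0..1} (\<lambda>x. h (of_real x + z)) = c" for z
    using has_field_derivative_zero_constant[of UNIV] by (metis UNIV_I convex_UNIV)
  from this[of z] this[of 0] show ?thesis by simp
qed

definition fourier_coeff :: "(complex \<Rightarrow> complex) \<Rightarrow> int \<Rightarrow> complex" where
  "fourier_coeff g k = integral {0..1} (\<lambda>x. g (of_real x) * exp (- 2 * of_real pi * \<i> * of_int k * of_real x))"

lemma exp_period: "exp (c * of_real pi * \<i> * of_int k * (z + 1)) = exp (c * of_real pi * \<i> * of_int k * z)" 
  if "c = 2 \<or> c = -2" for z c :: complex
proof -
  have "exp (c * of_real pi * \<i> * of_int k) = 1"
    using that exp_integer_2pi[of "of_int k"] exp_integer_2pi[of "of_int (-k)"] by (auto simp: mult_ac)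
  then show ?thesis by (simp add: distrib_left exp_add)
qed

lemma fourier_coeff_translate:
  assumes g: "g holomorphic_on UNIV" and per: "\<And>z. g (z + 1) = g z"
  shows "fourier_coeff g k = 
    integral {0..1} (\<lambda>x. g (of_real x + w) * exp (- 2 * of_real pi * \<i> * of_int k * (of_real x + w)))"
  unfolding fourier_coeff_def
  by (rule integral_period_translate[symmetric, where h="\<lambda>z. g z * exp (- 2 * of_real pi * \<i> * of_int k * z)"])
     (use g per exp_period[of "-2"] in \<open>auto intro!: holomorphic_intros\<close>)

text \<open>Moving the path of integration to height \<open>-1\<close> for \<open>k \<ge> 0\<close> and to height \<open>1\<close> for \<open>k < 0\<close>
  gains a factor \<open>exp (-2 \<pi> \<bar>k\<bar>)\<close>.\<close>

lemma fourier_coeff_bound: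
  assumes g: "g holomorphic_on UNIV" and per: "\<And>z. g (z + 1) = g z"
  obtains C where "\<And>k. norm (fourier_coeff g k) \<le> C * exp (- \<bar>of_int k\<bar>)"
proof -
  have cg: "continuous_on UNIV g" by (rule holomorphic_on_imp_continuous_on[OF g])
  have "\<exists>C. \<forall>x\<in>{0..1}. norm (g (of_real x + w)) \<le> C" for w
  proof -
    have "compact ((\<lambda>x. g (of_real x + w)) ` {0..1})"
      by (intro compact_continuous_image continuous_intros continuous_on_compose2[OF cg]) auto
    then have "bounded ((\<lambda>x. g (of_real x + w)) ` {0..1})" by (rule compact_imp_bounded)
    then show ?thesis unfolding bounded_iff by auto
  qed
  then obtain C1 C2 where C: "\<And>x. x \<in> {0..1} \<Longrightarrow> norm (g (of_real x + \<i>)) \<le> C1"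
     "\<And>x. x \<in> {0..1} \<Longrightarrow> norm (g (of_real x - \<i>)) \<le> C2"
    by (metis diff_conv_add_uminus)
  define C where "C = max C1 C2"
  have nonneg: "C \<ge> 0"
    using order_trans[OF norm_ge_zero C(1)[of 0]] unfolding C_def by simp
  have bound: "norm (fourier_coeff g k) \<le> C * exp (2 * pi * of_int k * Im w)"
    if w: "\<And>x. x \<in> {0..1} \<Longrightarrow> norm (g (of_real x + w)) \<le> C" for k w
  proof -
    have "norm (fourier_coeff g k) \<le> C * exp (2 * pi * of_int k * Im w) * measure lborel (cbox 0 (1::real))"
      unfolding fourier_coeff_translate[OF g per, of k w] interval_cbox
    proof (rule integrable_bound)
      show "(\<lambda>x. g (of_real x + w) * exp (- 2 * of_real pi * \<i> * of_int k * (of_real x + w))) integrable_on cbox 0 1"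
        by (intro integrable_continuous continuous_intros continuous_on_compose2[OF cg]) auto
      fix x :: real assume "x \<in> cbox 0 1"
      then have "norm (g (of_real x + w)) \<le> C" using w by simp
      then show "norm (g (of_real x + w) * exp (- 2 * of_real pi * \<i> * of_int k * (of_real x + w))) \<le>
          C * exp (2 * pi * of_int k * Im w)"
        unfolding norm_mult by (intro mult_mono) (auto simp: norm_exp_eq_Re nonneg)
    qed (use nonneg in auto)
    then show ?thesis by simp
  qed
  have "norm (fourier_coeff g k) \<le> C * exp (- \<bar>of_int k\<bar>)" for k
  proof -
    have ee: "exp (- 2 * pi * \<bar>of_int k\<bar>) \<le> exp (- \<bar>of_int k\<bar> :: real)"
      using pi_gt3 mult_right_mono[of 1 "2 * pi" "\<bar>of_int k\<bar>"] by simp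
    have "norm (fourier_coeff g k) \<le> C * exp (- 2 * pi * \<bar>of_int k\<bar>)"
    proof (cases "k \<ge> 0")
      case True
      have "norm (g (of_real x + - \<i>)) \<le> C" if "x \<in> {0..1}" for x
        using C(2)[OF that] by (simp add: C_def)
      from bound[OF this, of k] True show ?thesis by simp
    next
      case False
      have "norm (g (of_real x + \<i>)) \<le> C" if "x \<in> {0..1}" for x
        using C(1)[OF that] by (simp add: C_def)
      from bound[OF this, of k] False show ?thesis by simp
    qed
    also have "\<dots> \<le> C * exp (- \<bar>of_int k\<bar>)" by (rule mult_left_mono[OF ee nonneg])
    finally show ?thesis .
  qed
  then show thesis by (rule that)
qed

lemma fourier_coeff_summable:
  assumes g: "g holomorphic_on UNIV" and per: "\<And>z. g (z + 1) = g z"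
  shows "(\<lambda>k. norm (fourier_coeff g k)) summable_on UNIV"
proof -
  obtain C where C: "\<And>k. norm (fourier_coeff g k) \<le> C * exp (- \<bar>of_int k\<bar>)"
    using fourier_coeff_bound[of g] g per by blast
  have "(\<lambda>k::int. C * exp (- \<bar>of_int k\<bar>)) summable_on UNIV"
    using exp_neg_abs_int_summable[of 1] by (intro summable_on_cmult_right) simp
  then show ?thesis by (rule summable_on_comparison_test) (use C in auto)
qed

lemma periodic_int:
  fixes g :: "complex \<Rightarrow> 'a"
  assumes "\<And>z. g (z + 1) = g z" shows "g (z + of_int n) = g z"
proof (induction n rule: int_induct[where k=0])
  case (step1 i) then show ?case using assms[of "z + of_int i"] by (simp add: add_ac)
next
  case (step2 i) then show ?case using assms[of "z + of_int (i - 1)"] by (simp add: add_ac)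
qed simp

text \<open>The zeros of \<open>exp (2 \<pi> \<i> z) - 1\<close> are the integers and they are simple. The numerator
  vanishes there, so the singularities of the quotient are removable; by periodicity it suffices
  to look at \<open>0\<close>.\<close>

lemma periodic_divide:
  fixes g :: "complex \<Rightarrow> complex"
  assumes g: "g holomorphic_on UNIV" and per: "\<And>z. g (z + 1) = g z"
  obtains f where "f holomorphic_on UNIV" "\<And>z. f (z + 1) = f z" 
    "\<And>z. g z - g 0 = f z * (exp (2 * of_real pi * \<i> * z) - 1)"
proof
  define E where "E z = exp (2 * of_real pi * \<i> * z) - 1" for z
  define f where "f z = (if z \<in> \<int> then deriv g 0 / (2 * of_real pi * \<i>) else (g z - g 0) / E z)" for z
  have E0: "E z = 0 \<longleftrightarrow> z \<in> \<int>" for z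
  proof -
    have "E z = 0 \<longleftrightarrow> (\<exists>n::int. 2 * of_real pi * \<i> * z = of_real (real_of_int (2 * n) * pi) * \<i>)"
      unfolding E_def using exp_eq_1[of "2 * of_real pi * \<i> * z"] 
      by (auto simp: complex_eq_iff)
    also have "\<dots> \<longleftrightarrow> (\<exists>n::int. z = of_int n)" by auto
    finally show ?thesis by (auto simp: Ints_def)
  qed
  have Eper: "E (z + 1) = E z" for z using exp_period[of 2 1 z] by (simp add: E_def)
  show fper: "f (z + 1) = f z" for z
    by (simp add: f_def Eper per)
  have g0: "g z = g 0" if "z \<in> \<int>" for z
    using that periodic_int[of g, OF per, of 0] by (auto elim!: Ints_cases)
  show "g z - g 0 = f z * (exp (2 * of_real pi * \<i> * z) - 1)" for z
    using E0[of z] g0[of z] by (auto simp: f_def E_def)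
  have opn: "open (- \<int> :: complex set)" using closed_Ints by (simp add: open_closed)
  have hol1: "f holomorphic_on - \<int>"
  proof (rule holomorphic_transform)
    show "(\<lambda>z. (g z - g 0) / E z) holomorphic_on - \<int>"
      unfolding E_def using E0 by (intro holomorphic_intros holomorphic_on_subset[OF g]) (auto simp: E_def)
  qed (auto simp: f_def)
  have lim0: "(f \<longlongrightarrow> f 0) (at 0)"
  proof -
    have 1: "((\<lambda>z. (g z - g 0) / (z - 0)) \<longlongrightarrow> deriv g 0) (at 0)"
      using holomorphic_derivI[OF g open_UNIV UNIV_I, of 0] by (simp add: has_field_derivative_iff)
    have "(E has_field_derivative 2 * of_real pi * \<i>) (at 0)"
      unfolding E_def by (auto intro!: derivative_eq_intros)
    then have 2: "((\<lambda>z. E z / (z - 0)) \<longlongrightarrow> 2 * of_real pi * \<i>) (at 0)"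
      by (simp add: has_field_derivative_iff E_def)
    have "((\<lambda>z. ((g z - g 0) / (z - 0)) / (E z / (z - 0))) \<longlongrightarrow> deriv g 0 / (2 * of_real pi * \<i>)) (at 0)"
      by (intro tendsto_divide 1 2) simp
    moreover have "\<forall>\<^sub>F z in at (0::complex). ((g z - g 0) / (z - 0)) / (E z / (z - 0)) = f z"
    proof -
      have "open (ball (0::complex) 1)" by simp
      then have "\<forall>\<^sub>F z in at (0::complex). z \<in> ball 0 1 - {0}"
        by (intro eventually_at_in_open) auto
      then show ?thesis
      proof (eventually_elim)
        case (elim z)
        have "z \<notin> \<int>" 
        proof
          assume "z \<in> \<int>"
          then obtain n where n: "z = of_int n" by (auto elim: Ints_cases)
          with elim show False by (auto simp: norm_of_int)
        qed
        then show ?case using elim by (simp add: f_def)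
      qed
    qed
    ultimately show ?thesis by (auto simp: f_def intro: Lim_transform_eventually)
  qed
  have ball0: "f holomorphic_on ball 0 1"
  proof (rule no_isolated_singularity'[where K="{0}"])
    have "ball 0 1 - {0} \<subseteq> - (\<int>::complex set)"
    proof
      fix z :: complex assume z: "z \<in> ball 0 1 - {0}"
      have False if "z = of_int n" for n
        using z that by (auto simp: norm_of_int)
      then show "z \<in> - \<int>" by (auto elim!: Ints_cases)
    qed
    then show "f holomorphic_on ball 0 1 - {0}" by (rule holomorphic_on_subset[OF hol1])
    show "(f \<longlongrightarrow> f z) (at z within ball 0 1)" if "z \<in> {0}" for z
      using that lim0 by (auto intro: tendsto_within_subset)
  qed auto
  have fd0: "f field_differentiable at 0"
    using ball0 by (rule holomorphic_on_imp_differentiable_at) auto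
  have "f field_differentiable at z" for z
  proof (cases "z \<in> \<int>")
    case False
    then show ?thesis using holomorphic_on_imp_differentiable_at[OF hol1 opn] by auto
  next
    case True
    then obtain n where n: "z = of_int n" by (auto elim: Ints_cases)
    from fd0 obtain f' where "(f has_field_derivative f') (at (z + - of_int n))"
      by (auto simp: field_differentiable_def n)
    then have "((\<lambda>w. f (w + - of_int n)) has_field_derivative f') (at z)"
      by (subst (asm) DERIV_shift)
    moreover have "f (w + - of_int n) = f w" for w
      using periodic_int[of f w "-n", OF fper] by simp
    ultimately show ?thesis by (auto simp: field_differentiable_def)
  qed
  then show "f holomorphic_on UNIV" by (simp add: holomorphic_on_def)
qed

lemma integral_exp_int:
  "integral {0..1} (\<lambda>x. exp (- 2 * of_real pi * \<i> * of_int k * of_real x)) = (if k = 0 then 1 else 0 :: complex)"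
proof (cases "k = 0")
  case False
  define c where "c = - 2 * of_real pi * \<i> * of_int k"
  have c: "c \<noteq> 0" using False by (simp add: c_def)
  have "((\<lambda>x. exp (c * of_real x)) has_integral exp (c * of_real 1) / c - exp (c * of_real 0) / c) {0..1}"
  proof (rule fundamental_theorem_of_calculus)
    fix x :: real
    have "((\<lambda>w. exp (c * w) / c) has_field_derivative exp (c * of_real x)) (at (of_real x))"
      using c by (auto intro!: derivative_eq_intros)
    then show "((\<lambda>x. exp (c * of_real x) / c) has_vector_derivative exp (c * of_real x)) (at x within {0..1})"
      by (rule has_vector_derivative_real_field[THEN has_vector_derivative_at_within])
  qed simp
  moreover have "exp c = 1"
    unfolding c_def using exp_integer_2pi[of "of_int (-k)"] by (auto simp: mult_ac)
  ultimately show ?thesis using False by (simp add: integral_unique c_def)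
qed simp

text \<open>Chernoff's argument: dividing \<open>g - g 0\<close> by \<open>exp (2 \<pi> \<i> z) - 1\<close> yields a periodic entire \<open>f\<close>,
  and the Fourier coefficients of \<open>g - g 0\<close> are the differences of consecutive coefficients of
  \<open>f\<close>, which telescope to \<open>0\<close>.\<close>

lemma fourier_sum_at_0:
  assumes g: "g holomorphic_on UNIV" and per: "\<And>z. g (z + 1) = g z"
  shows "(fourier_coeff g has_sum g 0) UNIV"
proof -
  obtain f where f: "f holomorphic_on UNIV" "\<And>z. f (z + 1) = f z" 
    "\<And>z. g z - g 0 = f z * (exp (2 * of_real pi * \<i> * z) - 1)"
    using periodic_divide[of g] g per by blast
  have cf: "continuous_on UNIV f" by (rule holomorphic_on_imp_continuous_on[OF f(1)])
  have rel: "fourier_coeff g k = fourier_coeff f (k - 1) - fourier_coeff f k + (if k = 0 then g 0 else 0)" for k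
  proof -
    have int: "(\<lambda>x. f (of_real x) * exp (- 2 * of_real pi * \<i> * of_int j * of_real x)) integrable_on {0..1}" for j
      unfolding interval_cbox by (intro integrable_continuous continuous_intros continuous_on_compose2[OF cf]) auto
    have int2: "(\<lambda>x. g 0 * exp (- 2 * of_real pi * \<i> * of_int k * of_real x)) integrable_on {0..1}"
      unfolding interval_cbox by (intro integrable_continuous continuous_intros)
    have eq: "g (of_real x) * exp (- 2 * of_real pi * \<i> * of_int k * of_real x) =
       (f (of_real x) * exp (- 2 * of_real pi * \<i> * of_int (k - 1) * of_real x) -
       f (of_real x) * exp (- 2 * of_real pi * \<i> * of_int k * of_real x)) +
       g 0 * exp (- 2 * of_real pi * \<i> * of_int k * of_real x)" for x
    proof -
      have A: "exp (- 2 * of_real pi * \<i> * of_int (k - 1) * of_real x) =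
         exp (2 * of_real pi * \<i> * of_real x) * exp (- 2 * of_real pi * \<i> * of_int k * of_real x)"
        unfolding exp_add[symmetric] by (rule arg_cong[where f=exp]) (simp add: algebra_simps)
      have B: "g (of_real x) = f (of_real x) * (exp (2 * of_real pi * \<i> * of_real x) - 1) + g 0"
        using f(3)[of "of_real x"] by (simp add: algebra_simps)
      show ?thesis unfolding A B by (simp only: ring_distribs mult_1_left mult_1_right mult_ac)
    qed
    show ?thesis
      unfolding fourier_coeff_def[of g] eq
      unfolding integral_add[OF integrable_diff[OF int int] int2] integral_diff[OF int int] integral_mult_right integral_exp_int
      by (simp add: fourier_coeff_def)
  qed
  have fs: "fourier_coeff f summable_on UNIV"
    by (rule abs_summable_summable) (rule fourier_coeff_summable[OF f(1,2)])
  define S where "S = infsum (fourier_coeff f) UNIV"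
  have S: "(fourier_coeff f has_sum S) UNIV" using fs by (simp add: S_def)
  have S1: "((\<lambda>k. fourier_coeff f (k - 1)) has_sum S) UNIV"
    using S by (subst has_sum_reindex_bij_witness[where i="\<lambda>k. k + 1" and j="\<lambda>k. k - 1" and T=UNIV and h="fourier_coeff f"]) auto
  have S2: "((\<lambda>k. - fourier_coeff f k) has_sum - S) UNIV" using S by (simp add: has_sum_uminus)
  have d: "((\<lambda>k::int. if k = 0 then g 0 else 0) has_sum g 0) UNIV"
    by (rule has_sum_finite_neutralI[where B="{0}"]) auto
  have "((\<lambda>k. fourier_coeff f (k - 1) + - fourier_coeff f k + (if k = 0 then g 0 else 0)) has_sum (S + - S + g 0)) UNIV"
    by (intro has_sum_add S1 S2 d)
  then show ?thesis by (simp add: rel[abs_def])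
qed

text \<open>The value at \<open>z\<close> is the value at \<open>0\<close> of the function translated by \<open>z\<close>.\<close>

lemma fourier_expansion:
  assumes g: "g holomorphic_on UNIV" and per: "\<And>z. g (z + 1) = g z"
  shows "((\<lambda>k. fourier_coeff g k * exp (2 * of_real pi * \<i> * of_int k * z)) has_sum g z) UNIV"
    and "(\<lambda>k. norm (fourier_coeff g k * exp (2 * of_real pi * \<i> * of_int k * z))) summable_on UNIV"
proof -
  define G where "G w = g (w + z)" for w
  have G: "G holomorphic_on UNIV" unfolding G_def[abs_def]
    by (intro holomorphic_on_compose_gen[OF _ g, unfolded o_def] holomorphic_intros) auto
  have Gper: "G (w + 1) = G w" for w using per[of "w + z"] by (simp add: G_def add_ac)
  have eq: "fourier_coeff G k = fourier_coeff g k * exp (2 * of_real pi * \<i> * of_int k * z)" for k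
  proof -
    have "fourier_coeff g k * exp (2 * of_real pi * \<i> * of_int k * z) = 
      integral {0..1} (\<lambda>x. (g (of_real x + z) * exp (- 2 * of_real pi * \<i> * of_int k * (of_real x + z))) * 
          exp (2 * of_real pi * \<i> * of_int k * z))"
      unfolding fourier_coeff_translate[OF g per, of k z] by (simp add: integral_mult_left)
    also have "\<dots> = fourier_coeff G k"
      unfolding fourier_coeff_def G_def
      by (intro integral_cong) (simp add: algebra_simps flip: exp_add)
    finally show ?thesis ..
  qed
  then have eq: "fourier_coeff G = (\<lambda>k. fourier_coeff g k * exp (2 * of_real pi * \<i> * of_int k * z))"
    by (rule ext)
  show "((\<lambda>k. fourier_coeff g k * exp (2 * of_real pi * \<i> * of_int k * z)) has_sum g z) UNIV"
    using fourier_sum_at_0[OF G Gper] unfolding eq by (simp add: G_def)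
  show "(\<lambda>k. norm (fourier_coeff g k * exp (2 * of_real pi * \<i> * of_int k * z))) summable_on UNIV"
    using fourier_coeff_summable[OF G Gper] by (simp add: eq)
qed

section \<open>Polyanalytic functions as polynomials in the imaginary part\<close>

lemma dbar_eq:
  assumes "(F has_derivative D) (at z)" shows "dbar F z = (D 1 + \<i> * D \<i>) / 2"
  unfolding dbar_def frechet_derivative_at[OF assms, symmetric] ..

lemma dbar_Im_polynomial:
  assumes h: "\<And>j. j < M \<Longrightarrow> h j holomorphic_on UNIV"
  shows "(\<lambda>z. \<Sum>j<M. of_real (Im z) ^ j * h j z) differentiable (at z)"
    and "dbar (\<lambda>z. \<Sum>j<M. of_real (Im z) ^ j * h j z) z =
      (\<Sum>j<M. \<i> / 2 * of_nat j * of_real (Im z) ^ (j - 1) * h j z)"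
proof -
  define D where "D w = (\<Sum>j<M. of_real (Im z) ^ j * (deriv (h j) z * w) +
      (of_nat j * of_real (Im w) * of_real (Im z) ^ (j - 1)) * h j z)" for w
  have hd: "(h j has_derivative (\<lambda>w. deriv (h j) z * w)) (at z)" if "j < M" for j
    using holomorphic_derivI[OF h[OF that] open_UNIV UNIV_I, of z] 
    by (simp add: has_field_derivative_def)
  have im: "((\<lambda>z. complex_of_real (Im z)) has_derivative (\<lambda>w. of_real (Im w))) (at z)"
    by (intro derivative_intros bounded_linear_imp_has_derivative bounded_linear_compose[OF bounded_linear_of_real bounded_linear_Im])
  have der: "((\<lambda>z. \<Sum>j<M. of_real (Im z) ^ j * h j z) has_derivative D) (at z)"
    unfolding D_def
    by (intro has_derivative_sum has_derivative_mult hd has_derivative_power im) auto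
  then show "(\<lambda>z. \<Sum>j<M. of_real (Im z) ^ j * h j z) differentiable (at z)"
    by (auto simp: differentiable_def)
  show "dbar (\<lambda>z. \<Sum>j<M. of_real (Im z) ^ j * h j z) z =
      (\<Sum>j<M. \<i> / 2 * of_nat j * of_real (Im z) ^ (j - 1) * h j z)"
    unfolding dbar_eq[OF der]
    by (simp add: D_def sum_distrib_left sum.distrib[symmetric] sum_divide_distrib field_simps)
qed

text \<open>Since \<open>dbar\<close> maps \<open>Im z\<close> to \<open>\<i> / 2\<close>, a polynomial in \<open>Im z\<close> with entire coefficients can be
  integrated formally with respect to \<open>dbar\<close>; what is left over is annihilated by \<open>dbar\<close>, that is,
  entire. The powers of \<open>Im z\<close>, unlike those of the conjugate of \<open>z\<close>, are invariant under the
  translation \<open>z \<mapsto> z + 1\<close>.\<close>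

lemma polyanalytic_imp_Im_polynomial:
  assumes "polyanalytic N F"
  obtains h where "\<And>j. j < N \<Longrightarrow> h j holomorphic_on UNIV" "\<And>z. F z = (\<Sum>j<N. of_real (Im z) ^ j * h j z)"
proof -
  have "\<exists>h. (\<forall>j<N. h j holomorphic_on UNIV) \<and> (\<forall>z. F z = (\<Sum>j<N. of_real (Im z) ^ j * h j z))"
    using assms
  proof (induction N arbitrary: F)
    case 0
    then show ?case by (simp add: polyanalytic_def)
  next
    case (Suc N)
    have fd: "F differentiable (at z)" for z
      using Suc.prems by (auto simp: polyanalytic_def differentiable_on_def)
    have "polyanalytic N (dbar F)"
      unfolding polyanalytic_def
    proof (intro conjI allI impI)
      show "(dbar ^^ j) (dbar F) differentiable_on UNIV" if "j < N" for j
        using Suc.prems that unfolding polyanalytic_def by (metis Suc_less_eq funpow_simps_right(2) comp_apply)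
      show "(dbar ^^ N) (dbar F) z = 0" for z
        using Suc.prems unfolding polyanalytic_def by (metis funpow_simps_right(2) comp_apply)
    qed
    then obtain h where h: "\<And>j. j < N \<Longrightarrow> h j holomorphic_on UNIV" "\<And>z. dbar F z = (\<Sum>j<N. of_real (Im z) ^ j * h j z)"
      using Suc.IH by blast
    \<comment> \<open>The formal antiderivative of \<open>dbar F\<close>.\<close>
    define p where "p j = (case j of 0 \<Rightarrow> (\<lambda>_. 0) | Suc i \<Rightarrow> (\<lambda>z. 2 / (\<i> * of_nat (Suc i)) * h i z))" for j
    have p: "p j holomorphic_on UNIV" if "j < Suc N" for j
      using that h(1) by (cases j) (auto simp: p_def intro!: holomorphic_intros)
    define P where "P z = (\<Sum>j<Suc N. of_real (Im z) ^ j * p j z)" for z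
    have Pd: "P differentiable (at z)" for z
      unfolding P_def[abs_def] by (rule dbar_Im_polynomial[OF p])
    have Pdb: "dbar P z = dbar F z" for z
    proof -
      have "dbar P z = (\<Sum>j<Suc N. \<i> / 2 * of_nat j * of_real (Im z) ^ (j - 1) * p j z)"
        unfolding P_def[abs_def] by (rule dbar_Im_polynomial(2)[OF p])
      also have "\<dots> = (\<Sum>j<N. of_real (Im z) ^ j * h j z)"
        unfolding sum.lessThan_Suc_shift p_def
        by (simp del: of_nat_Suc)
      finally show ?thesis by (simp add: h(2))
    qed
    define E where "E z = F z - P z" for z
    have Ed: "E differentiable (at z)" for z
      unfolding E_def[abs_def] by (intro differentiable_diff fd Pd)
    have Edb: "dbar E z = 0" for z
    proof -
      note d = frechet_derivative_works[THEN iffD1, OF fd[of z]] frechet_derivative_works[THEN iffD1, OF Pd[of z]]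
      have "dbar E z = dbar F z - dbar P z"
        unfolding E_def[abs_def] dbar_eq[OF has_derivative_diff[OF d]] by (simp add: dbar_def algebra_simps diff_divide_distrib)
      then show ?thesis by (simp add: Pdb)
    qed
    have "polyanalytic 1 E"
      using Ed Edb by (auto simp: polyanalytic_def differentiable_on_def)
    then have Eh: "E holomorphic_on UNIV" by (simp only: polyanalytic_1_iff_entire)
    define q where "q j = (if j = 0 then E else p j)" for j
    have "F z = (\<Sum>j<Suc N. of_real (Im z) ^ j * q j z)" for z
    proof -
      have "F z = E z + P z" by (simp add: E_def)
      also have "\<dots> = (\<Sum>j<Suc N. of_real (Im z) ^ j * q j z)"
        unfolding P_def by (simp only: sum.lessThan_Suc_shift) (simp add: q_def p_def)
      finally show ?thesis .
    qed
    then show ?case using Eh p by (intro exI[of _ q]) (auto simp: q_def)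
  qed
  then show thesis using that by blast
qed

text \<open>Applying \<open>dbar\<close> lowers the degree in \<open>Im z\<close>.\<close>

lemma Im_polynomial_zero:
  assumes "\<And>j. j < N \<Longrightarrow> d j holomorphic_on UNIV" "\<And>z. (\<Sum>j<N. of_real (Im z) ^ j * d j z) = 0"
    and "j < N"
  shows "d j z = 0"
  using assms
proof (induction N arbitrary: d j z)
  case (Suc N)
  let ?e = "\<lambda>j z. \<i> / 2 * of_nat (Suc j) * d (Suc j) z"
  have "(\<Sum>j<N. of_real (Im z) ^ j * ?e j z) = 0" for z
  proof -
    have "(\<Sum>j<N. of_real (Im z) ^ j * ?e j z) = 
       (\<Sum>j<Suc N. \<i> / 2 * of_nat j * of_real (Im z) ^ (j - 1) * d j z)"
      unfolding sum.lessThan_Suc_shift by (simp add: mult_ac)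
    also have "\<dots> = dbar (\<lambda>z. \<Sum>j<Suc N. of_real (Im z) ^ j * d j z) z"
      by (rule dbar_Im_polynomial(2)[OF Suc.prems(1), symmetric])
    also have "(\<lambda>z. \<Sum>j<Suc N. of_real (Im z) ^ j * d j z) = (\<lambda>_. 0)" 
      using Suc.prems(2) by blast
    also have "dbar (\<lambda>_. 0) z = 0" by (subst dbar_eq[OF has_derivative_const]) simp
    finally show ?thesis .
  qed
  then have "?e j z = 0" if "j < N" for j z
    using that Suc.prems(1) by (intro Suc.IH[of ?e]) (auto intro!: holomorphic_intros)
  then have hi: "d (Suc j) z = 0" if "j < N" for j z using that by (simp del: of_nat_Suc)
  have "d 0 z = 0" for z
    using Suc.prems(2)[of z] hi by (subst (asm) sum.lessThan_Suc_shift) simp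
  with hi Suc.prems(3) show ?case by (cases j) auto
qed simp

text \<open>The factor \<open>exp (- \<pi> z\<^sup>2 / 2 - 2 \<pi> \<i> \<nu> z)\<close> turns the quasi-periodicity into periodicity. By
  uniqueness of the expansion in powers of \<open>Im z\<close> the entire coefficient functions are then
  periodic as well.\<close>

lemma fock_space_expansion:
  assumes F: "F \<in> fock_space \<nu> N"
  obtains a :: "nat \<Rightarrow> int \<Rightarrow> complex" where
    "\<And>j z. j < N \<Longrightarrow> (\<lambda>k. norm (a j k * exp (2 * of_real pi * \<i> * of_int k * z))) summable_on UNIV"
    "\<And>z. ((\<lambda>k. (\<Sum>j<N. of_real (Im z) ^ j * a j k) * exp (2 * of_real pi * \<i> * of_int k * z)) has_sum
        F z * exp (- of_real pi / 2 * z\<^sup>2 - 2 * of_real pi * \<i> * of_real \<nu> * z)) UNIV"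
proof -
  have pa: "polyanalytic N F" and qp: "\<And>z k::int. F (z + of_int k) =
            exp (2 * of_real pi * \<i> * of_int k * of_real \<nu>) *
            exp (of_real pi * of_int k * z + of_real pi / 2 * (of_int k)\<^sup>2) * F z"
    using F by (auto simp: fock_space_def)
  obtain h where h: "\<And>j. j < N \<Longrightarrow> h j holomorphic_on UNIV" "\<And>z. F z = (\<Sum>j<N. of_real (Im z) ^ j * h j z)"
    using polyanalytic_imp_Im_polynomial[OF pa] by blast
  define e where "e z = exp (- of_real pi / 2 * z\<^sup>2 - 2 * of_real pi * \<i> * of_real \<nu> * z)" for z
  define g where "g j z = h j z * e z" for j z
  have gh: "g j holomorphic_on UNIV" if "j < N" for j
    unfolding g_def[abs_def] e_def by (intro holomorphic_intros h that)
  have Fg: "F z * e z = (\<Sum>j<N. of_real (Im z) ^ j * g j z)" for z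
    by (simp only: h(2) g_def sum_distrib_right mult.assoc)
  have per: "F (z + 1) * e (z + 1) = F z * e z" for z
  proof -
    have "F (z + 1) * e (z + 1) = F z * (exp (2 * of_real pi * \<i> * of_real \<nu>) * exp (of_real pi * z + of_real pi / 2) * e (z + 1))"
      using qp[of z 1] by simp
    also have "exp (2 * of_real pi * \<i> * of_real \<nu>) * exp (of_real pi * z + of_real pi / 2) * e (z + 1) = e z"
      unfolding e_def exp_add[symmetric] by (rule arg_cong[where f=exp]) (simp add: power2_eq_square field_simps)
    finally show ?thesis .
  qed
  have gper: "g j (z + 1) = g j z" if "j < N" for j z
  proof -
    have "g j (z + 1) - g j z = 0"
    proof (rule Im_polynomial_zero[of N "\<lambda>j z. g j (z + 1) - g j z"])
      show "(\<lambda>z. g j (z + 1) - g j z) holomorphic_on UNIV" if "j < N" for j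
        using gh[OF that]
        by (intro holomorphic_intros holomorphic_on_compose_gen[OF _ gh[OF that], unfolded o_def]) auto
      show "(\<Sum>j<N. of_real (Im z) ^ j * (g j (z + 1) - g j z)) = 0" for z
        using per[of z] by (simp add: Fg right_diff_distrib sum_subtractf)
    qed (fact that)
    then show ?thesis by simp
  qed
  show thesis
  proof (rule that[of "\<lambda>j. fourier_coeff (g j)"])
    show "(\<lambda>k. norm (fourier_coeff (g j) k * exp (2 * of_real pi * \<i> * of_int k * z))) summable_on UNIV" if "j < N" for j z
      by (rule fourier_expansion[OF gh[OF that] gper[OF that]])
    fix z
    have "((\<lambda>k. \<Sum>j<N. of_real (Im z) ^ j * (fourier_coeff (g j) k * exp (2 * of_real pi * \<i> * of_int k * z))) has_sum
        (\<Sum>j<N. of_real (Im z) ^ j * g j z)) UNIV"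
      by (intro has_sum_finite_sum has_sum_cmult_right fourier_expansion gh gper) auto
    then show "((\<lambda>k. (\<Sum>j<N. of_real (Im z) ^ j * fourier_coeff (g j) k) * exp (2 * of_real pi * \<i> * of_int k * z)) has_sum
        F z * exp (- of_real pi / 2 * z\<^sup>2 - 2 * of_real pi * \<i> * of_real \<nu> * z)) UNIV"
      unfolding e_def[symmetric] Fg by (simp add: sum_distrib_right mult.assoc)
  qed
qed

section \<open>Fourier coefficients and the norm\<close>

lemma lborel_complex_eq:
  "(lborel :: complex measure) = distr (lborel \<Otimes>\<^sub>M lborel) borel (\<lambda>p. Complex (fst p) (snd p))"
proof (rule lborel_eqI)
  have meas [measurable]: "(\<lambda>p. Complex (fst p) (snd p)) \<in> borel_measurable (lborel \<Otimes>\<^sub>M lborel)"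
  proof -
    have "(\<lambda>p. Complex (fst p) (snd p)) \<in> borel_measurable borel"
      unfolding Complex_eq by (intro borel_measurable_continuous_onI continuous_intros)
    then show ?thesis by (simp add: lborel_prod)
  qed
  fix l u :: complex assume le: "\<And>b. b \<in> Basis \<Longrightarrow> l \<bullet> b \<le> u \<bullet> b"
  have le': "Re l \<le> Re u" "Im l \<le> Im u" using le[of 1] le[of \<i>] by (auto simp: Basis_complex_def)
  have eq: "(\<lambda>p. Complex (fst p) (snd p)) -` box l u \<inter> space (lborel \<Otimes>\<^sub>M lborel) =
     {Re l<..<Re u} \<times> {Im l<..<Im u}"
    by (auto simp: box_def Basis_complex_def space_pair_measure)
  show "emeasure (distr (lborel \<Otimes>\<^sub>M lborel) borel (\<lambda>p. Complex (fst p) (snd p))) (box l u) =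
      ennreal (\<Prod>b\<in>Basis. (u - l) \<bullet> b)"
    using le' by (simp add: emeasure_distr eq lborel.emeasure_pair_measure_Times ennreal_mult Basis_complex_def
        del: lborel_prod)
qed simp

lemma nn_integral_complex:
  fixes f :: "complex \<Rightarrow> ennreal"
  assumes [measurable]: "f \<in> borel_measurable borel"
  shows "(\<integral>\<^sup>+z. f z \<partial>lborel) = (\<integral>\<^sup>+y. \<integral>\<^sup>+x. f (Complex x y) \<partial>lborel \<partial>lborel)"
proof -
  have meas [measurable]: "(\<lambda>p. Complex (fst p) (snd p)) \<in> borel_measurable (lborel \<Otimes>\<^sub>M lborel)"
  proof -
    have "(\<lambda>p. Complex (fst p) (snd p)) \<in> borel_measurable borel"
      unfolding Complex_eq by (intro borel_measurable_continuous_onI continuous_intros)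
    then show ?thesis by (simp add: lborel_prod)
  qed
  have "(\<integral>\<^sup>+z. f z \<partial>lborel) = (\<integral>\<^sup>+p. f (Complex (fst p) (snd p)) \<partial>(lborel \<Otimes>\<^sub>M lborel))"
    by (subst lborel_complex_eq, subst nn_integral_distr) auto
  also have "\<dots> = (\<integral>\<^sup>+y. \<integral>\<^sup>+x. f (Complex x y) \<partial>lborel \<partial>lborel)"
    by (subst lborel_pair.nn_integral_snd[symmetric]) (auto simp del: lborel_prod)
  finally show ?thesis .
qed

lemma integral_has_sum_Weierstrass:
  fixes f :: "'i \<Rightarrow> real \<Rightarrow> complex"
  assumes c: "\<And>k. continuous_on {0..1} (f k)"
    and b: "\<And>k x. x \<in> {0..1} \<Longrightarrow> norm (f k x) \<le> M k" and M: "M summable_on UNIV"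
  shows "((\<lambda>k. integral {0..1} (f k)) has_sum integral {0..1} (\<lambda>x. \<Sum>\<^sub>\<infinity>k. f k x)) UNIV"
    and "continuous_on {0..1} (\<lambda>x. \<Sum>\<^sub>\<infinity>k. f k x)"
proof -
  have u: "uniform_limit {0..1} (\<lambda>X x. \<Sum>k\<in>X. f k x) (\<lambda>x. \<Sum>\<^sub>\<infinity>k. f k x) (finite_subsets_at_top UNIV)"
    by (rule Weierstrass_m_test_general[OF _ M]) (use b in auto)
  have cs: "continuous_on {0..1} (\<lambda>x. \<Sum>k\<in>X. f k x)" for X
    by (intro continuous_on_sum c)
  show "continuous_on {0..1} (\<lambda>x. \<Sum>\<^sub>\<infinity>k. f k x)"
    by (rule uniform_limit_theorem[OF _ u]) (auto intro!: always_eventually cs)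
  obtain I J where IJ: "\<And>X. ((\<lambda>x. \<Sum>k\<in>X. f k x) has_integral I X) {0..1}"
     "((\<lambda>x. \<Sum>\<^sub>\<infinity>k. f k x) has_integral J) {0..1}" "(I \<longlongrightarrow> J) (finite_subsets_at_top UNIV)"
    by (rule uniform_limit_integral[OF u cs]) auto
  have int: "f k integrable_on {0..1}" for k
    by (rule integrable_continuous_real[OF c])
  have "I X = (\<Sum>k\<in>X. integral {0..1} (f k))" if "finite X" for X
    using integral_unique[OF IJ(1)[of X]] integral_sum[OF that int, symmetric] by simp
  then have "((\<lambda>X. \<Sum>k\<in>X. integral {0..1} (f k)) \<longlongrightarrow> J) (finite_subsets_at_top UNIV)"
    by (intro Lim_transform_eventually[OF IJ(3)] eventually_finite_subsets_at_top_weakI) auto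
  then show "((\<lambda>k. integral {0..1} (f k)) has_sum integral {0..1} (\<lambda>x. \<Sum>\<^sub>\<infinity>k. f k x)) UNIV"
    using integral_unique[OF IJ(2)] by (simp add: has_sum_def)
qed

lemma norm_exp_2pi_i [simp]: "norm (exp (2 * of_real pi * \<i> * of_int k * of_real x)) = 1"
  by (simp add: norm_exp_eq_Re)

text \<open>Absolute summability makes every series below converge uniformly, so both the coefficients
  of \<open>g\<close> and the integral of \<open>g\<close> times its conjugate can be computed term by term.\<close>

lemma parseval:
  fixes u :: "int \<Rightarrow> complex"
  assumes u: "(\<lambda>k. norm (u k)) summable_on UNIV"
  defines "g \<equiv> \<lambda>x::real. \<Sum>\<^sub>\<infinity>k. u k * exp (2 * of_real pi * \<i> * of_int k * of_real x)"
  shows "((\<lambda>x. (norm (g x))\<^sup>2) has_integral (\<Sum>\<^sub>\<infinity>k. (norm (u k))\<^sup>2)) {0..1}"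
    and "(\<lambda>k. (norm (u k))\<^sup>2) summable_on UNIV" and "continuous_on {0..1} g"
proof -
  let ?E = "\<lambda>k x. exp (2 * of_real pi * \<i> * of_int k * of_real x) :: complex"
  have cnjE: "cnj (?E k x) = ?E (-k) x" for k x by (simp add: exp_cnj)
  have gc: "continuous_on {0..1} g"
    unfolding g_def
    by (rule integral_has_sum_Weierstrass(2)[OF _ _ u]) (auto intro!: continuous_intros simp: norm_mult)
  then show "continuous_on {0..1} g" .
  have coeff: "integral {0..1} (\<lambda>x. g x * ?E (-k) x) = u k" for k
  proof -
    have "((\<lambda>j. integral {0..1} (\<lambda>x. u j * ?E j x * ?E (-k) x)) has_sum
        integral {0..1} (\<lambda>x. \<Sum>\<^sub>\<infinity>j. u j * ?E j x * ?E (-k) x)) UNIV"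
      by (rule integral_has_sum_Weierstrass(1)[OF _ _ u]) (auto intro!: continuous_intros simp: norm_mult simp del: of_int_minus)
    also have "(\<lambda>x. \<Sum>\<^sub>\<infinity>j. u j * ?E j x * ?E (-k) x) = (\<lambda>x. g x * ?E (-k) x)"
      unfolding g_def by (simp add: infsum_cmult_left')
    also have "(\<lambda>j. integral {0..1} (\<lambda>x. u j * ?E j x * ?E (-k) x)) = (\<lambda>j. if j = k then u k else 0)"
    proof
      fix j
      have "u j * ?E j x * ?E (-k) x = u j * exp (- 2 * of_real pi * \<i> * of_int (k - j) * of_real x)" for x
        unfolding mult.assoc exp_add[symmetric] by (simp add: algebra_simps)
      then show "integral {0..1} (\<lambda>x. u j * ?E j x * ?E (-k) x) = (if j = k then u k else 0)"
        by (simp only: integral_mult_right integral_exp_int) simp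
    qed
    finally have "((\<lambda>j. if j = k then u k else 0) has_sum integral {0..1} (\<lambda>x. g x * ?E (-k) x)) UNIV" .
    moreover have "((\<lambda>j. if j = k then u k else 0) has_sum u k) UNIV"
      by (rule has_sum_finite_neutralI[where B="{k}"]) auto
    ultimately show ?thesis by (rule has_sum_unique)
  qed
  have "bounded (g ` {0..1})"
    by (intro compact_imp_bounded compact_continuous_image gc) auto
  then obtain B where B: "\<And>x. x \<in> {0..1} \<Longrightarrow> norm (g x) \<le> B"
    unfolding bounded_iff by blast
  have hs: "((\<lambda>k. integral {0..1} (\<lambda>x. cnj (u k) * (g x * ?E (-k) x))) has_sum
       integral {0..1} (\<lambda>x. \<Sum>\<^sub>\<infinity>k. cnj (u k) * (g x * ?E (-k) x))) UNIV"
  proof (rule integral_has_sum_Weierstrass(1))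
    show "(\<lambda>k. norm (u k) * B) summable_on UNIV" by (intro summable_on_cmult_left u)
    show "norm (cnj (u k) * (g x * ?E (-k) x)) \<le> norm (u k) * B" if "x \<in> {0..1}" for k x
      using B[OF that] by (simp add: norm_mult mult_left_mono del: of_int_minus)
  qed (intro continuous_intros gc)
  have "(\<Sum>\<^sub>\<infinity>k. cnj (u k) * (g x * ?E (-k) x)) = of_real ((norm (g x))\<^sup>2)" for x
  proof -
    have "(\<Sum>\<^sub>\<infinity>k. cnj (u k) * (g x * ?E (-k) x)) = (\<Sum>\<^sub>\<infinity>k. g x * cnj (u k * ?E k x))"
      unfolding complex_cnj_mult cnjE by (simp only: mult.left_commute)
    also have "\<dots> = g x * cnj (g x)"
      by (simp only: infsum_cmult_right' infsum_cnj g_def)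
    finally show ?thesis by (simp add: complex_norm_square[symmetric])
  qed
  moreover have "cnj (u k) * u k = of_real ((norm (u k))\<^sup>2)" for k
    unfolding complex_norm_square by (rule mult.commute)
  ultimately have hs2: "((\<lambda>k. of_real ((norm (u k))\<^sup>2)) has_sum integral {0..1} (\<lambda>x. of_real ((norm (g x))\<^sup>2) :: complex)) UNIV"
    using hs by (simp only: integral_mult_right coeff)
  have nc: "(\<lambda>x. (norm (g x))\<^sup>2) integrable_on {0..1}"
    by (intro integrable_continuous_real continuous_intros gc)
  have "integral {0..1} (\<lambda>x. of_real ((norm (g x))\<^sup>2) :: complex) = of_real (integral {0..1} (\<lambda>x. (norm (g x))\<^sup>2))"
    using has_integral_of_real[OF integrable_integral[OF nc]] by (rule integral_unique)
  with hs2 have hs3: "((\<lambda>k. (norm (u k))\<^sup>2) has_sum integral {0..1} (\<lambda>x. (norm (g x))\<^sup>2)) UNIV"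
    by (simp add: has_sum_of_real_iff del: of_real_power)
  then show "((\<lambda>x. (norm (g x))\<^sup>2) has_integral (\<Sum>\<^sub>\<infinity>k. (norm (u k))\<^sup>2)) {0..1}"
    and "(\<lambda>k. (norm (u k))\<^sup>2) summable_on UNIV"
    using integrable_integral[OF nc] by (auto simp: has_sum_iff)
qed

lemma nn_integral_count_space_infsum:
  fixes f :: "'a \<Rightarrow> real"
  assumes "\<And>x. f x \<ge> 0" "f summable_on UNIV"
  shows "(\<integral>\<^sup>+k. ennreal (f k) \<partial>count_space UNIV) = ennreal (infsum f UNIV)"
proof -
  have "Infinite_Set_Sum.abs_summable_on f UNIV"
    unfolding abs_summable_equivalent[symmetric] using assms by simp
  then show ?thesis
    using nn_integral_conv_infsetsum[of f UNIV] infsetsum_infsum[of f UNIV] assms by simp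
qed

lemma nn_integral_count_space_has_sum:
  fixes f :: "'a \<Rightarrow> real"
  assumes "\<And>x. f x \<ge> 0" "(\<integral>\<^sup>+k. ennreal (f k) \<partial>count_space UNIV) = ennreal S" "S \<ge> 0"
  shows "(f has_sum S) UNIV"
proof -
  have "integrable (count_space UNIV) f"
    by (rule integrableI_nonneg) (use assms in auto)
  then have "Infinite_Set_Sum.abs_summable_on f UNIV"
    by (simp add: Infinite_Set_Sum.abs_summable_on_def)
  then have s: "f summable_on UNIV"
    unfolding abs_summable_equivalent[symmetric] using assms by simp
  have "ennreal (infsum f UNIV) = ennreal S"
    using nn_integral_count_space_infsum[OF assms(1) s] assms(2) by simp
  then have "infsum f UNIV = S"
    using assms(3) infsum_nonneg[of UNIV f] assms(1) by simp
  with s show ?thesis by (simp add: has_sum_iff)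
qed

lemma nn_integral_parseval:
  fixes u :: "int \<Rightarrow> complex"
  assumes u: "(\<lambda>k. norm (u k)) summable_on UNIV"
  shows "(\<integral>\<^sup>+x. indicator {0..<1} x * 
      ennreal ((norm (\<Sum>\<^sub>\<infinity>k. u k * exp (2 * of_real pi * \<i> * of_int k * of_real x)))\<^sup>2) \<partial>lborel)
    = (\<integral>\<^sup>+k. ennreal ((norm (u k))\<^sup>2) \<partial>count_space UNIV)"
proof -
  define g where "g x = (\<Sum>\<^sub>\<infinity>k. u k * exp (2 * of_real pi * \<i> * of_int k * of_real x))" for x :: real
  note P = parseval[OF u, folded g_def]
  define G where "G x = (if x \<in> {0..1} then (norm (g x))\<^sup>2 else 0)" for x
  have Gm: "G \<in> borel_measurable borel"
    unfolding G_def
    by (intro borel_measurable_continuous_on_if continuous_intros P(3)) auto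
  have "(G has_integral (\<Sum>\<^sub>\<infinity>k. (norm (u k))\<^sup>2)) UNIV"
    unfolding G_def has_integral_restrict_UNIV by (rule P(1))
  then have "(\<integral>\<^sup>+x. ennreal (G x) \<partial>lborel) = ennreal (\<Sum>\<^sub>\<infinity>k. (norm (u k))\<^sup>2)"
    by (rule nn_integral_has_integral_lborel[OF Gm, rotated]) (simp add: G_def)
  moreover have "(\<integral>\<^sup>+x. indicator {0..<1} x * ennreal ((norm (g x))\<^sup>2) \<partial>lborel) = (\<integral>\<^sup>+x. ennreal (G x) \<partial>lborel)"
  proof (rule nn_integral_cong_AE)
    show "AE x in lborel. indicator {0..<1} x * ennreal ((norm (g x))\<^sup>2) = ennreal (G x)"
      using AE_lborel_singleton[of "1::real"] by eventually_elim (auto simp: G_def indicator_def)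
  qed
  ultimately show ?thesis
    using nn_integral_count_space_infsum[OF _ P(2)] by (simp add: g_def)
qed

text \<open>The Fourier coefficients of a weighted element of the Fock space along horizontal lines are,
  as functions of the height, translates of such functions.\<close>

definition gauss_poly :: "complex poly \<Rightarrow> real \<Rightarrow> complex" where
  "gauss_poly Q t = poly Q (of_real t) * of_real (exp (- pi * t\<^sup>2))"

lemma continuous_on_gauss_poly [continuous_intros]: 
  "continuous_on A f \<Longrightarrow> continuous_on A (\<lambda>x. gauss_poly Q (f x))"
  unfolding gauss_poly_def by (intro continuous_intros)

lemma gauss_poly_measurable [measurable]: "gauss_poly Q \<in> borel_measurable borel"
  using continuous_on_gauss_poly[OF continuous_on_id, of UNIV] by (intro borel_measurable_continuous_onI) simp

text \<open>The weight contributes \<open>exp (- \<pi> y\<^sup>2 - 2 \<pi> \<nu> y)\<close> and the \<open>k\<close>-th exponential \<open>exp (-2 \<pi> k y)\<close>.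
  Completing the square produces a Gaussian centred at \<open>- k - \<nu>\<close> and a constant, which is absorbed
  by the polynomial.\<close>

lemma fock_space_coefficients:
  assumes F: "F \<in> fock_space \<nu> N" and N: "N \<ge> 1"
  obtains Q :: "int \<Rightarrow> complex poly" where
    "\<And>k. degree (Q k) < N"
    "\<And>y. (\<lambda>k. norm (gauss_poly (Q k) (y + of_int k + \<nu>))) summable_on UNIV"
    "\<And>x y. fock_weighted F (Complex x y) = 
       (norm (\<Sum>\<^sub>\<infinity>k. gauss_poly (Q k) (y + of_int k + \<nu>) * exp (2 * of_real pi * \<i> * of_int k * of_real x)))\<^sup>2"
proof -
  obtain a :: "nat \<Rightarrow> int \<Rightarrow> complex" where
    a: "\<And>j z. j < N \<Longrightarrow> (\<lambda>k. norm (a j k * exp (2 * of_real pi * \<i> * of_int k * z))) summable_on UNIV"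
    "\<And>z. ((\<lambda>k. (\<Sum>j<N. of_real (Im z) ^ j * a j k) * exp (2 * of_real pi * \<i> * of_int k * z)) has_sum
        F z * exp (- of_real pi / 2 * z\<^sup>2 - 2 * of_real pi * \<i> * of_real \<nu> * z)) UNIV"
    using fock_space_expansion[OF F] by blast
  define P where "P k = (\<Sum>j<N. monom (a j k) j)" for k
  define c where "c k = complex_of_real (of_int k + \<nu>)" for k
  define Q where "Q k = smult (of_real (exp (pi * (of_int k + \<nu>)\<^sup>2))) (pcompose (P k) [:- c k, 1:])" for k
  have Pp: "poly (P k) w = (\<Sum>j<N. w ^ j * a j k)" for k w
    by (simp add: P_def poly_sum poly_monom mult.commute)
  have gp: "gauss_poly (Q k) (y + of_int k + \<nu>) = 
     poly (P k) (of_real y) * of_real (exp (- pi * y\<^sup>2 - 2 * pi * y * (of_int k + \<nu>)))" for k y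
  proof -
    have 1: "of_real (y + of_int k + \<nu>) = of_real y + c k" by (simp add: c_def)
    have 2: "exp (pi * (of_int k + \<nu>)\<^sup>2) * exp (- pi * (y + of_int k + \<nu>)\<^sup>2) =
        exp (- pi * y\<^sup>2 - 2 * pi * y * (of_int k + \<nu>))"
      unfolding exp_add[symmetric] by (rule arg_cong[where f=exp]) (simp add: power2_eq_square algebra_simps)
    show ?thesis
      unfolding gauss_poly_def Q_def 1 poly_smult poly_pcompose 2[symmetric] by (simp add: of_real_mult)
  qed
  have Pe: "gauss_poly (Q k) (y + of_int k + \<nu>) * exp (2 * of_real pi * \<i> * of_int k * of_real x) =
     of_real (exp (- pi * y\<^sup>2 - 2 * pi * y * \<nu>)) * 
      ((\<Sum>j<N. of_real y ^ j * a j k) * exp (2 * of_real pi * \<i> * of_int k * Complex x y))" for k x y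
  proof -
    have "exp (2 * of_real pi * \<i> * of_int k * Complex x y) =
       exp (2 * of_real pi * \<i> * of_int k * of_real x) * of_real (exp (- 2 * pi * y * of_int k))"
      unfolding exp_of_real[symmetric] exp_add[symmetric]
      by (rule arg_cong[where f=exp]) (simp add: Complex_eq algebra_simps)
    moreover have "exp (- pi * y\<^sup>2 - 2 * pi * y * (of_int k + \<nu>)) = exp (- pi * y\<^sup>2 - 2 * pi * y * \<nu>) * exp (- 2 * pi * y * of_int k)"
      unfolding exp_add[symmetric] by (rule arg_cong[where f=exp]) (simp add: algebra_simps)
    ultimately show ?thesis by (simp add: gp Pp mult_ac)
  qed
  show thesis
  proof (rule that[of Q])
    fix k
    have "degree (P k) \<le> N - 1"
      unfolding P_def by (intro degree_sum_le) (auto intro!: order_trans[OF degree_monom_le])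
    moreover have "degree (Q k) \<le> degree (P k)"
      unfolding Q_def by (rule order_trans[OF degree_smult_le]) (simp add: degree_pcompose)
    ultimately show "degree (Q k) < N" using N by simp
  next
    fix y
    let ?s = "exp (- pi * y\<^sup>2 - 2 * pi * y * \<nu>)"
    show "(\<lambda>k. norm (gauss_poly (Q k) (y + of_int k + \<nu>))) summable_on UNIV"
    proof (rule summable_on_comparison_test)
      show "(\<lambda>k. ?s * (\<Sum>j<N. norm (of_real y ^ j :: complex) * norm (a j k * exp (2 * of_real pi * \<i> * of_int k * Complex 0 y)))) summable_on UNIV"
      proof -
        have "((\<lambda>k. \<Sum>j<N. norm (of_real y ^ j :: complex) * norm (a j k * exp (2 * of_real pi * \<i> * of_int k * Complex 0 y))) has_sum 
           (\<Sum>j<N. norm (of_real y ^ j :: complex) * (\<Sum>\<^sub>\<infinity>k. norm (a j k * exp (2 * of_real pi * \<i> * of_int k * Complex 0 y))))) UNIV"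
          by (intro has_sum_finite_sum has_sum_cmult_right has_sum_infsum a) auto
        then show ?thesis by (intro summable_on_cmult_right has_sum_imp_summable)
      qed
      fix k
      have "norm (gauss_poly (Q k) (y + of_int k + \<nu>)) = norm (gauss_poly (Q k) (y + of_int k + \<nu>) * exp (2 * of_real pi * \<i> * of_int k * of_real 0))"
        by simp
      also have "\<dots> = ?s * norm (\<Sum>j<N. of_real y ^ j * (a j k * exp (2 * of_real pi * \<i> * of_int k * Complex 0 y)))"
        unfolding Pe by (simp add: norm_mult sum_distrib_right mult.assoc)
      also have "\<dots> \<le> ?s * (\<Sum>j<N. norm (of_real y ^ j :: complex) * norm (a j k * exp (2 * of_real pi * \<i> * of_int k * Complex 0 y)))"
        by (intro mult_left_mono order_trans[OF norm_sum] sum_mono) (auto simp: norm_mult)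
      finally show "norm (gauss_poly (Q k) (y + of_int k + \<nu>)) \<le> \<dots>" .
    qed auto
  next
    fix x y
    let ?z = "Complex x y"
    define e where "e = exp (- of_real pi / 2 * ?z\<^sup>2 - 2 * of_real pi * \<i> * of_real \<nu> * ?z)"
    have "(\<Sum>\<^sub>\<infinity>k. gauss_poly (Q k) (y + of_int k + \<nu>) * exp (2 * of_real pi * \<i> * of_int k * of_real x))
       = of_real (exp (- pi * y\<^sup>2 - 2 * pi * y * \<nu>)) * (F ?z * e)"
      unfolding Pe infsum_cmult_right' e_def using infsumI[OF a(2)[of ?z]] by simp
    moreover have "(exp (- pi * y\<^sup>2 - 2 * pi * y * \<nu>))\<^sup>2 * (norm e)\<^sup>2 = exp (- pi * (norm ?z)\<^sup>2)"
      unfolding e_def norm_exp_eq_Re power2_eq_square[of "exp _"] exp_add[symmetric]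
      by (rule arg_cong[where f=exp]) (simp add: cmod_power2, simp add: power2_eq_square field_simps)
    ultimately show "fock_weighted F ?z = (norm (\<Sum>\<^sub>\<infinity>k. gauss_poly (Q k) (y + of_int k + \<nu>) * exp (2 * of_real pi * \<i> * of_int k * of_real x)))\<^sup>2"
      by (simp add: fock_weighted_def norm_mult power_mult_distrib mult_ac)
  qed
qed

definition gauss_energy :: "complex poly \<Rightarrow> ennreal" where
  "gauss_energy Q = (\<integral>\<^sup>+t. ennreal ((norm (gauss_poly Q t))\<^sup>2) \<partial>lborel)"

text \<open>Fubini on the strip, Parseval on each horizontal period, and translation invariance of the
  integral over the height.\<close>

lemma fock_norm_sq_eq_sum_energy:
  fixes Q :: "int \<Rightarrow> complex poly"
  assumes F: "F \<in> fock_space \<nu> N"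
    and Q: "\<And>y. (\<lambda>k. norm (gauss_poly (Q k) (y + of_int k + \<nu>))) summable_on UNIV"
    "\<And>x y. fock_weighted F (Complex x y) = 
       (norm (\<Sum>\<^sub>\<infinity>k. gauss_poly (Q k) (y + of_int k + \<nu>) * exp (2 * of_real pi * \<i> * of_int k * of_real x)))\<^sup>2"
  obtains e where "\<And>k. e k \<ge> 0" "\<And>k. gauss_energy (Q k) = ennreal (e k)" "(e has_sum fock_norm_sq F) UNIV"
proof -
  have int: "integrable lborel (\<lambda>z. indicator strip z * fock_weighted F z)"
    using F by (simp add: fock_space_def set_integrable_def)
  then have meas: "(\<lambda>z. indicator strip z * fock_weighted F z) \<in> borel_measurable borel"
    by (simp add: borel_measurable_integrable[of lborel, simplified])
  have nonneg: "fock_norm_sq F \<ge> 0"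
    unfolding fock_norm_sq_def set_lebesgue_integral_def
    by (rule integral_nonneg_AE) (auto simp: fock_weighted_def)
  have "ennreal (fock_norm_sq F) = (\<integral>\<^sup>+z. ennreal (indicator strip z * fock_weighted F z) \<partial>lborel)"
    unfolding fock_norm_sq_def set_lebesgue_integral_def real_scaleR_def
    by (rule nn_integral_eq_integral[symmetric, OF int]) (auto simp: fock_weighted_def)
  also have "\<dots> = (\<integral>\<^sup>+y. \<integral>\<^sup>+x. ennreal (indicator strip (Complex x y) * fock_weighted F (Complex x y)) \<partial>lborel \<partial>lborel)"
    by (rule nn_integral_complex) (use meas in measurable)
  also have "\<dots> = (\<integral>\<^sup>+y. \<integral>\<^sup>+x. indicator {0..<1} x * ennreal ((norm (\<Sum>\<^sub>\<infinity>k. gauss_poly (Q k) (y + of_int k + \<nu>) * 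
       exp (2 * of_real pi * \<i> * of_int k * of_real x)))\<^sup>2) \<partial>lborel \<partial>lborel)"
    by (intro nn_integral_cong) (auto simp: Q(2) strip_def indicator_def)
  also have "\<dots> = (\<integral>\<^sup>+y. \<integral>\<^sup>+k. ennreal ((norm (gauss_poly (Q k) (y + of_int k + \<nu>)))\<^sup>2) \<partial>count_space UNIV \<partial>lborel)"
    by (intro nn_integral_cong nn_integral_parseval Q(1))
  also have "\<dots> = (\<integral>\<^sup>+k. \<integral>\<^sup>+y. ennreal ((norm (gauss_poly (Q k) (y + of_int k + \<nu>)))\<^sup>2) \<partial>lborel \<partial>count_space UNIV)"
    by (rule nn_integral_count_space_nn_integral) auto
  also have "\<dots> = (\<integral>\<^sup>+k. gauss_energy (Q k) \<partial>count_space UNIV)"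
  proof (intro nn_integral_cong)
    fix k
    have "gauss_energy (Q k) = (\<integral>\<^sup>+t. ennreal ((norm (gauss_poly (Q k) t))\<^sup>2) \<partial>distr lborel borel ((+) (of_int k + \<nu>)))"
      by (simp add: gauss_energy_def lborel_distr_plus)
    also have "\<dots> = (\<integral>\<^sup>+y. ennreal ((norm (gauss_poly (Q k) (y + of_int k + \<nu>)))\<^sup>2) \<partial>lborel)"
      by (subst nn_integral_distr) (auto simp: add_ac)
    finally show "(\<integral>\<^sup>+y. ennreal ((norm (gauss_poly (Q k) (y + of_int k + \<nu>)))\<^sup>2) \<partial>lborel) = gauss_energy (Q k)" ..
  qed
  finally have tot: "(\<integral>\<^sup>+k. gauss_energy (Q k) \<partial>count_space UNIV) = ennreal (fock_norm_sq F)" ..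
  have fin: "gauss_energy (Q k) \<noteq> \<infinity>" for k
  proof -
    have "gauss_energy (Q k) \<le> (\<integral>\<^sup>+k. gauss_energy (Q k) \<partial>count_space UNIV)"
      by (rule nn_integral_ge_point) simp
    then show ?thesis unfolding tot by (auto simp: top_unique)
  qed
  define e where "e k = enn2real (gauss_energy (Q k))" for k
  have e: "gauss_energy (Q k) = ennreal (e k)" for k
    using fin[of k] by (simp add: e_def less_top)
  show thesis
  proof (rule that[of e])
    show "(e has_sum fock_norm_sq F) UNIV"
      by (rule nn_integral_count_space_has_sum) (use tot nonneg in \<open>auto simp: e[symmetric], simp add: e_def\<close>)
  qed (auto simp: e, simp add: e_def)
qed

section \<open>Polynomials of bounded degree against the Gaussian weight\<close>

lemma poly_exp_bound: "\<exists>C\<ge>0. \<forall>s::real. norm (poly q (of_real s :: complex)) \<le> C * exp \<bar>s\<bar>"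
proof (intro exI[of _ "\<Sum>i\<le>degree q. norm (coeff q i) * fact i"] conjI allI)
  fix s :: real
  have "norm (poly q (of_real s)) \<le> (\<Sum>i\<le>degree q. norm (coeff q i) * \<bar>s\<bar> ^ i)"
    unfolding poly_altdef by (rule order_trans[OF norm_sum]) (simp add: norm_mult norm_power)
  also have "\<dots> \<le> (\<Sum>i\<le>degree q. norm (coeff q i) * (fact i * exp \<bar>s\<bar>))"
    by (intro sum_mono mult_left_mono power_le_fact_exp) auto
  finally show "norm (poly q (of_real s)) \<le> (\<Sum>i\<le>degree q. norm (coeff q i) * fact i) * exp \<bar>s\<bar>"
    by (simp add: sum_distrib_right mult.assoc)
qed (auto intro!: sum_nonneg)

text \<open>Lagrange interpolation at \<open>0, \<dots>, N - 1\<close>; each of the \<open>N\<close> basis polynomials grows less than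
  the exponential.\<close>

lemma lagrange_growth_bound:
  obtains C where "C \<ge> 0" "\<And>p s. degree p < N \<Longrightarrow>
    norm (poly p (of_real s :: complex)) \<le> C * exp \<bar>s\<bar> * (\<Sum>j<N. norm (poly p (of_nat j)))"
proof -
  define L :: "nat \<Rightarrow> complex poly" where "L j = smult (1 / (\<Prod>i\<in>{..<N}-{j}. (of_nat j - of_nat i))) (\<Prod>i\<in>{..<N}-{j}. [:- of_nat i, 1:])" for j
  have Ld: "degree (L j :: complex poly) < N" if "j < N" for j
  proof -
    have "degree (L j :: complex poly) \<le> degree (\<Prod>i\<in>{..<N}-{j}. [:- of_nat i, 1 :: complex:])"
      unfolding L_def by (rule degree_smult_le)
    also have "\<dots> \<le> sum (degree \<circ> (\<lambda>i. [:- of_nat i, 1 :: complex:])) ({..<N}-{j})"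
      by (rule degree_prod_sum_le) simp
    also have "\<dots> = N - 1" using that by simp
    finally show ?thesis using that by simp
  qed
  have Lv: "poly (L j) (of_nat m :: complex) = (if m = j then 1 else 0)" if "m < N" "j < N" for j m
    using that by (auto simp: L_def poly_prod)
  have rep: "p = (\<Sum>j<N. smult (poly p (of_nat j)) (L j))" if p: "degree p < N" for p :: "complex poly"
  proof (rule poly_eqI_degree)
    show "poly p x = poly (\<Sum>j<N. smult (poly p (of_nat j)) (L j)) x" if "x \<in> of_nat ` {..<N}" for x
    proof -
      from that obtain m where m: "x = of_nat m" "m < N" by auto
      have "(\<Sum>j<N. poly p (of_nat j) * poly (L j) x) = (\<Sum>j<N. if j = m then poly p x else 0)"
        by (rule sum.cong) (use m Lv in auto)
      then show ?thesis using m by (simp add: poly_sum)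
    qed
    have c: "card (of_nat ` {..<N} :: complex set) = N" by (subst card_image) (auto simp: inj_on_def)
    show "card (of_nat ` {..<N} :: complex set) > degree p" using p c by simp
    have "degree (\<Sum>j<N. smult (poly p (of_nat j)) (L j)) \<le> N - 1"
      by (intro degree_sum_le order_trans[OF degree_smult_le]) (use Ld in \<open>force+\<close>)
    then show "card (of_nat ` {..<N} :: complex set) > degree (\<Sum>j<N. smult (poly p (of_nat j)) (L j))"
      using p c by simp
  qed
  obtain c where c: "\<And>j. c j \<ge> 0" "\<And>j s. norm (poly (L j) (of_real s :: complex)) \<le> c j * exp \<bar>s\<bar>"
    using poly_exp_bound[of "L _"] by metis
  show thesis
  proof (rule that[of "\<Sum>j<N. c j"])
    show "(\<Sum>j<N. c j) \<ge> 0" using c by (auto intro!: sum_nonneg)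
    fix p :: "complex poly" and s :: real assume p: "degree p < N"
    have "norm (poly p (of_real s)) = norm (\<Sum>j<N. poly p (of_nat j) * poly (L j) (of_real s))"
      by (subst rep[OF p]) (simp add: poly_sum)
    also have "\<dots> \<le> (\<Sum>j<N. norm (poly p (of_nat j)) * ((\<Sum>j<N. c j) * exp \<bar>s\<bar>))"
    proof (intro order_trans[OF norm_sum] sum_mono)
      fix j assume j: "j \<in> {..<N}"
      have "norm (poly (L j) (of_real s :: complex)) \<le> c j * exp \<bar>s\<bar>" by (rule c)
      also have "\<dots> \<le> (\<Sum>j<N. c j) * exp \<bar>s\<bar>"
        using j c by (intro mult_right_mono member_le_sum) auto
      finally show "norm (poly p (of_nat j) * poly (L j) (of_real s)) \<le> norm (poly p (of_nat j)) * ((\<Sum>j<N. c j) * exp \<bar>s\<bar>)"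
        unfolding norm_mult by (rule mult_left_mono) simp
    qed
    finally show "norm (poly p (of_real s)) \<le> (\<Sum>j<N. c j) * exp \<bar>s\<bar> * (\<Sum>j<N. norm (poly p (of_nat j)))"
      unfolding sum_distrib_right[symmetric] by (simp only: mult_ac)
  qed
qed

lemma norm_gauss_poly: "norm (gauss_poly Q t) = norm (poly Q (of_real t)) * exp (- pi * t\<^sup>2)"
  by (simp only: gauss_poly_def norm_mult norm_of_real abs_exp_cancel)

lemma norm_poly_eq_gauss_poly: "norm (poly Q (of_real t)) = norm (gauss_poly Q t) * exp (pi * t\<^sup>2)"
  by (simp add: norm_gauss_poly mult.assoc flip: exp_add)

text \<open>The nodes \<open>r, r + \<beta>, \<dots>\<close> stay in the fixed interval \<open>[0, N \<beta>]\<close>, on which the Gaussian is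
  bounded below; this makes the constant independent of the offset \<open>r\<close>. The Gaussian at \<open>t\<close>
  dominates the exponential growth of the interpolation.\<close>

lemma gauss_poly_node_bound:
  assumes b: "\<beta> > 0"
  obtains C where "C \<ge> 0" "\<And>Q r t. degree Q < N \<Longrightarrow> 0 \<le> r \<Longrightarrow> r \<le> \<beta> \<Longrightarrow>
    (norm (gauss_poly Q t))\<^sup>2 \<le> C * exp (- 2 * \<bar>t\<bar>) * (\<Sum>j<N. (norm (gauss_poly Q (r + \<beta> * real j)))\<^sup>2)"
proof -
  obtain C where C: "C \<ge> 0" "\<And>p s. degree p < N \<Longrightarrow>
    norm (poly p (of_real s :: complex)) \<le> C * exp \<bar>s\<bar> * (\<Sum>j<N. norm (poly p (of_nat j)))"
    using lagrange_growth_bound by blast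
  \<comment> \<open>\<open>M\<close> bounds the reciprocal of the Gaussian at the nodes; \<open>d\<close> serves to absorb the linear
    exponents into the Gaussian at \<open>t\<close> by completing the square.\<close>
  define M where "M = exp (pi * (\<beta> * real N)\<^sup>2)"
  define d where "d = 1 / \<beta> + 1"
  define C' where "C' = C * exp 1 * M * exp (d\<^sup>2 / (4 * pi))"
  have C': "C' \<ge> 0" using C by (simp add: C'_def M_def)
  show thesis
  proof (rule that[of "C'\<^sup>2 * real N"])
    fix Q :: "complex poly" and r t :: real
    assume Q: "degree Q < N" and r: "0 \<le> r" "r \<le> \<beta>"
    define p where "p = pcompose Q [:of_real r, of_real \<beta>:]"
    have p: "degree p < N" using Q b by (simp add: p_def degree_pcompose)
    define s where "s = (t - r) / \<beta>"
    have pv: "poly p (of_real x) = poly Q (of_real (r + \<beta> * x))" for x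
      by (simp add: p_def poly_pcompose mult.commute)
    define \<Sigma> where "\<Sigma> = (\<Sum>j<N. norm (gauss_poly Q (r + \<beta> * real j)))"
    have "\<bar>s\<bar> = \<bar>t - r\<bar> / \<beta>" using b by (simp add: s_def)
    also have "\<dots> \<le> (\<bar>t\<bar> + \<beta>) / \<beta>" using b r by (intro divide_right_mono) auto
    finally have s: "\<bar>s\<bar> \<le> \<bar>t\<bar> / \<beta> + 1" using b by (simp add: add_divide_distrib)
    have nodes: "norm (poly p (of_nat j)) \<le> M * norm (gauss_poly Q (r + \<beta> * real j))" if "j < N" for j
    proof -
      define x where "x = r + \<beta> * real j"
      have "real j \<le> real N - 1" using that by linarith
      from mult_left_mono[OF this, of \<beta>] have x: "0 \<le> x" "x \<le> \<beta> * real N"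
        using r b by (auto simp: x_def algebra_simps)
      have "norm (poly p (of_nat j)) = norm (gauss_poly Q x) * exp (pi * x\<^sup>2)"
        using pv[of "real j"] by (simp add: norm_poly_eq_gauss_poly[symmetric] x_def)
      also have "\<dots> \<le> norm (gauss_poly Q x) * M"
        unfolding M_def using x by (intro mult_left_mono) (auto intro!: power_mono)
      finally show ?thesis by (simp add: x_def mult.commute)
    qed
    have "norm (poly Q (of_real t)) = norm (poly p (of_real s))"
      unfolding pv using b by (simp add: s_def)
    also have "\<dots> \<le> C * exp \<bar>s\<bar> * (\<Sum>j<N. norm (poly p (of_nat j)))" by (rule C(2)[OF p])
    also have "\<dots> \<le> C * exp (\<bar>t\<bar> / \<beta> + 1) * (\<Sum>j<N. M * norm (gauss_poly Q (r + \<beta> * real j)))"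
      using s nodes C(1) by (intro mult_mono sum_mono) (auto intro!: sum_nonneg)
    also have "\<dots> = C * exp 1 * M * exp (\<bar>t\<bar> / \<beta>) * \<Sigma>"
      by (simp add: \<Sigma>_def sum_distrib_left[symmetric] exp_add mult_ac)
    finally have "norm (gauss_poly Q t) \<le> C * exp 1 * M * exp (\<bar>t\<bar> / \<beta>) * \<Sigma> * exp (- pi * t\<^sup>2)"
      unfolding gauss_poly_def norm_mult by (auto intro!: mult_right_mono)
    also have "\<dots> = C * exp 1 * M * \<Sigma> * exp (\<bar>t\<bar> / \<beta> - pi * t\<^sup>2)"
      by (simp add: exp_add[symmetric] exp_diff exp_minus field_simps)
    also have "\<dots> \<le> C * exp 1 * M * \<Sigma> * exp (d\<^sup>2 / (4 * pi) - \<bar>t\<bar>)"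
    proof -
      have "0 \<le> pi * (\<bar>t\<bar> - d / (2 * pi))\<^sup>2" by simp
      also have "\<dots> = pi * t\<^sup>2 - d * \<bar>t\<bar> + d\<^sup>2 / (4 * pi)"
        by (simp add: power2_eq_square field_simps flip: abs_mult)
      finally have "\<bar>t\<bar> / \<beta> - pi * t\<^sup>2 \<le> d\<^sup>2 / (4 * pi) - \<bar>t\<bar>" by (simp add: d_def field_simps)
      moreover have "0 \<le> C * exp 1 * M * \<Sigma>" using C(1) by (auto simp: M_def \<Sigma>_def intro!: mult_nonneg_nonneg sum_nonneg)
      ultimately show ?thesis by (intro mult_left_mono) auto
    qed
    also have "\<dots> = C' * exp (- \<bar>t\<bar>) * \<Sigma>" by (simp only: C'_def diff_conv_add_uminus exp_add mult_ac)
    finally have "(norm (gauss_poly Q t))\<^sup>2 \<le> (C' * exp (- \<bar>t\<bar>) * \<Sigma>)\<^sup>2" by (intro power_mono) auto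
    also have "\<dots> = C'\<^sup>2 * exp (- 2 * \<bar>t\<bar>) * \<Sigma>\<^sup>2"
      by (simp add: power_mult_distrib power2_eq_square[of "exp _"] flip: exp_add)
    also have "\<dots> \<le> C'\<^sup>2 * exp (- 2 * \<bar>t\<bar>) * (real N * (\<Sum>j<N. (norm (gauss_poly Q (r + \<beta> * real j)))\<^sup>2))"
    proof (rule mult_left_mono)
      show "\<Sigma>\<^sup>2 \<le> real N * (\<Sum>j<N. (norm (gauss_poly Q (r + \<beta> * real j)))\<^sup>2)"
      using Cauchy_Schwarz_ineq_sum[of "\<lambda>_. 1" "\<lambda>j. norm (gauss_poly Q (r + \<beta> * real j))" "{..<N}"] by (simp add: \<Sigma>_def)
    qed simp
    finally show "(norm (gauss_poly Q t))\<^sup>2 \<le> C'\<^sup>2 * real N * exp (- 2 * \<bar>t\<bar>) * (\<Sum>j<N. (norm (gauss_poly Q (r + \<beta> * real j)))\<^sup>2)"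
      by (simp only: mult_ac)
  qed simp
qed

lemma nn_integral_exp_neg_abs_finite: "(\<integral>\<^sup>+t. ennreal (exp (- 2 * \<bar>t\<bar>)) \<partial>lborel) < \<infinity>"
proof -
  define f where "f t = (if t \<in> {0..} then exp (- 2 * t) else 0)" for t :: real
  have fm [measurable]: "f \<in> borel_measurable borel"
    unfolding f_def by measurable
  have "(f has_integral exp (- 2 * 0) / 2) UNIV"
    unfolding f_def has_integral_restrict_UNIV by (rule has_integral_exp_minus_to_infinity) simp
  then have 1: "(\<integral>\<^sup>+t. ennreal (f t) \<partial>lborel) = ennreal (1/2)"
    using nn_integral_has_integral_lborel[OF fm, of "1/2"] by (simp add: f_def)
  have 2: "(\<integral>\<^sup>+t. ennreal (f (- t)) \<partial>lborel) = (\<integral>\<^sup>+t. ennreal (f t) \<partial>lborel)"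
    using nn_integral_real_affine[of "\<lambda>t. ennreal (f t)" "-1" 0] by simp
  have "(\<integral>\<^sup>+t. ennreal (exp (- 2 * \<bar>t\<bar>)) \<partial>lborel) \<le> (\<integral>\<^sup>+t. ennreal (f t) + ennreal (f (- t)) \<partial>lborel)"
    by (intro nn_integral_mono) (auto simp: f_def simp flip: ennreal_plus)
  also have "\<dots> = ennreal (1/2) + ennreal (1/2)"
    by (subst nn_integral_add) (auto simp: 1 2)
  also have "\<dots> = ennreal 1" by (subst ennreal_plus[symmetric]) auto
  also have "\<dots> < \<infinity>" by simp
  finally show ?thesis .
qed

lemma gauss_energy_le_nodes:
  assumes b: "\<beta> > 0"
  obtains C where "C \<ge> 0" "\<And>Q r. degree Q < N \<Longrightarrow> 0 \<le> r \<Longrightarrow> r \<le> \<beta> \<Longrightarrow>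
    gauss_energy Q \<le> ennreal (C * (\<Sum>j<N. (norm (gauss_poly Q (r + \<beta> * real j)))\<^sup>2))"
proof -
  obtain C where C: "C \<ge> 0" "\<And>Q r t. degree Q < N \<Longrightarrow> 0 \<le> r \<Longrightarrow> r \<le> \<beta> \<Longrightarrow>
    (norm (gauss_poly Q t))\<^sup>2 \<le> C * exp (- 2 * \<bar>t\<bar>) * (\<Sum>j<N. (norm (gauss_poly Q (r + \<beta> * real j)))\<^sup>2)"
    using gauss_poly_node_bound[OF b] by blast
  obtain J where J: "J \<ge> 0" "(\<integral>\<^sup>+t. ennreal (exp (- 2 * \<bar>t\<bar>)) \<partial>lborel) = ennreal J"
    using nn_integral_exp_neg_abs_finite by (cases "\<integral>\<^sup>+t. ennreal (exp (- 2 * \<bar>t\<bar>)) \<partial>lborel") auto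
  show thesis
  proof (rule that[of "C * J"])
    fix Q :: "complex poly" and r
    assume Q: "degree Q < N" and r: "0 \<le> r" "r \<le> \<beta>"
    define \<Sigma> where "\<Sigma> = (\<Sum>j<N. (norm (gauss_poly Q (r + \<beta> * real j)))\<^sup>2)"
    have S: "\<Sigma> \<ge> 0" unfolding \<Sigma>_def by (intro sum_nonneg) auto
    have "gauss_energy Q \<le> (\<integral>\<^sup>+t. ennreal (C * \<Sigma>) * ennreal (exp (- 2 * \<bar>t\<bar>)) \<partial>lborel)"
      unfolding gauss_energy_def
      by (intro nn_integral_mono) (use C(2)[OF Q r, folded \<Sigma>_def] C(1) S in \<open>simp add: mult_ac flip: ennreal_mult\<close>)
    also have "\<dots> = ennreal (C * \<Sigma>) * (\<integral>\<^sup>+t. ennreal (exp (- 2 * \<bar>t\<bar>)) \<partial>lborel)"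
      by (rule nn_integral_cmult) auto
    also have "\<dots> = ennreal (C * J * \<Sigma>)" unfolding J(2) using C(1) S J by (simp add: mult_ac flip: ennreal_mult)
    finally show "gauss_energy Q \<le> ennreal (C * J * (\<Sum>j<N. (norm (gauss_poly Q (r + \<beta> * real j)))\<^sup>2))"
      by (simp add: \<Sigma>_def)
  qed (use C J in simp)
qed

text \<open>Average the bound by the node values over the offset \<open>r \<in> [0, 1]\<close>; each node then
  contributes at most the energy.\<close>

lemma gauss_poly_le_energy:
  obtains C where "C \<ge> 0" "\<And>Q e t. degree Q < N \<Longrightarrow> gauss_energy Q = ennreal e \<Longrightarrow> e \<ge> 0 \<Longrightarrow>
    norm (gauss_poly Q t) \<le> C * exp (- \<bar>t\<bar>) * sqrt e"
proof -
  obtain C where C: "C \<ge> 0" "\<And>Q r t. degree Q < N \<Longrightarrow> 0 \<le> r \<Longrightarrow> r \<le> 1 \<Longrightarrow>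
    (norm (gauss_poly Q t))\<^sup>2 \<le> C * exp (- 2 * \<bar>t\<bar>) * (\<Sum>j<N. (norm (gauss_poly Q (r + 1 * real j)))\<^sup>2)"
    using gauss_poly_node_bound[of 1 N] by (metis zero_less_one)
  show thesis
  proof (rule that[of "sqrt (C * real N)"])
    fix Q :: "complex poly" and e t
    assume Q: "degree Q < N" "gauss_energy Q = ennreal e" "e \<ge> 0"
    define c where "c = C * exp (- 2 * \<bar>t\<bar>)"
    have c: "c \<ge> 0" using C by (simp add: c_def)
    have sh: "(\<integral>\<^sup>+r. ennreal ((norm (gauss_poly Q (r + real j)))\<^sup>2) \<partial>lborel) = ennreal e" for j
    proof -
      have "gauss_energy Q = (\<integral>\<^sup>+t. ennreal ((norm (gauss_poly Q t))\<^sup>2) \<partial>distr lborel borel ((+) (real j)))"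
        by (simp add: gauss_energy_def lborel_distr_plus)
      also have "\<dots> = (\<integral>\<^sup>+y. ennreal ((norm (gauss_poly Q (y + real j)))\<^sup>2) \<partial>lborel)"
        by (subst nn_integral_distr) (auto simp: add_ac)
      finally show ?thesis using Q by simp
    qed
    have "ennreal ((norm (gauss_poly Q t))\<^sup>2) = (\<integral>\<^sup>+r. ennreal ((norm (gauss_poly Q t))\<^sup>2) * indicator {0..1::real} r \<partial>lborel)"
      by (subst nn_integral_cmult_indicator) auto
    also have "\<dots> \<le> (\<integral>\<^sup>+r. ennreal c * (\<Sum>j<N. ennreal ((norm (gauss_poly Q (r + real j)))\<^sup>2)) \<partial>lborel)"
    proof (intro nn_integral_mono)
      fix r :: real
      show "ennreal ((norm (gauss_poly Q t))\<^sup>2) * indicator {0..1} r \<le> ennreal c * (\<Sum>j<N. ennreal ((norm (gauss_poly Q (r + real j)))\<^sup>2))"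
      proof (cases "r \<in> {0..1}")
        case True
        have "ennreal ((norm (gauss_poly Q t))\<^sup>2) \<le> ennreal (c * (\<Sum>j<N. (norm (gauss_poly Q (r + real j)))\<^sup>2))"
          using C(2)[OF Q(1), of r t] True by (intro ennreal_leI) (simp add: c_def)
        also have "\<dots> = ennreal c * (\<Sum>j<N. ennreal ((norm (gauss_poly Q (r + real j)))\<^sup>2))"
          using c by (simp add: ennreal_mult sum_nonneg sum_ennreal)
        finally show ?thesis using True by simp
      qed simp
    qed
    also have "\<dots> = ennreal c * (\<Sum>j<N. \<integral>\<^sup>+r. ennreal ((norm (gauss_poly Q (r + real j)))\<^sup>2) \<partial>lborel)"
    proof -
      have "(\<integral>\<^sup>+r. (\<Sum>j<N. ennreal ((norm (gauss_poly Q (r + real j)))\<^sup>2)) \<partial>lborel) =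
          (\<Sum>j<N. \<integral>\<^sup>+r. ennreal ((norm (gauss_poly Q (r + real j)))\<^sup>2) \<partial>lborel)"
        by (rule nn_integral_sum) measurable
      moreover have "(\<integral>\<^sup>+r. ennreal c * (\<Sum>j<N. ennreal ((norm (gauss_poly Q (r + real j)))\<^sup>2)) \<partial>lborel) =
          ennreal c * (\<integral>\<^sup>+r. (\<Sum>j<N. ennreal ((norm (gauss_poly Q (r + real j)))\<^sup>2)) \<partial>lborel)"
        by (rule nn_integral_cmult) measurable
      ultimately show ?thesis by (simp only:)
    qed
    also have "\<dots> = ennreal (c * (real N * e))"
      using c Q(3) by (simp add: sh ennreal_mult ennreal_of_nat_eq_real_of_nat)
    finally have "(norm (gauss_poly Q t))\<^sup>2 \<le> c * (real N * e)"
      using c Q(3) by (subst (asm) ennreal_le_iff) auto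
    also have "\<dots> = (sqrt (C * real N) * exp (- \<bar>t\<bar>) * sqrt e)\<^sup>2"
      using C(1) Q(3) by (simp add: c_def power_mult_distrib power2_eq_square[of "exp _"] mult_ac flip: exp_add)
    finally show "norm (gauss_poly Q t) \<le> sqrt (C * real N) * exp (- \<bar>t\<bar>) * sqrt e"
      by (rule power2_le_imp_le) (use C(1) Q(3) in auto)
  qed (use C in simp)
qed

section \<open>Schur test\<close>

text \<open>Cauchy-Schwarz with the weights \<open>K a b\<close> bounds the square of the inner sum by \<open>A\<close> times
  \<open>\<Sum>\<^sub>b K a b (f b)\<^sup>2\<close>; summing over finitely many \<open>a\<close> first brings in the column bound.\<close>

lemma schur_test:
  fixes K :: "'a \<Rightarrow> 'b \<Rightarrow> real" and f :: "'b \<Rightarrow> real"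
  assumes K: "\<And>a b. K a b \<ge> 0" and rows: "\<And>a. K a summable_on UNIV" "\<And>a. infsum (K a) UNIV \<le> A"
    and cols: "\<And>X b. finite X \<Longrightarrow> (\<Sum>a\<in>X. K a b) \<le> B"
    and f: "\<And>b. f b \<ge> 0" "(\<lambda>b. (f b)\<^sup>2) summable_on UNIV"
  shows "(\<lambda>b. K a b * f b) summable_on UNIV"
    and "(\<lambda>a. (\<Sum>\<^sub>\<infinity>b. K a b * f b)\<^sup>2) summable_on UNIV"
    and "(\<Sum>\<^sub>\<infinity>a. (\<Sum>\<^sub>\<infinity>b. K a b * f b)\<^sup>2) \<le> A * B * (\<Sum>\<^sub>\<infinity>b. (f b)\<^sup>2)"
proof -
  have A: "A \<ge> 0" using order_trans[OF infsum_nonneg rows(2)] K by blast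
  have KB: "K a b \<le> B" for a b using cols[of "{a}" b] by simp
  have B: "B \<ge> 0" using order_trans[OF K KB] .
  have s2: "(\<lambda>b. K a b * (f b)\<^sup>2) summable_on UNIV" for a
    by (rule summable_on_comparison_test[OF summable_on_cmult_right[OF f(2), of B]])
       (use K KB in \<open>auto intro!: mult_right_mono\<close>)
  have s1: "(\<lambda>b. K a b * f b) summable_on UNIV" for a
  proof (rule summable_on_comparison_test[OF summable_on_add[OF rows(1)[of a] s2[of a]]])
    fix b
    \<comment> \<open>The rows and the weighted squares are summable, and together they dominate the products.\<close>
    have "f b \<le> 1 + (f b)\<^sup>2" using sum_squares_bound[of "f b" 1] f(1)[of b] by simp
    from mult_left_mono[OF this K[of a b]] show "K a b * f b \<le> K a b + K a b * (f b)\<^sup>2"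
      by (simp add: distrib_left)
  qed (use K f in auto)
  then show "(\<lambda>b. K a b * f b) summable_on UNIV" .
  define T where "T a = (\<Sum>\<^sub>\<infinity>b. K a b * (f b)\<^sup>2)" for a
  have T0: "T a \<ge> 0" for a unfolding T_def by (rule infsum_nonneg) (use K in auto)
  have cs: "(\<Sum>\<^sub>\<infinity>b. K a b * f b)\<^sup>2 \<le> A * T a" for a
  proof -
    have "(\<Sum>\<^sub>\<infinity>b. K a b * f b) \<le> sqrt (A * T a)"
    proof (rule infsum_le_finite_sums[OF s1])
      fix Y :: "'b set" assume Y: "finite Y"
      have "(\<Sum>b\<in>Y. K a b * f b)\<^sup>2 = (\<Sum>b\<in>Y. sqrt (K a b) * (sqrt (K a b) * f b))\<^sup>2"
        using K by (simp flip: mult.assoc)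
      also have "\<dots> \<le> (\<Sum>b\<in>Y. (sqrt (K a b))\<^sup>2) * (\<Sum>b\<in>Y. (sqrt (K a b) * f b)\<^sup>2)"
        by (rule Cauchy_Schwarz_ineq_sum)
      also have "\<dots> = (\<Sum>b\<in>Y. K a b) * (\<Sum>b\<in>Y. K a b * (f b)\<^sup>2)"
        using K by (simp add: power_mult_distrib)
      also have "\<dots> \<le> A * T a"
      proof (rule mult_mono)
        show "(\<Sum>b\<in>Y. K a b) \<le> A"
          using order_trans[OF finite_sum_le_infsum[OF rows(1) Y] rows(2)] K by auto
        show "(\<Sum>b\<in>Y. K a b * (f b)\<^sup>2) \<le> T a"
          unfolding T_def by (rule finite_sum_le_infsum[OF s2 Y]) (use K in auto)
      qed (use A K in \<open>auto intro!: sum_nonneg\<close>)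
      finally show "(\<Sum>b\<in>Y. K a b * f b) \<le> sqrt (A * T a)" by (rule real_le_rsqrt)
    qed
    moreover have "(\<Sum>\<^sub>\<infinity>b. K a b * f b) \<ge> 0" by (rule infsum_nonneg) (use K f in auto)
    ultimately have "(\<Sum>\<^sub>\<infinity>b. K a b * f b)\<^sup>2 \<le> (sqrt (A * T a))\<^sup>2" by (rule power_mono)
    also have "\<dots> = A * T a" using A T0[of a] by simp
    finally show ?thesis .
  qed
  have fin: "(\<Sum>a\<in>X. (\<Sum>\<^sub>\<infinity>b. K a b * f b)\<^sup>2) \<le> A * B * (\<Sum>\<^sub>\<infinity>b. (f b)\<^sup>2)" if X: "finite X" for X
  proof -
    have hs: "((\<lambda>b. \<Sum>a\<in>X. K a b * (f b)\<^sup>2) has_sum (\<Sum>a\<in>X. T a)) UNIV"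
      unfolding T_def by (intro has_sum_finite_sum has_sum_infsum s2)
    have hB: "((\<lambda>b. B * (f b)\<^sup>2) has_sum B * (\<Sum>\<^sub>\<infinity>b. (f b)\<^sup>2)) UNIV"
      by (intro has_sum_cmult_right has_sum_infsum f)
    have "(\<Sum>a\<in>X. (\<Sum>\<^sub>\<infinity>b. K a b * f b)\<^sup>2) \<le> A * (\<Sum>a\<in>X. T a)"
      unfolding sum_distrib_left by (rule sum_mono) (rule cs)
    also have "(\<Sum>a\<in>X. T a) \<le> B * (\<Sum>\<^sub>\<infinity>b. (f b)\<^sup>2)"
      by (rule has_sum_mono[OF hs hB]) (use cols[OF X] in \<open>auto simp: sum_distrib_right[symmetric] intro!: mult_right_mono\<close>)
    finally show ?thesis using A by (simp add: mult.assoc mult_left_mono)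
  qed
  show sum: "(\<lambda>a. (\<Sum>\<^sub>\<infinity>b. K a b * f b)\<^sup>2) summable_on UNIV"
    by (rule nonneg_bdd_above_summable_on) (use fin in \<open>auto intro!: bdd_aboveI\<close>)
  show "(\<Sum>\<^sub>\<infinity>a. (\<Sum>\<^sub>\<infinity>b. K a b * f b)\<^sup>2) \<le> A * B * (\<Sum>\<^sub>\<infinity>b. (f b)\<^sup>2)"
    by (rule infsum_le_finite_sums[OF sum]) (rule fin)
qed

text \<open>After a shift of \<open>n\<close> by the integer part of \<open>- y / b\<close> the offset lies in \<open>[-b, b]\<close>, which
  makes the bound uniform in \<open>y\<close>.\<close>

lemma exp_neg_abs_affine_sum_bounded:
  fixes b :: real
  assumes b: "b > 0"
  shows "\<exists>A. \<forall>y. (\<lambda>n::int. exp (- \<bar>b * of_int n + y\<bar>)) summable_on UNIV \<and>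
    (\<Sum>\<^sub>\<infinity>n::int. exp (- \<bar>b * of_int n + y\<bar>)) \<le> A"
proof -
  define J where "J = (\<Sum>\<^sub>\<infinity>n::int. exp (- b * \<bar>of_int n\<bar>))"
  have J: "((\<lambda>n::int. exp b * exp (- b * \<bar>of_int n\<bar>)) has_sum exp b * J) UNIV"
    unfolding J_def by (intro has_sum_cmult_right has_sum_infsum exp_neg_abs_int_summable b)
  have *: "(\<lambda>n::int. exp (- \<bar>b * of_int n + y\<bar>)) summable_on UNIV \<and>
      (\<Sum>\<^sub>\<infinity>n::int. exp (- \<bar>b * of_int n + y\<bar>)) \<le> exp b * J" for y
  proof -
    define c where "c = \<lfloor>- y / b\<rfloor>"
    define \<rho> where "\<rho> = b * of_int c + y"
    have "of_int c \<le> - y / b" "- y / b < of_int c + 1" unfolding c_def by linarith+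
    then have \<rho>: "\<bar>\<rho>\<bar> \<le> b" using b by (simp add: \<rho>_def field_simps abs_if)
    define e where "e n = exp (- \<bar>b * of_int n + \<rho>\<bar>)" for n :: int
    have le: "e n \<le> exp b * exp (- b * \<bar>of_int n\<bar>)" for n
    proof -
      have "b * \<bar>of_int n\<bar> = \<bar>b * of_int n\<bar>" using b by (simp add: abs_mult)
      then have "- \<bar>b * of_int n + \<rho>\<bar> \<le> b + - b * \<bar>of_int n\<bar>" using \<rho> by simp
      then show ?thesis unfolding e_def by (simp flip: exp_add)
    qed
    have es: "e summable_on UNIV"
      by (rule summable_on_comparison_test[OF has_sum_imp_summable[OF J]]) (use le in \<open>auto simp: e_def\<close>)
    have ei: "infsum e UNIV \<le> exp b * J"
      by (rule has_sum_mono[OF has_sum_infsum[OF es] J]) (use le in auto)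
    have "((\<lambda>n::int. exp (- \<bar>b * of_int n + y\<bar>)) has_sum infsum e UNIV) UNIV"
      by (subst has_sum_reindex_bij_witness[where i="\<lambda>m. m + c" and j="\<lambda>n. n - c" and T=UNIV and h=e])
         (use es in \<open>auto simp: e_def \<rho>_def algebra_simps\<close>)
    then show ?thesis using ei by (simp add: has_sum_iff)
  qed
  then show ?thesis by blast
qed

section \<open>Recovery of a coefficient from the samples\<close>

lemma kernel_poly_has_sum:
  fixes p :: "complex poly"
  assumes \<kappa>: "gauss_decay \<alpha> \<kappa>" "\<alpha> > 0" and p: "degree p < N"
  shows "((\<lambda>m. of_real (\<kappa> m) * poly p (of_int m) * of_real (exp (s * of_int m))) has_sum
      (\<Sum>i<N. coeff p i * of_real (moment \<kappa> s i))) UNIV"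
proof -
  have "((\<lambda>m. \<Sum>i<N. coeff p i * of_real (\<kappa> m * of_int m ^ i * exp (s * of_int m))) has_sum
      (\<Sum>i<N. coeff p i * of_real (moment \<kappa> s i))) UNIV"
    by (intro has_sum_finite_sum has_sum_cmult_right has_sum_of_real moment_has_sum[OF \<kappa>(2,1)])
  moreover have "(\<Sum>i<N. coeff p i * of_real (\<kappa> m * of_int m ^ i * exp (s * of_int m))) =
      of_real (\<kappa> m) * poly p (of_int m) * of_real (exp (s * of_int m))" for m
  proof -
    have "poly p (of_int m) = (\<Sum>i<N. coeff p i * of_int m ^ i)"
      unfolding poly_altdef by (rule sum.mono_neutral_left) (use p in \<open>auto simp: not_le coeff_eq_0\<close>)
    then show ?thesis by (simp add: sum_distrib_left sum_distrib_right mult_ac)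
  qed
  ultimately show ?thesis by simp
qed

text \<open>Put \<open>r = \<beta> n + k + \<nu>\<close>. In \<open>S (n + m)\<close> the coefficient with index \<open>k + l\<close> enters at the point
  \<open>\<beta> m + r + l\<close>. Multiplication by \<open>exp (\<pi> (\<beta> m + r)\<^sup>2)\<close> turns its Gaussian into a constant times
  \<open>exp (-2 \<pi> \<beta> l m)\<close>, and what remains is a polynomial in \<open>m\<close> of degree below \<open>N\<close>. Summation
  against \<open>\<kappa>\<close> therefore annihilates all contributions with \<open>l \<noteq> 0\<close> and returns the value at
  \<open>m = 0\<close> of the one with \<open>l = 0\<close>. The weights \<open>W\<close> dominate \<open>\<kappa>\<close> times the growing Gaussian and
  justify the exchange of sums.\<close>

lemma kernel_recovers_value:
  fixes Q :: "int \<Rightarrow> complex poly"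
  assumes b: "\<beta> > 0" and \<kappa>: "gauss_decay \<alpha> \<kappa>" "\<alpha> > 0"
     "\<And>l i. l \<noteq> 0 \<Longrightarrow> i < N \<Longrightarrow> moment \<kappa> (- 2 * pi * \<beta> * of_int l) i = 0" 
     "\<And>i. i < N \<Longrightarrow> moment \<kappa> 0 i = 0 ^ i"
   and W: "\<And>m r. \<bar>r\<bar> \<le> R \<Longrightarrow> \<bar>\<kappa> m\<bar> * exp (pi * (\<beta> * of_int m + r)\<^sup>2) \<le> W m" "W summable_on UNIV"
   and Q: "\<And>k. degree (Q k) < N" "\<And>y. (\<lambda>k. norm (gauss_poly (Q k) (y + of_int k + \<nu>))) summable_on UNIV"
     "\<And>y. (\<Sum>\<^sub>\<infinity>k. norm (gauss_poly (Q k) (y + of_int k + \<nu>))) \<le> G"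
   and r: "\<bar>\<beta> * of_int n + of_int k + \<nu>\<bar> \<le> R"
 defines "S \<equiv> \<lambda>n::int. \<Sum>\<^sub>\<infinity>k. gauss_poly (Q k) (\<beta> * of_int n + of_int k + \<nu>)"
 shows "norm (gauss_poly (Q k) (\<beta> * of_int n + of_int k + \<nu>)) \<le> (\<Sum>\<^sub>\<infinity>m. W m * norm (S (n + m)))"
proof -
  define r where "r = \<beta> * of_int n + of_int k + \<nu>"
  have r: "\<bar>r\<bar> \<le> R" using r by (simp add: r_def)
  have W0: "W m \<ge> 0" for m by (rule order_trans[OF _ W(1)[OF r, of m]]) simp
  have G: "G \<ge> 0" by (rule order_trans[OF infsum_nonneg Q(3)]) auto
  define y where "y m = \<beta> * of_int (n + m)" for m :: int
  define g where "g m l = gauss_poly (Q (k + l)) (y m + of_int (k + l) + \<nu>)" for m l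
  define c where "c m = complex_of_real (\<kappa> m * exp (pi * (\<beta> * of_int m + r)\<^sup>2))" for m
  have cW: "norm (c m) \<le> W m" for m using W(1)[OF r, of m] unfolding c_def norm_of_real by (simp add: abs_mult)
  have gn: "((\<lambda>l. norm (g m l)) has_sum (\<Sum>\<^sub>\<infinity>k. norm (gauss_poly (Q k) (y m + of_int k + \<nu>)))) UNIV" for m
    unfolding g_def
    by (subst has_sum_reindex_bij_witness[where i="\<lambda>j. j - k" and j="\<lambda>l. k + l" and T=UNIV and 
          h="\<lambda>k. norm (gauss_poly (Q k) (y m + of_int k + \<nu>))"]) (use Q(2) in auto)
  have gs: "(\<Sum>\<^sub>\<infinity>l. g m l) = S (n + m)" for m
    unfolding g_def S_def y_def
    by (rule infsum_reindex_bij_witness[where i="\<lambda>j. j - k" and j="\<lambda>l. k + l"]) auto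
  have Sle: "norm (S (n + m)) \<le> G" for m
    unfolding gs[symmetric]
    using norm_infsum_bound[of "g m" UNIV] gn[of m] Q(3)[of "y m"] by (force simp: has_sum_iff)
  have "(\<lambda>x. norm (case x of (m,l) \<Rightarrow> c m * g m l)) summable_on (UNIV \<times> UNIV)"
  proof (rule summable_on_comparison_test)
    show "(\<lambda>(m,l). W m * norm (g m l)) summable_on (UNIV \<times> UNIV)"
    proof (rule summable_on_SigmaI)
      show "((\<lambda>l. case (m, l) of (m, l) \<Rightarrow> W m * norm (g m l)) has_sum
          W m * (\<Sum>\<^sub>\<infinity>k. norm (gauss_poly (Q k) (y m + of_int k + \<nu>)))) UNIV" for m
        unfolding prod.case by (intro has_sum_cmult_right gn)
      show "(\<lambda>m. W m * (\<Sum>\<^sub>\<infinity>k. norm (gauss_poly (Q k) (y m + of_int k + \<nu>)))) summable_on UNIV"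
        by (rule summable_on_comparison_test[OF summable_on_cmult_left[OF W(2), of G]])
           (use Q(3) W0 in \<open>auto intro!: mult_left_mono mult_nonneg_nonneg infsum_nonneg\<close>)
    qed (use W0 in auto)
    show "norm (case x of (m,l) \<Rightarrow> c m * g m l) \<le> (case x of (m,l) \<Rightarrow> W m * norm (g m l))" for x
      by (cases x) (auto simp: norm_mult intro!: mult_right_mono cW)
  qed auto
  then have fs: "(\<lambda>(m,l). c m * g m l) summable_on (UNIV \<times> UNIV)"
    by (rule abs_summable_summable)
  have col: "(\<Sum>\<^sub>\<infinity>m. c m * g m l) = (if l = 0 then poly (Q k) (of_real r) else 0)" for l
  proof -
    define s where "s = - 2 * pi * \<beta> * of_int l"
    define p where "p = pcompose (Q (k + l)) [:of_real (r + of_int l), of_real \<beta>:]"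
    define d where "d = exp (- 2 * pi * of_int l * r - pi * (of_int l)\<^sup>2)"
    have p: "degree p < N" using Q(1)[of "k+l"] b by (simp add: p_def degree_pcompose)
    have "c m * g m l = of_real d * (of_real (\<kappa> m) * poly p (of_int m) * of_real (exp (s * of_int m)))" for m
    proof -
      have t: "y m + of_int (k + l) + \<nu> = \<beta> * of_int m + r + of_int l"
        by (simp add: y_def r_def algebra_simps)
      have e: "exp (pi * (\<beta> * of_int m + r)\<^sup>2) * exp (- pi * (\<beta> * of_int m + r + of_int l)\<^sup>2) = d * exp (s * of_int m)"
        unfolding d_def s_def exp_add[symmetric] by (rule arg_cong[where f=exp]) (simp add: power2_eq_square algebra_simps)
      have pp: "poly p (of_int m) = poly (Q (k + l)) (of_real (\<beta> * of_int m + r + of_int l))"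
        by (simp add: p_def poly_pcompose algebra_simps)
      have "c m * g m l = of_real (\<kappa> m) * poly p (of_int m) *
          of_real (exp (pi * (\<beta> * of_int m + r)\<^sup>2) * exp (- pi * (\<beta> * of_int m + r + of_int l)\<^sup>2))"
        unfolding c_def g_def gauss_poly_def t pp of_real_mult by (simp only: mult_ac)
      then show ?thesis unfolding e of_real_mult by (simp only: mult_ac)
    qed
    then have "(\<Sum>\<^sub>\<infinity>m. c m * g m l) = of_real d * (\<Sum>i<N. coeff p i * of_real (moment \<kappa> s i))"
      using infsumI[OF kernel_poly_has_sum[OF \<kappa>(1,2) p, of s]] by (simp only: infsum_cmult_right')
    also have "\<dots> = (if l = 0 then poly (Q k) (of_real r) else 0)"
    proof (cases "l = 0")
      case True
      have "(\<Sum>i<N. coeff p i * of_real (moment \<kappa> 0 i)) = (\<Sum>i<N. if i = 0 then coeff p 0 else 0)"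
        by (rule sum.cong) (auto simp: \<kappa>(4) power_0_left)
      also have "\<dots> = coeff p 0" using p by simp
      also have "\<dots> = poly (Q k) (of_real r)"
        by (simp add: p_def True poly_pcompose flip: poly_0_coeff_0)
      finally show ?thesis using True by (simp add: s_def d_def)
    next
      case False
      then have "(\<Sum>i<N. coeff p i * of_real (moment \<kappa> s i)) = 0"
        unfolding s_def by (intro sum.neutral ballI) (use \<kappa>(3)[OF False] in simp)
      then show ?thesis using False by simp
    qed
    finally show ?thesis .
  qed
  have "(\<Sum>\<^sub>\<infinity>m. c m * S (n + m)) = (\<Sum>\<^sub>\<infinity>m. \<Sum>\<^sub>\<infinity>l. c m * g m l)"
    by (simp add: infsum_cmult_right' gs)
  also have "\<dots> = (\<Sum>\<^sub>\<infinity>l. \<Sum>\<^sub>\<infinity>m. c m * g m l)" by (rule infsum_swap_banach[OF fs])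
  also have "\<dots> = (\<Sum>\<^sub>\<infinity>l::int. if l = 0 then poly (Q k) (of_real r) else 0)" by (simp only: col)
  also have "\<dots> = poly (Q k) (of_real r)"
    by (rule infsumI, rule has_sum_finite_neutralI[where B="{0}"]) auto
  finally have rec: "poly (Q k) (of_real r) = (\<Sum>\<^sub>\<infinity>m. c m * S (n + m))" ..
  have WS: "(\<lambda>m. W m * norm (S (n + m))) summable_on UNIV"
    by (rule summable_on_comparison_test[OF summable_on_cmult_left[OF W(2), of G]])
       (use Sle W0 in \<open>auto intro!: mult_left_mono\<close>)
  have le: "norm (c m * S (n + m)) \<le> W m * norm (S (n + m))" for m
    unfolding norm_mult by (intro mult_right_mono cW) auto
  have cs: "(\<lambda>m. norm (c m * S (n + m))) summable_on UNIV"
    by (rule summable_on_comparison_test[OF WS]) (use le in auto)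
  have "norm (gauss_poly (Q k) r) \<le> norm (poly (Q k) (of_real r))"
    unfolding norm_gauss_poly by (intro mult_left_le) auto
  also have "\<dots> \<le> (\<Sum>\<^sub>\<infinity>m. norm (c m * S (n + m)))"
    unfolding rec by (rule norm_infsum_bound) (use cs in simp)
  also have "\<dots> \<le> (\<Sum>\<^sub>\<infinity>m. W m * norm (S (n + m)))"
    by (intro infsum_mono cs WS le)
  finally show ?thesis by (simp add: r_def)
qed

text \<open>This is where the density condition enters: for \<open>\<alpha> = \<pi> \<beta> / N\<close> the decay of the kernel beats
  the growing Gaussian exactly when \<open>\<beta> < 1 / N\<close>.\<close>

lemma kernel_weight_summable:
  assumes k: "gauss_decay \<alpha> \<kappa>" and b: "\<beta> > 0" "pi * \<beta>\<^sup>2 < \<alpha>"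
  obtains W where "\<And>m r. \<bar>r\<bar> \<le> R \<Longrightarrow> \<bar>\<kappa> m\<bar> * exp (pi * (\<beta> * of_int m + r)\<^sup>2) \<le> W m" "W summable_on UNIV"
proof -
  obtain C D where CD: "C \<ge> 0" "D \<ge> 0"
    "\<And>n. \<bar>\<kappa> n\<bar> \<le> C * exp (D * \<bar>of_int n\<bar> - \<alpha> * (of_int n)\<^sup>2)"
    using gauss_decayD[OF k] by blast
  define W where "W m = C * exp (pi * R\<^sup>2) * exp ((D + 2 * pi * \<beta> * R) * \<bar>of_int m\<bar> - (\<alpha> - pi * \<beta>\<^sup>2) * (of_int m)\<^sup>2)" for m :: int
  have le: "\<bar>\<kappa> m\<bar> * exp (pi * (\<beta> * of_int m + r)\<^sup>2) \<le> W m" if r: "\<bar>r\<bar> \<le> R" for m r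
  proof -
    have "\<bar>\<beta> * of_int m + r\<bar> \<le> \<beta> * \<bar>of_int m\<bar> + R"
      using r b abs_triangle_ineq[of "\<beta> * of_int m" r] by (simp add: abs_mult)
    then have "(\<beta> * of_int m + r)\<^sup>2 \<le> (\<beta> * \<bar>of_int m\<bar> + R)\<^sup>2"
      using power_mono[of "\<bar>\<beta> * of_int m + r\<bar>" _ 2] by simp
    also have "\<dots> = \<beta>\<^sup>2 * (of_int m)\<^sup>2 + 2 * \<beta> * R * \<bar>of_int m\<bar> + R\<^sup>2"
      by (simp add: power2_sum power_mult_distrib)
    finally have "pi * (\<beta> * of_int m + r)\<^sup>2 \<le> pi * (\<beta>\<^sup>2 * (of_int m)\<^sup>2 + 2 * \<beta> * R * \<bar>of_int m\<bar> + R\<^sup>2)"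
      by (rule mult_left_mono) simp
    then have "exp (pi * (\<beta> * of_int m + r)\<^sup>2) \<le> exp (pi * (\<beta>\<^sup>2 * (of_int m)\<^sup>2 + 2 * \<beta> * R * \<bar>of_int m\<bar> + R\<^sup>2))" by simp
    then have "\<bar>\<kappa> m\<bar> * exp (pi * (\<beta> * of_int m + r)\<^sup>2) \<le> (C * exp (D * \<bar>of_int m\<bar> - \<alpha> * (of_int m)\<^sup>2)) * exp (pi * (\<beta>\<^sup>2 * (of_int m)\<^sup>2 + 2 * \<beta> * R * \<bar>of_int m\<bar> + R\<^sup>2))"
      by (intro mult_mono CD) (use CD in auto)
    also have "\<dots> = W m"
      unfolding W_def mult.assoc exp_add[symmetric] by (simp add: algebra_simps)
    finally show ?thesis .
  qed
  have "W summable_on UNIV"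
    unfolding W_def using b by (intro summable_on_cmult_right gauss_summable) auto
  with le show thesis by (rule that)
qed

section \<open>The sampling inequality\<close>

theorem corollary5:
  fixes \<nu> \<beta> :: real and N :: nat
  assumes "N \<ge> 1" and "\<beta> > 0" and "\<beta> < 1 / real N"
  shows "sampling \<nu> N (range (\<lambda>k::int. \<i> * of_real \<beta> * of_int k))"
proof -
  note N = assms(1) and b = assms(2)
  have bN: "\<beta> * real N < 1" using assms by (simp add: field_simps)
  have b1: "\<beta> < 1"
  proof -
    have "1 \<le> real N" using N by simp
    from mult_left_mono[OF this less_imp_le[OF b]] show ?thesis using bN by linarith
  qed
  define \<alpha> where "\<alpha> = pi * \<beta> / real N"
  have \<alpha>: "\<alpha> > 0" "pi * \<beta>\<^sup>2 < \<alpha>"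
    using b N mult_strict_left_mono[OF assms(3), of "pi * \<beta>"]
    by (simp_all add: \<alpha>_def power2_eq_square mult.assoc)
  obtain \<kappa> where \<kappa>: "gauss_decay \<alpha> \<kappa>"
     "\<And>l i. l \<noteq> 0 \<Longrightarrow> i < N \<Longrightarrow> moment \<kappa> (- 2 * pi * \<beta> * of_int l) i = 0" 
     "\<And>i. i < N \<Longrightarrow> moment \<kappa> 0 i = 0 ^ i"
    unfolding \<alpha>_def using ex_prescribed_moments_kernel[OF b N] by blast
  obtain W where W: "\<And>m r. \<bar>r\<bar> \<le> \<beta> * real N \<Longrightarrow> \<bar>\<kappa> m\<bar> * exp (pi * (\<beta> * of_int m + r)\<^sup>2) \<le> W m" "W summable_on UNIV"
    using kernel_weight_summable[OF \<kappa>(1) b \<alpha>(2)] by blast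
  have W0: "W m \<ge> 0" for m using order_trans[OF _ W(1)[of 0 m]] b by simp
  define \<omega> where "\<omega> = infsum W UNIV"
  have \<omega>: "\<omega> \<ge> 0" unfolding \<omega>_def by (rule infsum_nonneg) (use W0 in auto)
  obtain C1 where C1: "C1 \<ge> 0" "\<And>Q r. degree Q < N \<Longrightarrow> 0 \<le> r \<Longrightarrow> r \<le> \<beta> \<Longrightarrow>
    gauss_energy Q \<le> ennreal (C1 * (\<Sum>j<N. (norm (gauss_poly Q (r + \<beta> * real j)))\<^sup>2))"
    using gauss_energy_le_nodes[OF b] by blast
  obtain C2 where C2: "C2 \<ge> 0" "\<And>Q e t. degree Q < N \<Longrightarrow> gauss_energy Q = ennreal e \<Longrightarrow> e \<ge> 0 \<Longrightarrow>
    norm (gauss_poly Q t) \<le> C2 * exp (- \<bar>t\<bar>) * sqrt e"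
    using gauss_poly_le_energy by blast
  obtain A1 where A1': "\<forall>y::real. (\<lambda>k::int. exp (- \<bar>1 * of_int k + y\<bar>)) summable_on UNIV \<and>
      (\<Sum>\<^sub>\<infinity>k::int. exp (- \<bar>1 * of_int k + y\<bar>)) \<le> A1"
    using exp_neg_abs_affine_sum_bounded[OF zero_less_one] ..
  note A1 = A1'[rule_format, THEN conjunct1] A1'[rule_format, THEN conjunct2]
  obtain A2 where A2': "\<forall>y. (\<lambda>n::int. exp (- \<bar>\<beta> * of_int n + y\<bar>)) summable_on UNIV \<and>
      (\<Sum>\<^sub>\<infinity>n::int. exp (- \<bar>\<beta> * of_int n + y\<bar>)) \<le> A2"
    using exp_neg_abs_affine_sum_bounded[OF b] ..
  note A2 = A2'[rule_format, THEN conjunct1] A2'[rule_format, THEN conjunct2]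
  have A12: "A1 \<ge> 0" "A2 \<ge> 0"
    by (rule order_trans[OF infsum_nonneg A1(2)[of 0]], simp) (rule order_trans[OF infsum_nonneg A2(2)[of 0]], simp)
  \<comment> \<open>The unique sample index \<open>n\<close> with \<open>\<beta> n + k + \<nu>\<close> in \<open>[0, \<beta>)\<close>. For \<open>\<beta> < 1\<close> different
    coefficients get different indices, so no sample is used too often.\<close>
  define node :: "int \<Rightarrow> int" where "node k = - \<lfloor>(of_int k + \<nu>) / \<beta>\<rfloor>" for k
  have node_inj: "inj node"
  proof (rule injI)
    have strict: "node k' < node k" if "k < k'" for k k'
    proof -
      have "of_int k + 1 \<le> (of_int k' :: real)" using that by linarith
      then have "(of_int k + \<nu> + \<beta>) / \<beta> \<le> (of_int k' + \<nu>) / \<beta>"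
        using b b1 by (intro divide_right_mono) auto
      then have "(of_int k + \<nu>) / \<beta> + 1 \<le> (of_int k' + \<nu>) / \<beta>"
        using b by (simp add: add_divide_distrib)
      then have "\<lfloor>(of_int k + \<nu>) / \<beta> + 1\<rfloor> \<le> \<lfloor>(of_int k' + \<nu>) / \<beta>\<rfloor>" by (rule floor_mono)
      then show ?thesis by (simp add: node_def)
    qed
    show "k = k'" if "node k = node k'" for k k'
      using strict[of k k'] strict[of k' k] that by (cases k k' rule: linorder_cases) auto
  qed
  have node: "0 \<le> \<beta> * of_int (node k) + of_int k + \<nu>" "\<beta> * of_int (node k) + of_int k + \<nu> \<le> \<beta>" for k
  proof -
    define q where "q = \<lfloor>(of_int k + \<nu>) / \<beta>\<rfloor>"
    have "of_int q \<le> (of_int k + \<nu>) / \<beta>" "(of_int k + \<nu>) / \<beta> \<le> of_int q + 1"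
      unfolding q_def by linarith+
    then show "0 \<le> \<beta> * of_int (node k) + of_int k + \<nu>" "\<beta> * of_int (node k) + of_int k + \<nu> \<le> \<beta>"
      unfolding node_def q_def[symmetric] using b by (auto simp: field_simps)
  qed
  define X where "X = C1 * real N * \<omega>\<^sup>2"
  define Y where "Y = C2\<^sup>2 * A1 * A2"
  have XY: "X \<ge> 0" "Y \<ge> 0" using C1 A12 by (auto simp: X_def Y_def)
  define Z where "Z = (\<lambda>k::int. \<i> * of_real \<beta> * of_int k)"
  have main: "fock_weighted F summable_on range Z \<and> fock_norm_sq F \<le> X * infsum (fock_weighted F) (range Z) \<and>
      infsum (fock_weighted F) (range Z) \<le> Y * fock_norm_sq F \<and> 0 \<le> infsum (fock_weighted F) (range Z) \<and> 0 \<le> fock_norm_sq F"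
    if F: "F \<in> fock_space \<nu> N" for F
  proof -
    obtain Q :: "int \<Rightarrow> complex poly" where Q:
      "\<And>k. degree (Q k) < N"
      "\<And>y. (\<lambda>k. norm (gauss_poly (Q k) (y + of_int k + \<nu>))) summable_on UNIV"
      "\<And>x y. fock_weighted F (Complex x y) = 
        (norm (\<Sum>\<^sub>\<infinity>k. gauss_poly (Q k) (y + of_int k + \<nu>) * exp (2 * of_real pi * \<i> * of_int k * of_real x)))\<^sup>2"
      using fock_space_coefficients[OF F N] by blast
    obtain e where e: "\<And>k. e k \<ge> 0" "\<And>k. gauss_energy (Q k) = ennreal (e k)" "(e has_sum fock_norm_sq F) UNIV"
      using fock_norm_sq_eq_sum_energy[OF F Q(2,3)] by blast
    define E where "E = fock_norm_sq F"
    have E: "(e has_sum E) UNIV" using e(3) by (simp add: E_def)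
    have E0: "E \<ge> 0" by (rule has_sum_nonneg[OF E]) (use e in auto)
    have eE: "e k \<le> E" for k
      using finite_sum_le_has_sum[OF E, of "{k}"] e by simp
    have gb: "norm (gauss_poly (Q k) t) \<le> C2 * exp (- \<bar>t\<bar>) * sqrt (e k)" for k t
      by (rule C2(2)[OF Q(1) e(2,1)])
    define S where "S n = (\<Sum>\<^sub>\<infinity>k. gauss_poly (Q k) (\<beta> * of_int n + of_int k + \<nu>))" for n :: int
    have FS: "fock_weighted F (Z n) = (norm (S n))\<^sup>2" for n
    proof -
      have "Z n = Complex 0 (\<beta> * of_int n)" by (simp add: Z_def complex_eq_iff)
      then show ?thesis by (simp add: Q(3) S_def)
    qed
    have Ss: "(\<lambda>k. norm (gauss_poly (Q k) (\<beta> * of_int n + of_int k + \<nu>))) summable_on UNIV" for n :: int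
      by (rule Q(2))
    \<comment> \<open>The matrix bounding the samples by the square roots of the energies.\<close>
    define K where "K n k = exp (- \<bar>\<beta> * of_int n + of_int k + \<nu>\<bar>)" for n k :: int
    note sch = schur_test[of K A1 A2 "\<lambda>k. sqrt (e k)"]
    have K1: "K n summable_on UNIV" "infsum (K n) UNIV \<le> A1" for n
      using A1[of "\<beta> * of_int n + \<nu>"] by (simp_all add: K_def[abs_def] add_ac)
    have K2: "(\<Sum>n\<in>T. K n k) \<le> A2" if "finite T" for T k
    proof -
      have "(\<Sum>n\<in>T. exp (- \<bar>\<beta> * of_int n + (of_int k + \<nu>)\<bar>)) \<le> A2"
        by (rule order_trans[OF finite_sum_le_infsum[OF A2(1) that] A2(2)]) auto
      then show ?thesis by (simp add: K_def add_ac)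
    qed
    have se: "(\<lambda>k. (sqrt (e k))\<^sup>2) = e" using e(1) by simp
    have es: "e summable_on UNIV" "infsum e UNIV = E" using E by (auto simp: has_sum_iff)
    have upper: "(\<lambda>k. K n k * sqrt (e k)) summable_on UNIV"
       "(\<lambda>n. (\<Sum>\<^sub>\<infinity>k. K n k * sqrt (e k))\<^sup>2) summable_on UNIV"
       "(\<Sum>\<^sub>\<infinity>n. (\<Sum>\<^sub>\<infinity>k. K n k * sqrt (e k))\<^sup>2) \<le> A1 * A2 * E" for n
      using sch[OF _ K1 K2] es e(1) by (simp_all add: se K_def)
    have Sle: "norm (S n) \<le> C2 * (\<Sum>\<^sub>\<infinity>k. K n k * sqrt (e k))" for n
    proof -
      have "norm (S n) \<le> (\<Sum>\<^sub>\<infinity>k. norm (gauss_poly (Q k) (\<beta> * of_int n + of_int k + \<nu>)))"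
        unfolding S_def by (rule norm_infsum_bound) (use Ss in simp)
      also have "\<dots> \<le> (\<Sum>\<^sub>\<infinity>k. C2 * (K n k * sqrt (e k)))"
        by (intro infsum_mono Ss summable_on_cmult_right upper) (use gb in \<open>simp add: K_def mult.assoc\<close>)
      finally show ?thesis by (simp add: infsum_cmult_right')
    qed
    have Sle2: "(norm (S n))\<^sup>2 \<le> C2\<^sup>2 * (\<Sum>\<^sub>\<infinity>k. K n k * sqrt (e k))\<^sup>2" for n
      using power_mono[OF Sle[of n], of 2] by (simp add: power_mult_distrib)
    have S2s: "(\<lambda>n. (norm (S n))\<^sup>2) summable_on UNIV"
      by (rule summable_on_comparison_test[OF summable_on_cmult_right[OF upper(2)]]) (use Sle2 in auto)
    define \<Sigma> where "\<Sigma> = (\<Sum>\<^sub>\<infinity>n. (norm (S n))\<^sup>2)"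
    have Sig0: "\<Sigma> \<ge> 0" unfolding \<Sigma>_def by (rule infsum_nonneg) auto
    have "\<Sigma> \<le> (\<Sum>\<^sub>\<infinity>n. C2\<^sup>2 * (\<Sum>\<^sub>\<infinity>k. K n k * sqrt (e k))\<^sup>2)"
      unfolding \<Sigma>_def by (intro infsum_mono S2s summable_on_cmult_right upper Sle2)
    also have "\<dots> \<le> C2\<^sup>2 * (A1 * A2 * E)"
      unfolding infsum_cmult_right' by (intro mult_left_mono upper) auto
    finally have up: "\<Sigma> \<le> Y * E" by (simp add: Y_def mult.assoc)
    \<comment> \<open>A bound of the samples uniform in the height, needed for the exchange of sums in the
      recovery formula.\<close>
    define G where "G = C2 * sqrt E * A1"
    have G: "(\<Sum>\<^sub>\<infinity>k. norm (gauss_poly (Q k) (y + of_int k + \<nu>))) \<le> G" for y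
    proof -
      have "(\<Sum>\<^sub>\<infinity>k. norm (gauss_poly (Q k) (y + of_int k + \<nu>))) \<le> (\<Sum>\<^sub>\<infinity>k. C2 * sqrt E * exp (- \<bar>1 * of_int k + (y + \<nu>)\<bar>))"
      proof (intro infsum_mono Q(2) summable_on_cmult_right A1)
        fix k
        have "norm (gauss_poly (Q k) (y + of_int k + \<nu>)) \<le> C2 * exp (- \<bar>y + of_int k + \<nu>\<bar>) * sqrt (e k)" by (rule gb)
        also have "\<dots> \<le> C2 * exp (- \<bar>y + of_int k + \<nu>\<bar>) * sqrt E"
          using eE C2(1) by (intro mult_left_mono) auto
        finally show "norm (gauss_poly (Q k) (y + of_int k + \<nu>)) \<le> C2 * sqrt E * exp (- \<bar>1 * of_int k + (y + \<nu>)\<bar>)"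
          by (simp add: add_ac mult_ac)
      qed
      also have "\<dots> \<le> G"
        unfolding infsum_cmult_right' G_def using C2(1) E0 by (intro mult_left_mono A1) auto
      finally show ?thesis .
    qed
    \<comment> \<open>The matrix bounding the recovery of the values of the \<open>k\<close>-th coefficient at the \<open>j\<close>-th node
      from the samples.\<close>
    define H where "H j k n = W (n - node k - int j)" for j :: nat and k n :: int
    define v where "v j k = (\<Sum>\<^sub>\<infinity>n. H j k n * norm (S n))" for j :: nat and k :: int
    have Hsum: "(H j k has_sum \<omega>) UNIV" for j k
      unfolding H_def
      by (subst has_sum_reindex_bij_witness[where i="\<lambda>m. m + node k + int j" and j="\<lambda>n. n - node k - int j" and T=UNIV and h=W])
         (use W(2) in \<open>auto simp: \<omega>_def\<close>)
    have Hcol: "(\<Sum>k\<in>T. H j k n) \<le> \<omega>" if T: "finite T" for T j n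
    proof -
      have inj: "inj_on (\<lambda>k. n - node k - int j) T" using node_inj by (auto simp: inj_on_def inj_def)
      have "(\<Sum>k\<in>T. H j k n) = sum W ((\<lambda>k. n - node k - int j) ` T)"
        unfolding H_def by (simp add: sum.reindex[OF inj])
      also have "\<dots> \<le> \<omega>" unfolding \<omega>_def by (rule finite_sum_le_infsum[OF W(2)]) (use T W0 in auto)
      finally show ?thesis .
    qed
    have low: "(\<lambda>k. (v j k)\<^sup>2) summable_on UNIV" "(\<Sum>\<^sub>\<infinity>k. (v j k)\<^sup>2) \<le> \<omega> * \<omega> * \<Sigma>" for j
      using schur_test(2,3)[of "H j" \<omega> \<omega> "\<lambda>n. norm (S n)"] W0 Hsum[of j] Hcol S2s
      by (auto simp: v_def \<Sigma>_def has_sum_iff H_def[symmetric], auto simp: H_def)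
    have value_le: "norm (gauss_poly (Q k) (\<beta> * of_int (node k) + of_int k + \<nu> + \<beta> * real j)) \<le> v j k" if j: "j < N" for k j
    proof -
      let ?n = "node k + int j"
      have t: "\<beta> * of_int (node k) + of_int k + \<nu> + \<beta> * real j = \<beta> * of_int ?n + of_int k + \<nu>"
        by (simp add: algebra_simps)
      have "real j \<le> real N - 1" using j by linarith
      from mult_left_mono[OF this, of \<beta>] have "\<beta> * real j \<le> \<beta> * real N - \<beta>" using b by (simp add: algebra_simps)
      moreover have "0 \<le> \<beta> * real j" using b by simp
      ultimately have R: "\<bar>\<beta> * of_int ?n + of_int k + \<nu>\<bar> \<le> \<beta> * real N"
        unfolding t[symmetric] using node[of k] by (simp only: abs_le_iff) linarith
      have "norm (gauss_poly (Q k) (\<beta> * of_int ?n + of_int k + \<nu>)) \<le> (\<Sum>\<^sub>\<infinity>m. W m * norm (S (?n + m)))"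
        unfolding S_def by (rule kernel_recovers_value[OF b \<kappa>(1) \<alpha>(1) \<kappa>(2,3) W Q(1,2) G R])
      also have "\<dots> = v j k"
        unfolding v_def H_def
        by (rule infsum_reindex_bij_witness[where i="\<lambda>n. n - node k - int j" and j="\<lambda>m. ?n + m"]) auto
      finally show ?thesis by (simp only: t)
    qed
    have e_le: "e k \<le> C1 * (\<Sum>j<N. (v j k)\<^sup>2)" for k
    proof -
      let ?r = "\<beta> * of_int (node k) + of_int k + \<nu>"
      have "ennreal (e k) \<le> ennreal (C1 * (\<Sum>j<N. (norm (gauss_poly (Q k) (?r + \<beta> * real j)))\<^sup>2))"
        unfolding e(2)[symmetric] by (rule C1(2)[OF Q(1) node])
      then have "e k \<le> C1 * (\<Sum>j<N. (norm (gauss_poly (Q k) (?r + \<beta> * real j)))\<^sup>2)"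
        using C1(1) by (subst (asm) ennreal_le_iff) (auto intro!: sum_nonneg mult_nonneg_nonneg)
      also have "\<dots> \<le> C1 * (\<Sum>j<N. (v j k)\<^sup>2)"
        using C1(1) value_le by (intro mult_left_mono sum_mono power_mono) auto
      finally show ?thesis .
    qed
    have "((\<lambda>k. C1 * (\<Sum>j<N. (v j k)\<^sup>2)) has_sum C1 * (\<Sum>j<N. \<Sum>\<^sub>\<infinity>k. (v j k)\<^sup>2)) UNIV"
      by (intro has_sum_cmult_right has_sum_finite_sum has_sum_infsum low)
    from has_sum_mono[OF E this] have "E \<le> C1 * (\<Sum>j<N. \<Sum>\<^sub>\<infinity>k. (v j k)\<^sup>2)" using e_le by blast
    also have "\<dots> \<le> C1 * (\<Sum>j<N. \<omega> * \<omega> * \<Sigma>)"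
      using C1(1) low by (intro mult_left_mono sum_mono) auto
    finally have lo: "E \<le> X * \<Sigma>" by (simp add: X_def power2_eq_square mult_ac)
    have injZ: "inj Z" using b by (auto simp: Z_def inj_def)
    have "(fock_weighted F has_sum \<Sigma>) (range Z)"
      unfolding has_sum_reindex[OF injZ] o_def FS \<Sigma>_def by (rule has_sum_infsum[OF S2s])
    then show ?thesis using lo up Sig0 E0 by (auto simp: has_sum_iff E_def)
  qed
  have "range Z \<subseteq> strip" by (auto simp: Z_def strip_def)
  moreover have "\<exists>A>0. \<exists>B>0. \<forall>F\<in>fock_space \<nu> N. fock_weighted F summable_on range Z \<and>
        A * fock_norm_sq F \<le> infsum (fock_weighted F) (range Z) \<and>
        infsum (fock_weighted F) (range Z) \<le> B * fock_norm_sq F"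
  \<comment> \<open>Adding \<open>1\<close> makes the constants positive.\<close>
  proof (rule exI[of _ "1 / (X + 1)"], intro conjI, goal_cases)
    case 1 then show ?case using XY by simp
  next
    case 2 show ?case
    proof (rule exI[of _ "Y + 1"], intro conjI ballI, goal_cases)
      case 1 then show ?case using XY by simp
    next
      case (2 F) then show ?case using main by blast
    next
      case (3 F)
      then have "fock_norm_sq F \<le> (X + 1) * infsum (fock_weighted F) (range Z)"
        using main[of F] by (simp add: distrib_right)
      then show ?case using XY by (simp add: field_simps)
    next
      case (4 F) then show ?case using main[of F] by (simp add: distrib_right)
    qed
  qed
  ultimately show ?thesis unfolding sampling_def Z_def by blast
qed

end
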